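(* Let $n\ge 2$, $c>0$, and let $p,q\in\mathbb{R}^n$ with $p\neq q$. For any suitable integrable function $G:\mathbb{R}^n\times\mathbb{R}^n\times\mathbb{R}^n\times\mathbb{R}^n\to\mathbb{R}$, $$\frac{c}{p^0q^0}\int_{\mathbb{R}^n}\frac{dq'}{q'^0}\int_{\mathbb{R}^n}\frac{dp'}{p'^0}\,W(p,q|p',q')\,G(p,q,p',q')=\int_{\mathbb{S}^{n-1}}d\omega\;\frac{s\,\sigma(\varrho,\theta)}{p^0q^0}\,B_n(p,q,\omega)\,G(p,q,p',q').$$ Here the kernel is $B_n(p,q,\omega)=B(p,q,\omega)\,\big(A(p,q,\omega)\big)^{n-3}$ with $$B(p,q,\omega)=c\,\frac{(p^0+q^0)^2p^0q^0\left|\omega\cdot\left(\frac{p}{p^0}-\frac{q}{q^0}\right)\right|}{\left[(p^0+q^0)^2-(\omega\cdot[p+q])^2\right]^2},\qquad A(p,q,\omega)=\frac{(p^0+q^0)p^0q^0\left|\omega\cdot\left(\frac{p}{p^0}-\frac{q}{q^0}\right)\right|}{(p^0+q^0)^2-(\omega\cdot[p+q])^2}\,\frac{4}{\varrho},$$ and on the right-hand side the post-collisional momenta are $$p'=p+a(p,q,\omega)\,\omega,\qquad q'=q-a(p,q,\omega)\,\omega,\qquad a(p,q,\omega)=\frac{2(p^0+q^0)\{\omega\cdot(p^0q-q^0p)\}}{(p^0+q^0)^2-(\omega\cdot[p+q])^2},$$ and the angle $\theta$ is given by $$\cos\theta=1-\frac{8}{\varrho^2}\,\frac{\{\omega\c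dot(p^0q-q^0p)\}^2}{(p^0+q^0)^2-(\omega\cdot[p+q])^2}.$$
   Context: Notation. For a momentum $p\in\mathbb{R}^n$ the energy is $p^0=\sqrt{c^2+|p|^2}$ and $p^\mu=(p^0,p)$; similarly for $q,p',q'$. Indices are lowered with the Minkowski metric $\mathrm{diag}(-1,1,\ldots,1)$ and repeated indices are summed, so $p^\mu q_\mu=-p^0q^0+p\cdot q$. Set $$\varrho=\sqrt{(p^\mu-q^\mu)(p_\mu-q_\mu)}=\sqrt{2(p^0q^0-p\cdot q-c^2)},\qquad s=-(p^\mu+q^\mu)(p_\mu+q_\mu)=2(p^0q^0-p\cdot q+c^2).$$ The transition rate is $$W(p,q|p',q')=\frac12\Big(\frac{\varrho}{2}\Big)^{3-n}s\,\sigma(\varrho,\theta)\,\delta^{(1+n)}(p^\mu+q^\mu-p'^\mu-q'^\mu),$$ where $\varrho=\varrho(p,q)$, $s=s(p,q)$, $\sigma(\varrho,\theta)$ is a given function (the differential cross-section), and on the left-hand side of the claim $\theta$ is the angle defined by $\cos\theta=(p^\mu-q^\mu)(p'_\mu-q'_\mu)/\varrho^2$, which is well defined when $p^\mu+q^\mu=p'^\mu+q'^\mu$. $\delta^{(1+n)}$ is the product of $1+n$ Dirac delta functions, with the usual meaning: the $n$ spatial deltas set $q'=p+q-p'$, and the remaining delta $\delta(g(p'))$, $g(p')=p^0+q^0-\sqrt{c^2+|p'|^2}-\sqrt{c^2+|p+q-p'|^2}$, is the measure $|\nabla g|^{-1}d\mathcal{H}^{n-1}$ on $\{g=0\}$.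 "Suitable integrable" means that $\sigma$ and $G$ are measurable and such that the integrals converge absolutely. $d\omega$ is the surface measure on the unit sphere $\mathbb{S}^{n-1}$. When $n=2$, $B_n$ is understood for almost every $\omega$ (those with $A\neq0$). *)

theory Defs
  imports "HOL-Analysis.Analysis"
begin

definition hausdorff_premeasure :: "nat \<Rightarrow> real \<Rightarrow> 'a::metric_space set \<Rightarrow> ennreal" where
  "hausdorff_premeasure d \<delta> S =
    (INF U \<in> {U :: nat \<Rightarrow> 'a set. S \<subseteq> (\<Union>i. U i) \<and> (\<forall>i. bounded (U i) \<and> diameter (U i) \<le> \<delta>)}.
       \<Sum>i. if U i = {} then 0
           else ennreal (unit_ball_vol (real d) * (diameter (U i) / 2) ^ d))"

definition hausdorff_outer :: "nat \<Rightarrow> 'a::metric_space set \<Rightarrow> ennreal" where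
  "hausdorff_outer d S = (SUP \<delta>\<in>{0<..}. hausdorff_premeasure d \<delta> S)"

(* The outer measure is a metric outer measure, hence countably additive on the Borel
   sets, so this measure takes its values there (measure_of would give the zero measure
   otherwise). The factor unit_ball_vol d makes it agree with Lebesgue measure on R^d. *)
definition hausdorff_measure :: "nat \<Rightarrow> 'a::metric_space measure" where
  "hausdorff_measure d = measure_of UNIV (sets borel) (hausdorff_outer d)"

definition gradient :: "('a::real_inner \<Rightarrow> real) \<Rightarrow> 'a \<Rightarrow> 'a" where
  "gradient f x = (THE D. GDERIV f x :> D)"

definition sphere_measure :: "(real ^ 'n) measure" where
  "sphere_measure = restrict_space (hausdorff_measure (CARD('n) - 1)) (sphere 0 1)"

(* The Dirac delta of a scalar function g whose gradient does not vanish on {g = 0}. *)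
definition delta_level :: "(real ^ 'n \<Rightarrow> real) \<Rightarrow> (real ^ 'n) measure" where
  "delta_level g =
     density (restrict_space (hausdorff_measure (CARD('n) - 1)) {x. g x = 0})
             (\<lambda>x. ennreal (1 / norm (gradient g x)))"

definition energy :: "real \<Rightarrow> real ^ 'n \<Rightarrow> real" where
  "energy c p = sqrt (c\<^sup>2 + (norm p)\<^sup>2)"

definition four_momentum :: "real \<Rightarrow> real ^ 'n \<Rightarrow> real \<times> (real ^ 'n)" where
  "four_momentum c p = (energy c p, p)"

definition minkowski :: "real \<times> (real ^ 'n) \<Rightarrow> real \<times> (real ^ 'n) \<Rightarrow> real" where
  "minkowski x y = - (fst x * fst y) + snd x \<bullet> snd y"

definition rho :: "real \<Rightarrow> real ^ 'n \<Rightarrow> real ^ 'n \<Rightarrow> real" where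
  "rho c p q = sqrt (minkowski (four_momentum c p - four_momentum c q)
                               (four_momentum c p - four_momentum c q))"

definition mandelstam_s :: "real \<Rightarrow> real ^ 'n \<Rightarrow> real ^ 'n \<Rightarrow> real" where
  "mandelstam_s c p q = - minkowski (four_momentum c p + four_momentum c q)
                                    (four_momentum c p + four_momentum c q)"

definition theta :: "real \<Rightarrow> real ^ 'n \<Rightarrow> real ^ 'n \<Rightarrow> real ^ 'n \<Rightarrow> real ^ 'n \<Rightarrow> real" where
  "theta c p q p' q' =
     arccos (minkowski (four_momentum c p - four_momentum c q)
                       (four_momentum c p' - four_momentum c q') / (rho c p q)\<^sup>2)"

(* delta^(1+n)(p + q - p' - q') as a measure in the pair (p', q'): the spatial deltas put
   q' = p + q - p', and the energy delta is then a delta of a function of p' alone. *)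
definition collision_delta ::
  "real \<Rightarrow> real ^ 'n \<Rightarrow> real ^ 'n \<Rightarrow> ((real ^ 'n) \<times> (real ^ 'n)) measure" where
  "collision_delta c p q =
     distr (delta_level (\<lambda>p'. energy c p + energy c q - energy c p' - energy c (p + q - p')))
           borel (\<lambda>p'. (p', p + q - p'))"

(* The transition rate is the distribution W(p,q|p',q') = W_factor * collision_delta. *)
definition W_factor ::
  "real \<Rightarrow> (real \<Rightarrow> real \<Rightarrow> real) \<Rightarrow> real ^ 'n \<Rightarrow> real ^ 'n \<Rightarrow> real ^ 'n \<Rightarrow> real ^ 'n \<Rightarrow> real" where
  "W_factor c \<sigma> p q p' q' =
     1 / 2 * (rho c p q / 2) powi (3 - int CARD('n)) * mandelstam_s c p q
       * \<sigma> (rho c p q) (theta c p q p' q')"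

definition coll_denom :: "real \<Rightarrow> real ^ 'n \<Rightarrow> real ^ 'n \<Rightarrow> real ^ 'n \<Rightarrow> real" where
  "coll_denom c p q \<omega> = (energy c p + energy c q)\<^sup>2 - (\<omega> \<bullet> (p + q))\<^sup>2"

definition kernel_B :: "real \<Rightarrow> real ^ 'n \<Rightarrow> real ^ 'n \<Rightarrow> real ^ 'n \<Rightarrow> real" where
  "kernel_B c p q \<omega> =
     c * ((energy c p + energy c q)\<^sup>2 * energy c p * energy c q
            * \<bar>\<omega> \<bullet> (p /\<^sub>R energy c p - q /\<^sub>R energy c q)\<bar>)
       / (coll_denom c p q \<omega>)\<^sup>2"

definition kernel_A :: "real \<Rightarrow> real ^ 'n \<Rightarrow> real ^ 'n \<Rightarrow> real ^ 'n \<Rightarrow> real" where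
  "kernel_A c p q \<omega> =
     ((energy c p + energy c q) * energy c p * energy c q
            * \<bar>\<omega> \<bullet> (p /\<^sub>R energy c p - q /\<^sub>R energy c q)\<bar>)
       / coll_denom c p q \<omega> * (4 / rho c p q)"

(* For CARD('n) = 2 and kernel_A = 0 the power is 0; this happens on a null set of the sphere. *)
definition kernel_Bn :: "real \<Rightarrow> real ^ 'n \<Rightarrow> real ^ 'n \<Rightarrow> real ^ 'n \<Rightarrow> real" where
  "kernel_Bn c p q \<omega> = kernel_B c p q \<omega> * kernel_A c p q \<omega> powi (int CARD('n) - 3)"

definition coll_a :: "real \<Rightarrow> real ^ 'n \<Rightarrow> real ^ 'n \<Rightarrow> real ^ 'n \<Rightarrow> real" where
  "coll_a c p q \<omega> =
     2 * (energy c p + energy c q) * (\<omega> \<bullet> (energy c p *\<^sub>R q - energy c q *\<^sub>R p))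
       / coll_denom c p q \<omega>"

definition post_p :: "real \<Rightarrow> real ^ 'n \<Rightarrow> real ^ 'n \<Rightarrow> real ^ 'n \<Rightarrow> real ^ 'n" where
  "post_p c p q \<omega> = p + coll_a c p q \<omega> *\<^sub>R \<omega>"

definition post_q :: "real \<Rightarrow> real ^ 'n \<Rightarrow> real ^ 'n \<Rightarrow> real ^ 'n \<Rightarrow> real ^ 'n" where
  "post_q c p q \<omega> = q - coll_a c p q \<omega> *\<^sub>R \<omega>"

definition theta_omega :: "real \<Rightarrow> real ^ 'n \<Rightarrow> real ^ 'n \<Rightarrow> real ^ 'n \<Rightarrow> real" where
  "theta_omega c p q \<omega> =
     arccos (1 - 8 / (rho c p q)\<^sup>2
                 * ((\<omega> \<bullet> (energy c p *\<^sub>R q - energy c q *\<^sub>R p))\<^sup>2 / coll_denom c p q \<omega>))"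

end

theory Submission
  imports Defs
begin

text \<open>
  The delta measure on the left lives on the energy shell, the set of momenta \<open>x\<close> for which
  \<open>x\<close> and \<open>p + q - x\<close> have the same total energy as \<open>p\<close> and \<open>q\<close>. The incoming momentum \<open>p\<close>
  lies on this shell. Squaring the conservation law twice shows that a ray \<open>p + t \<omega>\<close> with \<open>t > 0\<close>
  meets the shell exactly when \<open>\<omega>\<close> has positive product with the vector
  \<open>p\<^sup>0 q - q\<^sup>0 p\<close>, and then only at \<open>t = a(\<omega>)\<close> (\<open>energy_gap_ray\<close>, \<open>energy_gap_post\<close>). So, up to
  the point \<open>p\<close>, the shell is the graph of the radius \<open>a\<close> over an open half of the unit sphere
  (\<open>energy_shell\<close>), and the theorem is a change of variables along
  \<open>\<omega> \<mapsto> p + a(\<omega>) \<omega>\<close>, a map between two hypersurfaces that both carry the Hausdorff measure.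

  The area formula for such radial graphs is proved from the definition of the Hausdorff
  measure (\<open>hausdorff_measure_radial_graph\<close>). Near a point the map is, up to a factor arbitrarily
  close to \<open>1\<close> in all distances, an injective linear map on the tangent hyperplane of the sphere; distances
  control Hausdorff measure (\<open>hausdorff_outer_image_le\<close>), and comparisons that hold locally for
  every factor \<open>K > 1\<close> force equality of measures (\<open>emeasure_eq_of_local_comparison\<close>). What remains is the
  factor by which a linear map scales the Hausdorff measure of a hyperplane
  (\<open>hausdorff_graph_over_hyperplane\<close>). There the Hausdorff measure is translation invariant and hence
  a constant multiple of the Lebesgue volume of cylinders (\<open>hausdorff_hyperplane_cylinder\<close>). The
  constant is the same for every hyperplane and cancels, because both hypersurfaces carry the Hausdorff measure.

  For a radial graph the Jacobian is \<open>a\<^bsup>n-1\<^esup> |\<nabla>g| / |\<omega> \<cdot> \<nabla>g|\<close>, where \<open>g\<close> is the energy gap, because the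
  graph is a level set of \<open>g\<close> (\<open>coll_a_tangency\<close>, \<open>radial_jacobian_coll_a\<close>). The factor \<open>|\<nabla>g|\<close>
  cancels against the density of the delta measure, and the radial derivative of \<open>g\<close> at the
  outgoing momenta is, up to the outgoing energies, the same product
  \<open>\<omega> \<cdot> (p\<^sup>0 q - q\<^sup>0 p)\<close> that appears in the kernel (\<open>radial_gap_gradient\<close>). This turns the integrand into
  twice that of the right-hand side (\<open>kernel_Bn_eq\<close>), integrated over the half sphere. Since
  opposite directions give the same collision and the integrand vanishes on the equator, twice the
  half sphere is the whole sphere (\<open>integral_sphere_even\<close>).
\<close>

section \<open>Hausdorff measures are Borel measures\<close>

definition covering_cost :: "nat \<Rightarrow> (nat \<Rightarrow> 'a::metric_space set) \<Rightarrow> ennreal" where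
  "covering_cost d U =
     (\<Sum>i. if U i = {} then 0 else ennreal (unit_ball_vol (real d) * (diameter (U i) / 2) ^ d))"

lemma hausdorff_premeasure_le:
  assumes "S \<subseteq> (\<Union>i. U i)" "\<And>i. bounded (U i)" "\<And>i. diameter (U i) \<le> \<delta>"
  shows "hausdorff_premeasure d \<delta> S \<le> covering_cost d U"
  unfolding hausdorff_premeasure_def covering_cost_def
  by (rule INF_lower) (use assms in auto)

lemma le_hausdorff_premeasure:
  assumes "\<And>U. S \<subseteq> (\<Union>i. U i) \<Longrightarrow> (\<And>i. bounded (U i)) \<Longrightarrow> (\<And>i. diameter (U i) \<le> \<delta>)
             \<Longrightarrow> x \<le> covering_cost d U"
  shows "x \<le> hausdorff_premeasure d \<delta> S"
  unfolding hausdorff_premeasure_def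
  by (rule INF_greatest) (use assms in \<open>auto simp: covering_cost_def\<close>)

lemma hausdorff_premeasure_approx:
  assumes "hausdorff_premeasure d \<delta> S < y"
  obtains U where "S \<subseteq> (\<Union>i. U i)" "\<And>i. bounded (U i)" "\<And>i. diameter (U i) \<le> \<delta>"
    "covering_cost d U < y"
  using assms unfolding hausdorff_premeasure_def INF_less_iff
  by (auto simp: covering_cost_def)

lemma hausdorff_premeasure_le_outer: "\<delta> > 0 \<Longrightarrow> hausdorff_premeasure d \<delta> S \<le> hausdorff_outer d S"
  unfolding hausdorff_outer_def by (rule SUP_upper) auto

lemma hausdorff_outer_le:
  "(\<And>\<delta>. \<delta> > 0 \<Longrightarrow> hausdorff_premeasure d \<delta> S \<le> x) \<Longrightarrow> hausdorff_outer d S \<le> x"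
  unfolding hausdorff_outer_def by (rule SUP_least) auto

lemma hausdorff_premeasure_antimono:
  "\<delta> \<le> \<epsilon> \<Longrightarrow> hausdorff_premeasure d \<epsilon> S \<le> hausdorff_premeasure d \<delta> S"
  by (rule le_hausdorff_premeasure, rule hausdorff_premeasure_le) (auto intro: order_trans)

lemma hausdorff_premeasure_mono:
  "S \<subseteq> T \<Longrightarrow> hausdorff_premeasure d \<delta> S \<le> hausdorff_premeasure d \<delta> T"
  by (rule le_hausdorff_premeasure, rule hausdorff_premeasure_le) auto

lemma hausdorff_outer_mono: "S \<subseteq> T \<Longrightarrow> hausdorff_outer d S \<le> hausdorff_outer d T"
  by (rule hausdorff_outer_le)
     (meson hausdorff_premeasure_mono hausdorff_premeasure_le_outer order_trans)

lemma hausdorff_outer_empty [simp]: "hausdorff_outer d ({} :: 'a::metric_space set) = 0"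
proof -
  have "hausdorff_premeasure d \<delta> ({} :: 'a set) \<le> covering_cost d (\<lambda>_. {} :: 'a set)" if "\<delta> > 0" for \<delta>
    by (rule hausdorff_premeasure_le) (use that in auto)
  then have "hausdorff_outer d ({} :: 'a set) \<le> 0"
    by (intro hausdorff_outer_le) (auto simp: covering_cost_def)
  then show ?thesis by simp
qed

text \<open>
  The two maps are compared with
  each other, instead of one map being Lipschitz, because the natural comparison of a curved
  piece with its linear model runs through a common parameter set. A cover of \<open>h ` A\<close> is pulled
  back to \<open>A\<close> and pushed forward by \<open>f\<close>, which multiplies every diameter by at most \<open>K\<close>.
\<close>
lemma hausdorff_outer_image_le:
  fixes f :: "'a \<Rightarrow> 'b::metric_space" and h :: "'a \<Rightarrow> 'c::metric_space"
  assumes K: "K > 0"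
    and lip: "\<And>x y. x \<in> A \<Longrightarrow> y \<in> A \<Longrightarrow> dist (f x) (f y) \<le> K * dist (h x) (h y)"
  shows "hausdorff_outer d (f ` A) \<le> ennreal (K ^ d) * hausdorff_outer d (h ` A)"
proof (rule hausdorff_outer_le)
  fix \<delta> :: real assume \<delta>: "\<delta> > 0"
  have *: "ennreal (inverse (K ^ d)) * hausdorff_premeasure d \<delta> (f ` A) \<le> hausdorff_premeasure d (\<delta> / K) (h ` A)"
  proof (rule le_hausdorff_premeasure)
    fix U :: "nat \<Rightarrow> 'c set"
    assume U: "h ` A \<subseteq> (\<Union>i. U i)" "\<And>i. bounded (U i)" "\<And>i. diameter (U i) \<le> \<delta> / K"
    define V where "V i = f ` (A \<inter> h -` U i)" for i
    have dV: "dist a b \<le> K * diameter (U i)" if ab: "a \<in> V i" "b \<in> V i" for a b i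
    proof -
      obtain x y where xy: "x \<in> A" "y \<in> A" "h x \<in> U i" "h y \<in> U i" "a = f x" "b = f y"
        using ab unfolding V_def by blast
      have "dist (h x) (h y) \<le> diameter (U i)"
        using diameter_bounded_bound[OF U(2)] xy by auto
      with lip[OF xy(1,2)] K show ?thesis unfolding xy
        by (meson mult_left_mono order_trans less_imp_le)
    qed
    have diamV: "diameter (V i) \<le> K * diameter (U i)" for i
    proof (cases "V i = {}")
      case True
      then show ?thesis using K diameter_ge_0[OF U(2)] by auto
    next
      case False
      then show ?thesis unfolding diameter_def[of "V i"] using dV by (auto intro!: cSUP_least)
    qed
    have bV: "bounded (V i)" for i
    proof (cases "V i = {}")
      case False
      then obtain a where "a \<in> V i" by auto
      then have "V i \<subseteq> cball a (K * diameter (U i))" using dV by auto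
      then show ?thesis using bounded_cball bounded_subset by blast
    qed auto
    have "hausdorff_premeasure d \<delta> (f ` A) \<le> covering_cost d V"
    proof (rule hausdorff_premeasure_le)
      show "f ` A \<subseteq> (\<Union>i. V i)"
      proof
        fix y assume "y \<in> f ` A"
        then obtain x where x: "x \<in> A" "y = f x" by auto
        then obtain i where "h x \<in> U i" using U(1) by blast
        with x show "y \<in> (\<Union>i. V i)" by (auto simp: V_def)
      qed
      show "diameter (V i) \<le> \<delta>" for i
        using diamV[of i] U(3)[of i] K by (simp add: field_simps)
    qed (rule bV)
    also have "\<dots> \<le> ennreal (K ^ d) * covering_cost d U"
      unfolding covering_cost_def ennreal_suminf_cmult[symmetric]
    proof (intro suminf_le summableI)
      fix i
      show "(if V i = {} then 0 else ennreal (unit_ball_vol (real d) * (diameter (V i) / 2) ^ d))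
        \<le> ennreal (K ^ d) * (if U i = {} then 0 else ennreal (unit_ball_vol (real d) * (diameter (U i) / 2) ^ d))"
      proof (cases "V i = {}")
        case False
        then have "U i \<noteq> {}" by (auto simp: V_def)
        moreover have "(diameter (V i) / 2) ^ d \<le> (K * diameter (U i) / 2) ^ d"
          by (rule power_mono) (use diamV[of i] diameter_ge_0[OF bV] in auto)
        then have "unit_ball_vol (real d) * (diameter (V i) / 2) ^ d
            \<le> K ^ d * (unit_ball_vol (real d) * (diameter (U i) / 2) ^ d)"
          using mult_left_mono[of _ _ "unit_ball_vol (real d)"]
          by (fastforce simp: power_mult_distrib power_divide field_simps)
        ultimately show ?thesis using False K
          by (auto simp flip: ennreal_mult simp: diameter_ge_0[OF U(2)] intro!: ennreal_leI)
      qed auto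
    qed
    finally have "ennreal (inverse (K ^ d)) * hausdorff_premeasure d \<delta> (f ` A)
        \<le> ennreal (inverse (K ^ d)) * (ennreal (K ^ d) * covering_cost d U)"
      by (rule mult_left_mono) auto
    also have "\<dots> = covering_cost d U"
      using K by (simp add: mult.assoc[symmetric] flip: ennreal_mult)
    finally show "ennreal (inverse (K ^ d)) * hausdorff_premeasure d \<delta> (f ` A) \<le> covering_cost d U" .
  qed
  have "hausdorff_premeasure d \<delta> (f ` A)
      = ennreal (K ^ d) * (ennreal (inverse (K ^ d)) * hausdorff_premeasure d \<delta> (f ` A))"
    using K by (simp add: mult.assoc[symmetric] flip: ennreal_mult)
  also have "\<dots> \<le> ennreal (K ^ d) * hausdorff_outer d (h ` A)"
    using order_trans[OF * hausdorff_premeasure_le_outer] \<delta> K by (intro mult_left_mono) auto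
  finally show "hausdorff_premeasure d \<delta> (f ` A) \<le> ennreal (K ^ d) * hausdorff_outer d (h ` A)" .
qed

lemma covering_cost_prod_decode:
  "covering_cost d (\<lambda>k. U (fst (prod_decode k)) (snd (prod_decode k))) = (\<Sum>m. covering_cost d (U m))"
proof -
  define f where "f = (\<lambda>(m, i). if U m i = {} then 0
        else ennreal (unit_ball_vol (real d) * (diameter (U m i) / 2) ^ d))"
  have "(\<Sum>k. f (prod_decode k)) = (\<Sum>m. \<Sum>i. f (m, i))"
    using suminf_ennreal_2dimen[of "\<lambda>m. \<Sum>i. f (m, i)" f] by (simp add: o_def)
  then show ?thesis
    by (simp add: covering_cost_def f_def split_beta cong: if_cong)
qed

text \<open>
  Covers of the single sets, each optimal up to a share of \<open>e\<close> from a geometric series, are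
  enumerated together by the pairing of natural numbers.
\<close>
lemma hausdorff_premeasure_countable_subadditive:
  fixes A :: "nat \<Rightarrow> 'a::metric_space set"
  shows "hausdorff_premeasure d \<delta> (\<Union>m. A m) \<le> (\<Sum>m. hausdorff_premeasure d \<delta> (A m))"
proof (rule ennreal_le_epsilon)
  fix e :: real
  assume fin: "(\<Sum>m. hausdorff_premeasure d \<delta> (A m)) < top" and e: "0 < e"
  have "\<exists>U. A m \<subseteq> (\<Union>i. U i) \<and> (\<forall>i. bounded (U i) \<and> diameter (U i) \<le> \<delta>)
      \<and> covering_cost d U \<le> hausdorff_premeasure d \<delta> (A m) + e * (1/2) ^ Suc m" for m
  proof -
    have "hausdorff_premeasure d \<delta> (A m) < top"
      using fin ennreal_suminf_lessD by auto
    then have "hausdorff_premeasure d \<delta> (A m) < hausdorff_premeasure d \<delta> (A m) + e * (1/2) ^ Suc m"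
      using e by (cases "hausdorff_premeasure d \<delta> (A m)") (auto simp flip: ennreal_plus simp: ennreal_less_iff)
    from hausdorff_premeasure_approx[OF this] show ?thesis by (metis less_imp_le)
  qed
  then obtain U where U: "\<And>m. A m \<subseteq> (\<Union>i. U m i)" "\<And>m i. bounded (U m i)" "\<And>m i. diameter (U m i) \<le> \<delta>"
    and cost: "\<And>m. covering_cost d (U m) \<le> hausdorff_premeasure d \<delta> (A m) + ennreal (e * (1/2) ^ Suc m)"
    by metis
  have "hausdorff_premeasure d \<delta> (\<Union>m. A m)
      \<le> covering_cost d (\<lambda>k. U (fst (prod_decode k)) (snd (prod_decode k)))"
  proof (rule hausdorff_premeasure_le)
    show "(\<Union>m. A m) \<subseteq> (\<Union>k. U (fst (prod_decode k)) (snd (prod_decode k)))"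
    proof
      fix x assume "x \<in> (\<Union>m. A m)"
      then obtain m i where "x \<in> U m i" using U(1) by blast
      then show "x \<in> (\<Union>k. U (fst (prod_decode k)) (snd (prod_decode k)))"
        by (intro UN_I[of "prod_encode (m, i)"]) auto
    qed
  qed (use U in auto)
  also have "\<dots> = (\<Sum>m. covering_cost d (U m))"
    by (rule covering_cost_prod_decode)
  also have "\<dots> \<le> (\<Sum>m. hausdorff_premeasure d \<delta> (A m) + ennreal (e * (1/2) ^ Suc m))"
    by (intro suminf_le cost summableI)
  also have "\<dots> = (\<Sum>m. hausdorff_premeasure d \<delta> (A m)) + (\<Sum>m. ennreal (e * (1/2) ^ Suc m))"
    by (intro suminf_add[symmetric] summableI)
  also have "(\<Sum>m. ennreal (e * (1/2) ^ Suc m)) = ennreal e"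
    using sums_mult[OF power_half_series, of e] e by (intro suminf_ennreal_eq) auto
  finally show "hausdorff_premeasure d \<delta> (\<Union>m. A m) \<le> (\<Sum>m. hausdorff_premeasure d \<delta> (A m)) + ennreal e" .
qed

lemma hausdorff_outer_UN_le:
  fixes A :: "nat \<Rightarrow> 'a::metric_space set"
  shows "hausdorff_outer d (\<Union>m. A m) \<le> (\<Sum>m. hausdorff_outer d (A m))"
proof (rule hausdorff_outer_le)
  fix \<delta> :: real assume "\<delta> > 0"
  then show "hausdorff_premeasure d \<delta> (\<Union>m. A m) \<le> (\<Sum>m. hausdorff_outer d (A m))"
    by (intro order_trans[OF hausdorff_premeasure_countable_subadditive] suminf_le summableI
          hausdorff_premeasure_le_outer)
qed

lemma outer_measure_space_hausdorff_outer:
  "outer_measure_space (Pow UNIV) (hausdorff_outer d :: 'a::metric_space set \<Rightarrow> ennreal)"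
  by (auto simp: outer_measure_space_def positive_def increasing_def countably_subadditive_def
      hausdorff_outer_mono hausdorff_outer_UN_le)

lemma hausdorff_outer_Un_le:
  "hausdorff_outer d (A \<union> B) \<le> hausdorff_outer d A + hausdorff_outer d B"
proof -
  have "(\<lambda>n::nat. if n = 0 then A else if n = 1 then B else {}) ` UNIV = {A, B, {}}"
    by (auto simp: image_iff)
  then have *: "(\<Union>n::nat. if n = 0 then A else if n = 1 then B else {}) = A \<union> B"
    by auto
  have "hausdorff_outer d (\<Union>n::nat. if n = 0 then A else if n = 1 then B else {})
      \<le> (\<Sum>n::nat. hausdorff_outer d (if n = 0 then A else if n = 1 then B else {}))"
    by (rule hausdorff_outer_UN_le)
  also have "\<dots> = (\<Sum>n\<in>{0,1::nat}. hausdorff_outer d (if n = 0 then A else if n = 1 then B else {}))"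
    by (rule suminf_finite) auto
  finally show ?thesis unfolding * by simp
qed

text \<open>
  At scales below the distance of the two sets, no member of a cover meets both of them, so every
  cover splits into a cover of each.
\<close>
lemma hausdorff_outer_Un_separated:
  fixes A B :: "'a::metric_space set"
  assumes \<eta>: "\<eta> > 0" and sep: "\<And>x y. x \<in> A \<Longrightarrow> y \<in> B \<Longrightarrow> \<eta> \<le> dist x y"
  shows "hausdorff_outer d (A \<union> B) = hausdorff_outer d A + hausdorff_outer d B"
proof (rule antisym[OF hausdorff_outer_Un_le])
  have small: "hausdorff_premeasure d \<delta> A + hausdorff_premeasure d \<delta> B \<le> hausdorff_outer d (A \<union> B)"
    if \<delta>: "0 < \<delta>" "\<delta> < \<eta>" for \<delta>
  proof (rule order_trans[OF le_hausdorff_premeasure hausdorff_premeasure_le_outer[OF \<delta>(1)]])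
    fix U :: "nat \<Rightarrow> 'a set"
    assume U: "A \<union> B \<subseteq> (\<Union>i. U i)" "\<And>i. bounded (U i)" "\<And>i. diameter (U i) \<le> \<delta>"
    \<comment> \<open>the members of the cover that meet \<open>X\<close>\<close>
    define V where "V X i = (if U i \<inter> X = {} then {} else U i)" for X i
    have V: "X \<subseteq> (\<Union>i. V X i)" "\<And>i. bounded (V X i)" "\<And>i. diameter (V X i) \<le> \<delta>" if "X \<subseteq> A \<union> B" for X
      using U \<delta>(1) that by (auto simp: V_def dest!: subsetD)
    have one: "U i \<inter> A = {} \<or> U i \<inter> B = {}" for i
      using sep diameter_bounded_bound[OF U(2)[of i]] U(3)[of i] \<delta>(2) by fastforce
    have "hausdorff_premeasure d \<delta> A + hausdorff_premeasure d \<delta> B \<le> covering_cost d (V A) + covering_cost d (V B)"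
      by (intro add_mono hausdorff_premeasure_le V) auto
    also have "\<dots> = (\<Sum>i. (if V A i = {} then 0 else ennreal (unit_ball_vol (real d) * (diameter (V A i) / 2) ^ d))
        + (if V B i = {} then 0 else ennreal (unit_ball_vol (real d) * (diameter (V B i) / 2) ^ d)))"
      unfolding covering_cost_def by (intro suminf_add summableI)
    also have "\<dots> \<le> covering_cost d U"
      unfolding covering_cost_def
    proof (intro suminf_le summableI)
      fix i
      show "(if V A i = {} then 0 else ennreal (unit_ball_vol (real d) * (diameter (V A i) / 2) ^ d))
        + (if V B i = {} then 0 else ennreal (unit_ball_vol (real d) * (diameter (V B i) / 2) ^ d))
        \<le> (if U i = {} then 0 else ennreal (unit_ball_vol (real d) * (diameter (U i) / 2) ^ d))"
        using one[of i] by (auto simp: V_def)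
    qed
    finally show "hausdorff_premeasure d \<delta> A + hausdorff_premeasure d \<delta> B \<le> covering_cost d U" .
  qed
  have "hausdorff_premeasure d \<delta> A + hausdorff_premeasure d \<epsilon> B \<le> hausdorff_outer d (A \<union> B)"
    if "0 < \<delta>" "0 < \<epsilon>" for \<delta> \<epsilon>
  proof -
    define m where "m = min (min \<delta> \<epsilon>) (\<eta> / 2)"
    have "hausdorff_premeasure d \<delta> A + hausdorff_premeasure d \<epsilon> B
        \<le> hausdorff_premeasure d m A + hausdorff_premeasure d m B"
      by (intro add_mono hausdorff_premeasure_antimono) (auto simp: m_def)
    also have "\<dots> \<le> hausdorff_outer d (A \<union> B)"
      by (rule small) (use that \<eta> in \<open>auto simp: m_def\<close>)
    finally show ?thesis .
  qed
  then have "(SUP \<epsilon>\<in>{0<..}. SUP \<delta>\<in>{0<..}. hausdorff_premeasure d \<delta> A + hausdorff_premeasure d \<epsilon> B)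
      \<le> hausdorff_outer d (A \<union> B)"
    by (intro SUP_least) auto
  then show "hausdorff_outer d A + hausdorff_outer d B \<le> hausdorff_outer d (A \<union> B)"
    unfolding hausdorff_outer_def[of d A] hausdorff_outer_def[of d B]
    by (simp only: ennreal_SUP_add_right ennreal_SUP_add_left greaterThan_non_empty not_False_eq_True)
qed

text \<open>
  Additivity on separated sets suffices for closed sets to be measurable in the sense of
  Caratheodory. The part of \<open>X\<close> outside \<open>C\<close> is exhausted by the sets \<open>Y k\<close> of points at
  distance at least \<open>1 / (k + 1)\<close> from \<open>C\<close>, and each \<open>Y k\<close> is separated from \<open>C\<close>. What \<open>Y n\<close> misses
  is covered by the shells \<open>R k\<close> with \<open>k \<ge> n\<close>; since shells whose indices differ by two are separated,
  the measures of all shells have a finite sum, and its tails vanish.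
\<close>
lemma closed_in_lambda_system_hausdorff_outer:
  fixes C :: "'a::metric_space set"
  assumes C: "closed C"
  shows "C \<in> lambda_system UNIV (Pow UNIV) (hausdorff_outer d)"
proof (cases "C = {}")
  case True
  then show ?thesis by (simp add: lambda_system_def)
next
  case ne: False
  let ?H = "hausdorff_outer d :: 'a set \<Rightarrow> ennreal"
  have "?H (X \<inter> C) + ?H (X - C) \<le> ?H X" for X
  proof (cases "?H X = top")
    case fin: False
    define Y where "Y k = {x \<in> X. 1 / real (Suc k) \<le> infdist x C}" for k
    define R where "R k = {x \<in> X. 1 / real (Suc (Suc k)) \<le> infdist x C \<and> infdist x C < 1 / real (Suc k)}" for k
    have dist_gap: "infdist x C - infdist y C \<le> dist x y" for x y
      using infdist_triangle[of x C y] by linarith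
    have rings: "(\<Sum>k<N. ?H (R (2 * k + b))) \<le> ?H (\<Union>k<N. R (2 * k + b))" for N b
    proof (induction N)
      case (Suc N)
      have gap: "1 / real (2 * N + b) - 1 / real (2 * N + b + 1) \<le> dist x y"
        if x: "x \<in> (\<Union>k<N. R (2 * k + b))" and y: "y \<in> R (2 * N + b)" for x y
      proof -
        obtain k where k: "k < N" "x \<in> R (2 * k + b)" using x by auto
        have "1 / real (2 * N + b) \<le> 1 / real (Suc (Suc (2 * k + b)))"
          using k(1) by (intro divide_left_mono) auto
        also have "\<dots> \<le> infdist x C" using k(2) by (simp add: R_def)
        finally show ?thesis using dist_gap[of x y] y by (simp add: R_def)
      qed
      have "(\<Sum>k<Suc N. ?H (R (2 * k + b))) \<le> ?H (\<Union>k<N. R (2 * k + b)) + ?H (R (2 * N + b))"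
        using Suc by (simp add: add_right_mono)
      also have "\<dots> = ?H ((\<Union>k<N. R (2 * k + b)) \<union> R (2 * N + b))"
      proof (cases "N = 0")
        case False
        show ?thesis
          by (rule hausdorff_outer_Un_separated[symmetric, OF _ gap])
             (use False in \<open>auto intro!: divide_strict_left_mono\<close>)
      qed simp
      finally show ?case by (simp add: lessThan_Suc Un_commute)
    qed simp
    have rings_X: "(\<Sum>k. ?H (R (2 * k + b))) \<le> ?H X" for b
    proof (rule suminf_le_const[OF summableI])
      fix N
      show "(\<Sum>k<N. ?H (R (2 * k + b))) \<le> ?H X"
        by (rule order_trans[OF rings hausdorff_outer_mono]) (auto simp: R_def)
    qed
    \<comment> \<open>even and odd shells are summed separately, so that neighbouring shells never occur together\<close>
    have split: "(\<Sum>k<2 * N. f k) = (\<Sum>k<N. f (2 * k)) + (\<Sum>k<N. f (2 * k + 1))" for f :: "nat \<Rightarrow> ennreal" and N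
      by (induction N) (auto simp: ac_simps)
    have total: "(\<Sum>k. ?H (R k)) \<le> ?H X + ?H X"
    proof (rule suminf_le_const[OF summableI])
      fix N
      have "(\<Sum>k<N. ?H (R k)) \<le> (\<Sum>k<2*N. ?H (R k))"
        by (rule sum_mono2) auto
      also have "\<dots> \<le> (\<Sum>k. ?H (R (2 * k + 0))) + (\<Sum>k. ?H (R (2 * k + 1)))"
        unfolding split by (intro add_mono) (auto intro!: sum_le_suminf)
      also have "\<dots> \<le> ?H X + ?H X" by (intro add_mono rings_X)
      finally show "(\<Sum>k<N. ?H (R k)) \<le> ?H X + ?H X" .
    qed
    have shells: "X - C \<subseteq> Y n \<union> (\<Union>k. R (k + n))" for n
    proof
      fix x assume x: "x \<in> X - C"
      show "x \<in> Y n \<union> (\<Union>k. R (k + n))"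
      proof (cases "x \<in> Y n")
        case False
        have pos: "infdist x C > 0"
          using x C ne in_closed_iff_infdist_zero[of C x] infdist_nonneg[of x C] by force
        define m where "m = (LEAST m. 1 / real (Suc m) \<le> infdist x C)"
        obtain m0 where "inverse (real (Suc m0)) < infdist x C" using reals_Archimedean[OF pos] by auto
        then have m: "1 / real (Suc m) \<le> infdist x C"
          unfolding m_def using LeastI[of "\<lambda>m. 1 / real (Suc m) \<le> infdist x C" m0]
          by (simp add: inverse_eq_divide)
        have "n < m"
        proof (rule ccontr)
          assume "\<not> n < m"
          then have "1 / real (Suc n) \<le> 1 / real (Suc m)" by (intro divide_left_mono) auto
          with m have "1 / real (Suc n) \<le> infdist x C" by linarith
          with False x show False by (auto simp: Y_def)
        qed
        then have "\<not> 1 / real (Suc (m - 1)) \<le> infdist x C"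
          using not_less_Least[of "m - 1" "\<lambda>m. 1 / real (Suc m) \<le> infdist x C"]
          unfolding m_def[symmetric] by auto
        with m x \<open>n < m\<close> have "x \<in> R ((m - 1 - n) + n)" by (auto simp: R_def)
        then show ?thesis by blast
      qed auto
    qed
    \<comment> \<open>the finite partial sum is kept on the left, so that the tails of the series need not be handled in the extended reals\<close>
    have partial: "?H (X \<inter> C) + ?H (X - C) + (\<Sum>k<n. ?H (R k)) \<le> ?H X + (\<Sum>k. ?H (R k))" for n
    proof -
      have "?H (X - C) \<le> ?H (Y n) + (\<Sum>k. ?H (R (k + n)))"
      proof -
        have "?H (X - C) \<le> ?H (Y n) + ?H (\<Union>k. R (k + n))"
          by (rule order_trans[OF hausdorff_outer_mono[OF shells] hausdorff_outer_Un_le])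
        also have "?H (\<Union>k. R (k + n)) \<le> (\<Sum>k. ?H (R (k + n)))"
          by (rule hausdorff_outer_UN_le)
        finally show ?thesis by simp
      qed
      moreover have "?H (X \<inter> C) + ?H (Y n) \<le> ?H X"
      proof -
        have "1 / real (Suc n) \<le> dist x y" if "x \<in> Y n" "y \<in> X \<inter> C" for x y
          using that dist_gap[of x y] by (auto simp: Y_def)
        then have "?H (Y n \<union> (X \<inter> C)) = ?H (Y n) + ?H (X \<inter> C)"
          by (intro hausdorff_outer_Un_separated[of "1 / real (Suc n)"]) auto
        moreover have "?H (Y n \<union> (X \<inter> C)) \<le> ?H X"
          by (rule hausdorff_outer_mono) (auto simp: Y_def)
        ultimately show ?thesis by (simp add: add.commute)
      qed
      ultimately have "?H (X \<inter> C) + ?H (X - C) + (\<Sum>k<n. ?H (R k))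
          \<le> ?H X + ((\<Sum>k. ?H (R (k + n))) + (\<Sum>k<n. ?H (R k)))"
        by (smt (verit, best) add.assoc add.commute add_mono order_refl order_trans)
      also have "(\<Sum>k. ?H (R (k + n))) + (\<Sum>k<n. ?H (R k)) = (\<Sum>k. ?H (R k))"
        by (rule suminf_offset[symmetric, OF summableI])
      finally show ?thesis .
    qed
    have "?H (X \<inter> C) + ?H (X - C) + (\<Sum>k. ?H (R k)) \<le> ?H X + (\<Sum>k. ?H (R k))"
      by (rule LIMSEQ_le_const2[OF tendsto_add[OF tendsto_const summable_LIMSEQ[OF summableI]]])
         (use partial in auto)
    moreover have "(\<Sum>k. ?H (R k)) \<noteq> top"
      using total fin by (auto simp: top_unique)
    ultimately show ?thesis
      by (simp add: add.commute[of _ "\<Sum>k. ?H (R k)"] ennreal_add_left_cancel_le)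
  qed simp
  moreover have "?H X \<le> ?H (X \<inter> C) + ?H (X - C)" for X
    using hausdorff_outer_Un_le[of d "X \<inter> C" "X - C"] by (simp add: Int_Diff_Un)
  ultimately show ?thesis
    by (auto simp: lambda_system_def Int_commute Diff_eq[symmetric] intro!: antisym)
       (simp_all add: Diff_eq Int_commute)
qed

theorem sets_hausdorff_measure [simp, measurable_cong]: "sets (hausdorff_measure d) = sets borel"
  unfolding hausdorff_measure_def by (metis sets_measure_of_conv sets.sigma_sets_eq sets.space_closed space_borel)

lemma space_hausdorff_measure [simp]: "space (hausdorff_measure d) = UNIV"
  unfolding hausdorff_measure_def by (simp add: space_measure_of_conv)

theorem emeasure_hausdorff_measure:
  fixes A :: "'a::metric_space set"
  assumes "A \<in> sets borel"
  shows "emeasure (hausdorff_measure d) A = hausdorff_outer d A"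
proof -
  interpret sigma_algebra "UNIV :: 'a set" "Pow UNIV" by (rule sigma_algebra_Pow)
  let ?L = "lambda_system UNIV (Pow UNIV) (hausdorff_outer d :: 'a set \<Rightarrow> ennreal)"
  have L: "measure_space UNIV ?L (hausdorff_outer d)"
    by (rule caratheodory_lemma[OF outer_measure_space_hausdorff_outer])
  have "sets borel = sigma_sets UNIV {S :: 'a set. closed S}"
    by (simp add: borel_eq_closed)
  also have "\<dots> \<subseteq> ?L"
    using L closed_in_lambda_system_hausdorff_outer
    by (intro sigma_algebra.sigma_sets_subset) (auto simp: measure_space_def)
  finally have "measure_space UNIV (sets borel) (hausdorff_outer d :: 'a set \<Rightarrow> ennreal)"
    using measure_down[OF L] sets.sigma_algebra_axioms[of "borel :: 'a measure"] by auto
  then show ?thesis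
    unfolding hausdorff_measure_def
    by (intro emeasure_measure_of_sigma assms) (auto simp: measure_space_def)
qed

section \<open>Similarities, points and the reflection at the origin\<close>
lemma hausdorff_outer_similarity:
  fixes f :: "'a \<Rightarrow> 'b::metric_space" and h :: "'a \<Rightarrow> 'c::metric_space"
  assumes K: "K > 0"
    and eq: "\<And>x y. x \<in> A \<Longrightarrow> y \<in> A \<Longrightarrow> dist (f x) (f y) = K * dist (h x) (h y)"
  shows "hausdorff_outer d (f ` A) = ennreal (K ^ d) * hausdorff_outer d (h ` A)"
proof (rule antisym)
  show "hausdorff_outer d (f ` A) \<le> ennreal (K ^ d) * hausdorff_outer d (h ` A)"
    by (rule hausdorff_outer_image_le) (use assms in auto)
  have "hausdorff_outer d (h ` A) \<le> ennreal ((1 / K) ^ d) * hausdorff_outer d (f ` A)"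
    by (rule hausdorff_outer_image_le) (use assms in auto)
  then have "ennreal (K ^ d) * hausdorff_outer d (h ` A)
      \<le> ennreal (K ^ d) * (ennreal ((1 / K) ^ d) * hausdorff_outer d (f ` A))"
    by (rule mult_left_mono) auto
  also have "\<dots> = hausdorff_outer d (f ` A)"
    using K by (simp add: mult.assoc[symmetric] power_one_over flip: ennreal_mult)
  finally show "ennreal (K ^ d) * hausdorff_outer d (h ` A) \<le> hausdorff_outer d (f ` A)" .
qed

lemma hausdorff_outer_isometry:
  fixes f :: "'a \<Rightarrow> 'b::metric_space" and h :: "'a \<Rightarrow> 'c::metric_space"
  assumes "\<And>x y. x \<in> A \<Longrightarrow> y \<in> A \<Longrightarrow> dist (f x) (f y) = dist (h x) (h y)"
  shows "hausdorff_outer d (f ` A) = hausdorff_outer d (h ` A)"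
  using hausdorff_outer_similarity[of 1 A f h d] assms by simp

lemma hausdorff_measure_singleton:
  fixes x :: "'a::metric_space"
  assumes "d > 0"
  shows "emeasure (hausdorff_measure d) {x} = 0"
proof -
  have "hausdorff_premeasure d \<delta> {x} \<le> covering_cost d (\<lambda>_. {x})" if "\<delta> > 0" for \<delta>
    by (rule hausdorff_premeasure_le) (use that in auto)
  then have "hausdorff_outer d {x} \<le> 0"
    using assms by (intro hausdorff_outer_le) (auto simp: covering_cost_def power_0_left)
  then show ?thesis by (simp add: emeasure_hausdorff_measure)
qed

text \<open>
  Needed to identify the contributions of opposite directions on the sphere.
\<close>
lemma hausdorff_measure_uminus:
  "distr (hausdorff_measure d) borel uminus = (hausdorff_measure d :: 'a::real_normed_vector measure)"
proof (rule measure_eqI)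
  fix A :: "'a set" assume "A \<in> sets (distr (hausdorff_measure d) borel uminus)"
  then have [measurable]: "A \<in> sets borel" by simp
  have m: "uminus \<in> borel_measurable (borel :: 'a measure)"
    by (intro borel_measurable_continuous_onI continuous_intros)
  then have A': "uminus -` A \<in> sets borel" using measurable_sets[OF m, of A] by simp
  have "emeasure (distr (hausdorff_measure d) borel uminus) A = hausdorff_outer d (uminus -` A)"
    using m A' by (subst emeasure_distr) (auto simp: emeasure_hausdorff_measure)
  also have "\<dots> = hausdorff_outer d ((\<lambda>x. x) ` (uminus -` A))" by simp
  also have "\<dots> = hausdorff_outer d (uminus ` (uminus -` A))"
    by (rule hausdorff_outer_isometry) (simp add: dist_minus)
  also have "uminus ` (uminus -` A) = A" by (auto simp: image_iff intro!: bexI[of _ "- _"])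
  finally show "emeasure (distr (hausdorff_measure d) borel uminus) A = emeasure (hausdorff_measure d) A"
    by (simp add: emeasure_hausdorff_measure)
qed simp

section \<open>The Hausdorff measure of a hyperplane under linear maps\<close>
lemma hausdorff_premeasure_finite_cover:
  assumes I: "finite I" and S: "S \<subseteq> (\<Union>i\<in>I. U i)" and b: "\<And>i. i \<in> I \<Longrightarrow> bounded (U i)"
    and diam: "\<And>i. i \<in> I \<Longrightarrow> diameter (U i) \<le> \<eta>" and \<eta>: "0 \<le> \<eta>" "\<eta> \<le> \<delta>"
  shows "hausdorff_premeasure d \<delta> S \<le> ennreal (real (card I) * (unit_ball_vol (real d) * (\<eta> / 2) ^ d))"
proof -
  obtain e where e: "bij_betw e {..<card I} I"
    using ex_bij_betw_nat_finite[OF I] by (auto simp: atLeast0LessThan)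
  define V where "V k = (if k < card I then U (e k) else {})" for k
  have eI: "e k \<in> I" if "k < card I" for k using e that by (auto simp: bij_betw_def)
  have V: "bounded (V k)" "diameter (V k) \<le> \<eta>" for k
    using b diam \<eta> eI by (auto simp: V_def)
  have "hausdorff_premeasure d \<delta> S \<le> covering_cost d V"
  proof (rule hausdorff_premeasure_le)
    have "(\<Union>i\<in>I. U i) = (\<Union>k<card I. U (e k))"
      using e by (metis (no_types, lifting) SUP_cong bij_betw_imp_surj_on image_image)
    with S show "S \<subseteq> (\<Union>k. V k)" by (fastforce simp: V_def)
    show "diameter (V k) \<le> \<delta>" for k using V(2)[of k] \<eta> by simp
  qed (rule V)
  also have "\<dots> = (\<Sum>k<card I. if V k = {} then 0 else ennreal (unit_ball_vol (real d) * (diameter (V k) / 2) ^ d))"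
    unfolding covering_cost_def by (rule suminf_finite) (auto simp: V_def)
  also have "\<dots> \<le> (\<Sum>k<card I. ennreal (unit_ball_vol (real d) * (\<eta> / 2) ^ d))"
    using V diameter_ge_0[OF V(1)] by (intro sum_mono) (auto intro!: ennreal_leI mult_left_mono power_mono)
  also have "\<dots> = ennreal (real (card I) * (unit_ball_vol (real d) * (\<eta> / 2) ^ d))"
    using \<eta> by (simp add: ennreal_mult ennreal_of_nat_eq_real_of_nat)
  finally show ?thesis .
qed

text \<open>
  The disc is covered by the cells of the grid of mesh \<open>1 / N\<close>, at most \<open>(2 N + 1)\<^bsup>n-1\<^esup>\<close> of them, each of
  diameter at most \<open>n / N\<close>; the powers of \<open>N\<close> cancel. Finiteness on discs is what makes the Hausdorff measure
  of a hyperplane sigma-finite, so that Fubini's theorem applies to it.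
\<close>
lemma hausdorff_outer_coordinate_disc_finite:
  fixes k :: "'n::finite"
  shows "hausdorff_outer (CARD('n) - 1) {x :: real^'n. x $ k = 0 \<and> norm x \<le> 1} < top"
proof -
  let ?n = "real CARD('n)" and ?d = "CARD('n) - 1"
  let ?S = "{x :: real^'n. x $ k = 0 \<and> norm x \<le> 1}"
  define C where "C = unit_ball_vol (real ?d) * (3 * ?n / 2) ^ ?d"
  have "hausdorff_outer ?d ?S \<le> ennreal C"
  proof (rule hausdorff_outer_le)
    fix \<delta> :: real assume \<delta>: "\<delta> > 0"
    obtain N0 :: nat where N0: "?n / \<delta> < real N0" using reals_Archimedean2 by blast
    define N where "N = max 1 N0"
    have "?n < real N0 * \<delta>" using N0 \<delta> by (simp add: divide_less_eq)
    also have "\<dots> \<le> real N * \<delta>" using \<delta> by (intro mult_right_mono) (auto simp: N_def)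
    finally have N: "N \<ge> 1" "?n / real N \<le> \<delta>"
      by (auto simp: N_def divide_le_eq mult.commute)
    \<comment> \<open>grid cells are indexed by their integer parts; the \<open>k\<close>-th one is frozen at zero\<close>
    define I where "I = PiE UNIV (\<lambda>i::'n. if i = k then {0} else {- int N..int N})"
    define U where "U z = {x :: real^'n. x $ k = 0 \<and> (\<forall>i. \<lfloor>real N * x $ i\<rfloor> = z i)}" for z
    have cardI: "card I = (2 * N + 1) ^ ?d"
    proof -
      have "card I = (\<Prod>i\<in>UNIV. card (if i = k then {0} else {- int N..int N}))"
        unfolding I_def by (rule card_PiE) auto
      also have "\<dots> = (\<Prod>i\<in>UNIV - {k}. nat (2 * int N + 1))"
        unfolding prod.remove[OF finite UNIV_I, of _ k] by simp
      finally have "card I = nat (2 * int N + 1) ^ ?d" by (simp add: card_Diff_singleton)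
      also have "nat (2 * int N + 1) = 2 * N + 1" by arith
      finally show ?thesis .
    qed
    have close: "dist x y \<le> ?n / real N" if "x \<in> U z" "y \<in> U z" for x y z
    proof -
      have "\<bar>(x - y) $ i\<bar> \<le> 1 / real N" for i
      proof -
        have "\<lfloor>real N * x $ i\<rfloor> = \<lfloor>real N * y $ i\<rfloor>" using that by (simp add: U_def)
        then have "\<bar>real N * x $ i - real N * y $ i\<bar> \<le> 1" by linarith
        then have "real N * \<bar>x $ i - y $ i\<bar> \<le> 1"
          by (metis abs_mult abs_of_nat right_diff_distrib)
        then show ?thesis using N by (simp add: field_simps)
      qed
      then have "norm (x - y) \<le> (\<Sum>i\<in>(UNIV::'n set). 1 / real N)"
        by (intro order_trans[OF norm_le_l1_cart] sum_mono) auto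
      then show ?thesis by (simp add: dist_norm)
    qed
    have "hausdorff_premeasure ?d \<delta> ?S
        \<le> ennreal (real (card I) * (unit_ball_vol (real ?d) * (?n / real N / 2) ^ ?d))"
    proof (rule hausdorff_premeasure_finite_cover)
      show "finite I" unfolding I_def by (rule finite_PiE) auto
      show "?S \<subseteq> (\<Union>z\<in>I. U z)"
      proof
        fix x :: "real^'n" assume x: "x \<in> ?S"
        have "(\<lambda>i. \<lfloor>real N * x $ i\<rfloor>) \<in> I"
          unfolding I_def
        proof (rule PiE_I)
          fix i
          have "\<bar>x $ i\<bar> \<le> 1" using x component_le_norm_cart[of x i] by auto
          then have "\<bar>real N * x $ i\<bar> \<le> real N"
            using mult_left_mono[of "\<bar>x $ i\<bar>" 1 "real N"] by (simp add: abs_mult)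
          then have "real N * x $ i \<le> real N" "- real N \<le> real N * x $ i" by linarith+
          then show "\<lfloor>real N * x $ i\<rfloor> \<in> (if i = k then {0} else {- int N..int N})"
            using x by (auto simp: floor_le_iff le_floor_iff)
        qed auto
        then show "x \<in> (\<Union>z\<in>I. U z)" using x by (auto simp: U_def intro!: bexI)
      qed
      fix z
      show "bounded (U z)"
        unfolding bounded_def using close by (cases "U z = {}") blast+
      show "diameter (U z) \<le> ?n / real N"
        by (rule diameter_le) (use close in \<open>auto simp: dist_norm\<close>)
    qed (use N in auto)
    also have "real (card I) * (unit_ball_vol (real ?d) * (?n / real N / 2) ^ ?d)
        \<le> (3 * real N) ^ ?d * (unit_ball_vol (real ?d) * (?n / real N / 2) ^ ?d)"
    proof (rule mult_right_mono)
      have "real (2 * N + 1) ^ ?d \<le> (3 * real N) ^ ?d"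
        using N by (intro power_mono) auto
      then show "real (card I) \<le> (3 * real N) ^ ?d" by (simp only: cardI of_nat_power)
    qed simp
    also have "\<dots> = unit_ball_vol (real ?d) * (3 * real N * (?n / real N / 2)) ^ ?d"
      by (simp only: power_mult_distrib ac_simps)
    also have "3 * real N * (?n / real N / 2) = 3 * ?n / 2"
      using N by simp
    finally show "hausdorff_premeasure ?d \<delta> ?S \<le> ennreal C"
      by (simp add: C_def ennreal_leI)
  qed
  then show ?thesis by (simp add: order_le_less_trans)
qed

definition hyperplane :: "real^'n \<Rightarrow> (real^'n) set" where
  "hyperplane \<omega> = {v. v \<bullet> \<omega> = 0}"

definition hyperplane_disc :: "real^'n \<Rightarrow> (real^'n) set" where
  "hyperplane_disc \<omega> = {v. v \<bullet> \<omega> = 0 \<and> norm v \<le> 1}"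

definition hyperplane_proj :: "real^'n \<Rightarrow> real^'n \<Rightarrow> real^'n" where
  "hyperplane_proj \<omega> y = y - (y \<bullet> \<omega>) *\<^sub>R \<omega>"

definition cylinder :: "real^'n \<Rightarrow> (real^'n) set \<Rightarrow> (real^'n) set" where
  "cylinder \<omega> B = {y. 0 \<le> y \<bullet> \<omega> \<and> y \<bullet> \<omega> \<le> 1 \<and> hyperplane_proj \<omega> y \<in> B}"

lemma closed_hyperplane: "closed (hyperplane \<omega>)"
  unfolding hyperplane_def by (intro closed_Collect_eq continuous_intros)

lemma hyperplane_borel [measurable]: "hyperplane \<omega> \<in> sets borel"
  by (rule borel_closed[OF closed_hyperplane])

lemma hyperplane_disc_borel [measurable]: "hyperplane_disc \<omega> \<in> sets borel"
  unfolding hyperplane_disc_def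
  by (intro borel_closed closed_Collect_conj closed_Collect_eq closed_Collect_le continuous_intros)

lemma continuous_on_hyperplane_proj [continuous_intros]: "continuous_on S (hyperplane_proj \<omega>)"
  unfolding hyperplane_proj_def by (intro continuous_intros)

lemma hyperplane_proj_borel [measurable]: "hyperplane_proj \<omega> \<in> borel_measurable borel"
  by (intro borel_measurable_continuous_onI continuous_intros)

lemma cylinder_borel [measurable]: "B \<in> sets borel \<Longrightarrow> cylinder \<omega> B \<in> sets borel"
proof -
  assume [measurable]: "B \<in> sets borel"
  have "cylinder \<omega> B = {y. 0 \<le> y \<bullet> \<omega>} \<inter> {y. y \<bullet> \<omega> \<le> 1} \<inter> (hyperplane_proj \<omega> -` B \<inter> space borel)"
    by (auto simp: cylinder_def)
  also have "\<dots> \<in> sets borel" by measurable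
  finally show ?thesis .
qed

lemma hausdorff_outer_hyperplane_disc_finite:
  fixes \<omega> :: "real^'n::finite"
  assumes "norm \<omega> = 1"
  shows "hausdorff_outer (CARD('n) - 1) (hyperplane_disc \<omega>) < top"
proof -
  obtain k :: 'n where True by simp
  obtain f :: "real^'n \<Rightarrow> real^'n" where f: "orthogonal_transformation f" "f \<omega> = axis k 1"
    using orthogonal_transformation_exists[of \<omega> "axis k 1"] assms by auto
  have "hausdorff_outer (CARD('n) - 1) (hyperplane_disc \<omega>)
      = hausdorff_outer (CARD('n) - 1) ((\<lambda>x. x) ` hyperplane_disc \<omega>)"
    by simp
  also have "\<dots> = hausdorff_outer (CARD('n) - 1) (f ` hyperplane_disc \<omega>)"
    by (rule hausdorff_outer_isometry) (metis f(1) orthogonal_transformation_isometry)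
  also have "\<dots> \<le> hausdorff_outer (CARD('n) - 1) {x :: real^'n. x $ k = 0 \<and> norm x \<le> 1}"
  proof (rule hausdorff_outer_mono, safe)
    fix v assume v: "v \<in> hyperplane_disc \<omega>"
    have "f v \<bullet> f \<omega> = 0" using f(1) v by (simp add: orthogonal_transformation_def hyperplane_disc_def)
    then show "f v $ k = 0" by (simp add: f(2) cart_eq_inner_axis)
    show "norm (f v) \<le> 1" using v f(1) by (simp add: orthogonal_transformation_norm hyperplane_disc_def)
  qed
  also have "\<dots> < top" by (rule hausdorff_outer_coordinate_disc_finite)
  finally show ?thesis .
qed

text \<open>
  Kept as a measure on the whole space, so that its product with Lebesgue measure needs no
  restricted measurable spaces.
\<close>
definition hyperplane_measure :: "real^'n::finite \<Rightarrow> (real^'n) measure" where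
  "hyperplane_measure \<omega> = density (hausdorff_measure (CARD('n) - 1)) (indicator (hyperplane \<omega>))"

lemma sets_hyperplane_measure [simp, measurable_cong]: "sets (hyperplane_measure \<omega>) = sets borel"
  by (simp add: hyperplane_measure_def)

lemma space_hyperplane_measure [simp]: "space (hyperplane_measure \<omega>) = UNIV"
  by (simp add: hyperplane_measure_def)

lemma emeasure_hyperplane_measure:
  fixes \<omega> :: "real^'n::finite"
  assumes "A \<in> sets borel"
  shows "emeasure (hyperplane_measure \<omega>) A = hausdorff_outer (CARD('n) - 1) (hyperplane \<omega> \<inter> A)"
  using assms by (simp add: hyperplane_measure_def emeasure_density
      emeasure_hausdorff_measure flip: indicator_inter_arith)

lemma sigma_finite_hyperplane_measure:
  fixes \<omega> :: "real^'n::finite"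
  assumes \<omega>: "norm \<omega> = 1"
  shows "sigma_finite_measure (hyperplane_measure \<omega>)"
proof
  let ?B = "\<lambda>j::nat. cball (0 :: real^'n) (real (Suc j))"
  have fin: "emeasure (hyperplane_measure \<omega>) (?B j) \<noteq> \<infinity>" for j
  proof -
    have "hyperplane \<omega> \<inter> ?B j = (\<lambda>x. real (Suc j) *\<^sub>R x) ` hyperplane_disc \<omega>"
    proof safe
      fix x assume "x \<in> hyperplane \<omega>" "x \<in> ?B j"
      then show "x \<in> (\<lambda>x. real (Suc j) *\<^sub>R x) ` hyperplane_disc \<omega>"
        by (intro image_eqI[of _ _ "x /\<^sub>R real (Suc j)"])
           (auto simp: hyperplane_def hyperplane_disc_def field_simps simp del: of_nat_Suc)
    qed (auto simp: hyperplane_def hyperplane_disc_def simp del: of_nat_Suc)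
    also have "hausdorff_outer (CARD('n) - 1) \<dots>
        = ennreal (real (Suc j) ^ (CARD('n) - 1)) * hausdorff_outer (CARD('n) - 1) ((\<lambda>x. x) ` hyperplane_disc \<omega>)"
      by (rule hausdorff_outer_similarity) (auto simp: dist_norm simp flip: scaleR_diff_right)
    also have "\<dots> < top"
      using hausdorff_outer_hyperplane_disc_finite[OF \<omega>] by (simp add: ennreal_mult_less_top)
    finally show ?thesis by (simp add: emeasure_hyperplane_measure)
  qed
  have cover: "(\<Union>j. ?B j) = UNIV"
  proof -
    have "\<exists>j. norm x \<le> real (Suc j)" for x :: "real^'n"
      using real_arch_simple[of "norm x"] by (metis le_SucI of_nat_mono order_trans order_refl)
    then show ?thesis by (auto simp: set_eq_iff simp del: of_nat_Suc)
  qed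
  show "\<exists>A::(real^'n) set set. countable A \<and> A \<subseteq> sets (hyperplane_measure \<omega>)
      \<and> \<Union> A = space (hyperplane_measure \<omega>) \<and> (\<forall>a\<in>A. emeasure (hyperplane_measure \<omega>) a \<noteq> \<infinity>)"
    by (rule exI[of _ "range ?B"]) (use fin cover in auto)
qed

lemma emeasure_lborel_translate:
  fixes t :: "'a::euclidean_space"
  assumes "A \<in> sets borel"
  shows "emeasure lborel {y. t + y \<in> A} = emeasure lborel A"
proof -
  have "emeasure lborel A = emeasure (distr lborel borel ((+) t)) A"
    by (simp add: lborel_distr_plus)
  also have "\<dots> = emeasure lborel {y. t + y \<in> A}"
    using assms by (subst emeasure_distr) (auto simp: vimage_def)
  finally show ?thesis by simp
qed

lemma emeasure_lborel_reflect:
  fixes t :: "'a::euclidean_space"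
  assumes "A \<in> sets borel"
  shows "emeasure lborel {y. t - y \<in> A} = emeasure lborel A"
proof -
  have "emeasure lborel A = emeasure (distr lborel borel (\<lambda>x. t + (-1) *\<^sub>R x)) A"
    using lborel_affine[of "-1" t] by (simp add: density_1)
  also have "\<dots> = emeasure lborel {y. t - y \<in> A}"
    using assms by (subst emeasure_distr) (auto simp: vimage_def)
  finally show ?thesis by simp
qed

lemma hyperplane_proj_add: "hyperplane_proj \<omega> (x + y) = hyperplane_proj \<omega> x + hyperplane_proj \<omega> y"
  by (simp add: hyperplane_proj_def inner_left_distrib scaleR_left_distrib)

lemma hyperplane_proj_diff: "hyperplane_proj \<omega> (x - y) = hyperplane_proj \<omega> x - hyperplane_proj \<omega> y"
  by (simp add: hyperplane_proj_def inner_diff_left scaleR_left_diff_distrib)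

lemma hyperplane_proj_hyperplane [simp]: "v \<in> hyperplane \<omega> \<Longrightarrow> hyperplane_proj \<omega> v = v"
  by (simp add: hyperplane_proj_def hyperplane_def)

lemma hyperplane_proj_in_hyperplane: "norm \<omega> = 1 \<Longrightarrow> hyperplane_proj \<omega> y \<in> hyperplane \<omega>"
  by (simp add: hyperplane_proj_def hyperplane_def inner_diff_left dot_square_norm)

text \<open>
  Uniqueness of the translation invariant measure on a hyperplane, in a form that compares
  \<open>(n-1)\<close>-dimensional measure with \<open>n\<close>-dimensional volume: the ratio of \<open>H(B)\<close> to the volume of the
  cylinder over \<open>B\<close> does not depend on \<open>B\<close>. Both sides compute, by Fubini, the size of the set of
  pairs \<open>(v, y)\<close> with \<open>v \<in> B\<close>, \<open>y\<close> in the slab of height one and \<open>v + y\<close> above \<open>W\<close>: integrating over \<open>y\<close> first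
  gives the left side; integrating over \<open>v\<close> first, after the translation \<open>u = v + y\<close> within the
  hyperplane, the right side.
\<close>
lemma hausdorff_hyperplane_cylinder:
  fixes \<omega> :: "real^'n::finite"
  assumes \<omega>: "norm \<omega> = 1"
    and B: "B \<subseteq> hyperplane \<omega>" "B \<in> sets borel" and W: "W \<subseteq> hyperplane \<omega>" "W \<in> sets borel"
  shows "hausdorff_outer (CARD('n) - 1) B * emeasure lborel (cylinder \<omega> W)
       = hausdorff_outer (CARD('n) - 1) W * emeasure lborel (cylinder \<omega> B)"
proof -
  let ?H = "hausdorff_outer (CARD('n) - 1) :: (real^'n) set \<Rightarrow> ennreal"
  let ?M = "hyperplane_measure \<omega>"
  note [measurable] = B(2) W(2)
  define Q where "Q = {y. 0 \<le> y \<bullet> \<omega> \<and> y \<bullet> \<omega> \<le> 1}"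
  have [measurable]: "Q \<in> sets borel"
    unfolding Q_def by measurable
  interpret M: sigma_finite_measure ?M
    by (rule sigma_finite_hyperplane_measure[OF \<omega>])
  interpret P: pair_sigma_finite ?M "lborel :: (real^'n) measure" ..
  have H: "emeasure ?M A = ?H A" if "A \<subseteq> hyperplane \<omega>" "A \<in> sets borel" for A
    using that by (simp add: emeasure_hyperplane_measure Int_absorb1)
  define f where "f v y = indicator B v * (indicator W (v + hyperplane_proj \<omega> y) * indicator Q y :: ennreal)" for v y
  define g where "g u y = indicator W u * (indicator B (u - hyperplane_proj \<omega> y) * indicator Q y :: ennreal)" for u y
  have f_meas [measurable]: "case_prod f \<in> borel_measurable (?M \<Otimes>\<^sub>M lborel)"
    unfolding f_def by measurable
  have g_meas [measurable]: "case_prod g \<in> borel_measurable (?M \<Otimes>\<^sub>M lborel)"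
    unfolding g_def by measurable
  have "(\<integral>\<^sup>+v. \<integral>\<^sup>+y. f v y \<partial>lborel \<partial>?M) = (\<integral>\<^sup>+v. emeasure lborel (cylinder \<omega> W) * indicator B v \<partial>?M)"
  proof (rule nn_integral_cong)
    fix v
    show "(\<integral>\<^sup>+y. f v y \<partial>lborel) = emeasure lborel (cylinder \<omega> W) * indicator B v"
    proof (cases "v \<in> B")
      case True
      then have v: "v \<in> hyperplane \<omega>" using B by auto
      have "(\<integral>\<^sup>+y. f v y \<partial>lborel) = (\<integral>\<^sup>+y. indicator {y. v + y \<in> cylinder \<omega> W} y \<partial>lborel)"
        using True v by (intro nn_integral_cong)
           (auto simp: f_def cylinder_def Q_def hyperplane_proj_add inner_left_distrib hyperplane_def split: split_indicator)
      also have "\<dots> = emeasure lborel {y. v + y \<in> cylinder \<omega> W}"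
        by (rule nn_integral_indicator) measurable
      also have "\<dots> = emeasure lborel (cylinder \<omega> W)"
        by (rule emeasure_lborel_translate) measurable
      finally show ?thesis using True by simp
    qed (simp add: f_def)
  qed
  also have "\<dots> = emeasure lborel (cylinder \<omega> W) * ?H B"
    using H[OF B] by (simp add: nn_integral_cmult_indicator)
  finally have 1: "(\<integral>\<^sup>+v. \<integral>\<^sup>+y. f v y \<partial>lborel \<partial>?M) = emeasure lborel (cylinder \<omega> W) * ?H B" .
  have "(\<integral>\<^sup>+u. \<integral>\<^sup>+y. g u y \<partial>lborel \<partial>?M) = (\<integral>\<^sup>+u. emeasure lborel (cylinder \<omega> B) * indicator W u \<partial>?M)"
  proof (rule nn_integral_cong)
    fix u
    show "(\<integral>\<^sup>+y. g u y \<partial>lborel) = emeasure lborel (cylinder \<omega> B) * indicator W u"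
    proof (cases "u \<in> W")
      case True
      then have u: "u \<in> hyperplane \<omega>" using W by auto
      \<comment> \<open>the shift by \<open>\<omega>\<close> makes the reflection map the slab \<open>0 \<le> y \<bullet> \<omega> \<le> 1\<close> to itself\<close>
      have "(\<integral>\<^sup>+y. g u y \<partial>lborel) = (\<integral>\<^sup>+y. indicator {y. (u + \<omega>) - y \<in> cylinder \<omega> B} y \<partial>lborel)"
        using True u \<omega> by (intro nn_integral_cong)
           (auto simp: g_def cylinder_def Q_def hyperplane_proj_add hyperplane_proj_diff inner_left_distrib inner_diff_left
              hyperplane_def dot_square_norm hyperplane_proj_def[of \<omega> \<omega>] split: split_indicator)
      also have "\<dots> = emeasure lborel {y. (u + \<omega>) - y \<in> cylinder \<omega> B}"
        by (rule nn_integral_indicator) measurable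
      also have "\<dots> = emeasure lborel (cylinder \<omega> B)"
        by (rule emeasure_lborel_reflect) measurable
      finally show ?thesis using True by simp
    qed (simp add: g_def)
  qed
  also have "\<dots> = emeasure lborel (cylinder \<omega> B) * ?H W"
    using H[OF W] by (simp add: nn_integral_cmult_indicator)
  finally have 2: "(\<integral>\<^sup>+u. \<integral>\<^sup>+y. g u y \<partial>lborel \<partial>?M) = emeasure lborel (cylinder \<omega> B) * ?H W" .
  have inner: "(\<integral>\<^sup>+v. f v y \<partial>?M) = (\<integral>\<^sup>+u. g u y \<partial>?M)" for y
  proof (cases "y \<in> Q")
    case True
    let ?A = "B \<inter> {v. v + hyperplane_proj \<omega> y \<in> W}" and ?A' = "W \<inter> {u. u - hyperplane_proj \<omega> y \<in> B}"
    have AA [measurable]: "?A \<in> sets borel" "?A' \<in> sets borel" by measurable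
    have "(\<integral>\<^sup>+v. f v y \<partial>?M) = (\<integral>\<^sup>+v. indicator ?A v \<partial>?M)"
      using True by (intro nn_integral_cong) (auto simp: f_def split: split_indicator)
    also have "\<dots> = ?H ?A"
      using B(1) H[OF _ AA(1)] by (subst nn_integral_indicator) auto
    also have "\<dots> = ?H ((\<lambda>v. v + hyperplane_proj \<omega> y) ` ?A)"
      using hausdorff_outer_isometry[of ?A "\<lambda>v. v + hyperplane_proj \<omega> y" "\<lambda>v. v"] by (simp add: dist_norm)
    also have "(\<lambda>v. v + hyperplane_proj \<omega> y) ` ?A = ?A'"
      by (auto simp: image_iff intro!: bexI[of _ "_ - hyperplane_proj \<omega> y"])
    also have "?H ?A' = (\<integral>\<^sup>+u. indicator ?A' u \<partial>?M)"
      using W(1) H[OF _ AA(2)] by (subst nn_integral_indicator) (auto simp: subset_iff)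
    also have "\<dots> = (\<integral>\<^sup>+u. g u y \<partial>?M)"
      using True by (intro nn_integral_cong) (auto simp: g_def split: split_indicator)
    finally show ?thesis .
  qed (simp add: f_def g_def)
  have "emeasure lborel (cylinder \<omega> W) * ?H B = (\<integral>\<^sup>+y. \<integral>\<^sup>+v. f v y \<partial>?M \<partial>lborel)"
    unfolding 1[symmetric] by (rule P.Fubini'[OF f_meas, symmetric])
  also have "\<dots> = (\<integral>\<^sup>+y. \<integral>\<^sup>+u. g u y \<partial>?M \<partial>lborel)"
    by (simp add: inner)
  also have "\<dots> = emeasure lborel (cylinder \<omega> B) * ?H W"
    unfolding 2[symmetric] by (rule P.Fubini'[OF g_meas])
  finally show ?thesis by (simp add: mult.commute)
qed

text \<open>
  A cylinder with volume strictly between zero and infinity is what allows the ratio in the previous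
  lemma to be cancelled.
\<close>
lemma cylinder_disc_measure:
  fixes \<omega> :: "real^'n::finite"
  assumes \<omega>: "norm \<omega> = 1"
  shows "0 < emeasure lborel (cylinder \<omega> (hyperplane_disc \<omega>))"
    and "emeasure lborel (cylinder \<omega> (hyperplane_disc \<omega>)) < top"
proof -
  have "ball (\<omega> /\<^sub>R 2) (1/2) \<subseteq> cylinder \<omega> (hyperplane_disc \<omega>)"
  proof
    fix y assume "y \<in> ball (\<omega> /\<^sub>R 2) (1/2)"
    define z where "z = y - \<omega> /\<^sub>R 2"
    have z: "norm z < 1/2" "y = z + \<omega> /\<^sub>R 2"
      using \<open>y \<in> _\<close> by (auto simp: z_def dist_norm norm_minus_commute)
    have "\<bar>z \<bullet> \<omega>\<bar> \<le> norm z" using Cauchy_Schwarz_ineq2[of z \<omega>] \<omega> by simp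
    moreover have "y \<bullet> \<omega> = z \<bullet> \<omega> + 1/2" using \<omega> by (simp add: z inner_left_distrib dot_square_norm)
    moreover have "hyperplane_proj \<omega> y = hyperplane_proj \<omega> z" using \<omega> by (simp add: z hyperplane_proj_def inner_left_distrib dot_square_norm algebra_simps)
    moreover have "norm (hyperplane_proj \<omega> z) \<le> norm z + \<bar>z \<bullet> \<omega>\<bar>"
      unfolding hyperplane_proj_def using norm_triangle_ineq4[of z "(z \<bullet> \<omega>) *\<^sub>R \<omega>"] \<omega> by simp
    ultimately show "y \<in> cylinder \<omega> (hyperplane_disc \<omega>)"
      using z hyperplane_proj_in_hyperplane[OF \<omega>, of z] by (auto simp: cylinder_def hyperplane_disc_def hyperplane_def)
  qed
  then have "emeasure lborel (ball (\<omega> /\<^sub>R 2) (1/2)) \<le> emeasure lborel (cylinder \<omega> (hyperplane_disc \<omega>))"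
    by (intro emeasure_mono) auto
  moreover have "0 < emeasure lborel (ball (\<omega> /\<^sub>R 2) (1/2))"
    by (simp add: emeasure_ball unit_ball_vol_pos)
  ultimately show "0 < emeasure lborel (cylinder \<omega> (hyperplane_disc \<omega>))" by (rule order_less_le_trans[rotated])
  have "bounded (cylinder \<omega> (hyperplane_disc \<omega>))"
    unfolding bounded_iff
  proof (intro exI ballI)
    fix y assume y: "y \<in> cylinder \<omega> (hyperplane_disc \<omega>)"
    have "norm y \<le> norm (hyperplane_proj \<omega> y) + norm ((y \<bullet> \<omega>) *\<^sub>R \<omega>)"
      unfolding hyperplane_proj_def by (metis diff_add_cancel norm_triangle_ineq)
    also have "\<dots> \<le> 2" using y \<omega> by (auto simp: cylinder_def hyperplane_disc_def)
    finally show "norm y \<le> 2" .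
  qed
  then show "emeasure lborel (cylinder \<omega> (hyperplane_disc \<omega>)) < top"
    using emeasure_bounded_finite by (auto simp: less_top)
qed

lemma linear_inj_image_borel:
  fixes L :: "'a::euclidean_space \<Rightarrow> 'a"
  assumes L: "linear L" "inj L" and B: "B \<in> sets borel"
  shows "L ` B \<in> sets borel"
proof -
  obtain g where g: "linear g" "\<And>x. g (L x) = x" "\<And>x. L (g x) = x"
    using linear_injective_isomorphism[OF L] by blast
  have "L ` B = g -` B \<inter> space borel"
    by (auto simp: g image_iff intro!: bexI[of _ "g _"])
  moreover have "g \<in> borel_measurable borel"
    using g(1) by (intro borel_measurable_continuous_onI linear_continuous_on linear_conv_bounded_linear[THEN iffD1])
  ultimately show ?thesis using B by (metis measurable_sets)
qed

text \<open>
  A linear map that preserves the hyperplane and fixes its normal commutes with forming cylinders,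
  so it scales \<open>(n-1)\<close>-dimensional measure in the hyperplane as it scales volume.
\<close>
lemma hausdorff_linear_image_hyperplane:
  fixes L :: "real^'n::finite \<Rightarrow> real^'n"
  assumes \<omega>: "norm \<omega> = 1" and L: "linear L" "inj L" "L \<omega> = \<omega>"
    and vol: "\<And>A. A \<in> sets borel \<Longrightarrow> emeasure lborel (L ` A) = c * emeasure lborel A"
    and hyp: "\<And>v. v \<in> hyperplane \<omega> \<Longrightarrow> L v \<in> hyperplane \<omega>"
    and B: "B \<subseteq> hyperplane \<omega>" "B \<in> sets borel"
  shows "hausdorff_outer (CARD('n) - 1) (L ` B)
       = c * hausdorff_outer (CARD('n) - 1) B"
proof -
  let ?H = "hausdorff_outer (CARD('n) - 1) :: (real^'n) set \<Rightarrow> ennreal"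
  let ?W = "hyperplane_disc \<omega>"
  let ?c = "emeasure lborel (cylinder \<omega> ?W)"
  have W: "?W \<subseteq> hyperplane \<omega>" by (auto simp: hyperplane_disc_def hyperplane_def)
  have split: "L y = L (hyperplane_proj \<omega> y) + (y \<bullet> \<omega>) *\<^sub>R \<omega>" for y
    using L linear_diff[OF L(1)] linear_scale[OF L(1)] by (simp add: hyperplane_proj_def)
  have dot: "L y \<bullet> \<omega> = y \<bullet> \<omega>" for y
    using hyp[OF hyperplane_proj_in_hyperplane[OF \<omega>, of y]] \<omega>
    by (subst split) (simp add: inner_left_distrib hyperplane_def dot_square_norm)
  have tL: "hyperplane_proj \<omega> (L y) = L (hyperplane_proj \<omega> y)" for y
    using dot[of y] by (simp add: hyperplane_proj_def[of \<omega> "L y"]) (subst split, simp)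
  have cyl: "cylinder \<omega> (L ` B) = L ` cylinder \<omega> B"
  proof safe
    fix y assume y: "y \<in> cylinder \<omega> (L ` B)"
    obtain x where x: "y = L x"
      using linear_injective_isomorphism[OF L(1,2)] by metis
    have "L (hyperplane_proj \<omega> x) \<in> L ` B" using y by (simp add: cylinder_def x tL)
    then have "hyperplane_proj \<omega> x \<in> B" using L(2) by (auto simp: inj_def)
    then show "y \<in> L ` cylinder \<omega> B" using y by (auto simp: cylinder_def x dot)
  qed (auto simp: cylinder_def dot tL)
  have LB: "L ` B \<in> sets borel" by (rule linear_inj_image_borel[OF L(1,2) B(2)])
  have LB': "L ` B \<subseteq> hyperplane \<omega>" using B(1) hyp by auto
  have "?H (L ` B) * ?c = ?H ?W * emeasure lborel (L ` cylinder \<omega> B)"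
    using hausdorff_hyperplane_cylinder[OF \<omega> LB' LB W hyperplane_disc_borel] by (simp add: cyl)
  also have "emeasure lborel (L ` cylinder \<omega> B)
      = c * emeasure lborel (cylinder \<omega> B)"
    using B by (intro vol cylinder_borel)
  also have "?H ?W * (c * emeasure lborel (cylinder \<omega> B))
      = c * (?H B * ?c)"
    using hausdorff_hyperplane_cylinder[OF \<omega> B(1,2) W hyperplane_disc_borel]
    by (simp add: ac_simps)
  finally have "?c * ?H (L ` B) = ?c * (c * ?H B)"
    by (simp add: ac_simps)
  then show ?thesis
    using cylinder_disc_measure[OF \<omega>] by (subst (asm) ennreal_mult_cancel_left) auto
qed

text \<open>
  The reflection in the hyperplane orthogonal to \<open>a - b\<close>. For \<open>a = b\<close> the division by zero
  in its formula yields the identity, as it should.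
\<close>
lemma reflection_exists:
  fixes a b :: "real^'n::finite"
  assumes ab: "norm a = norm b"
  obtains f where "orthogonal_transformation f" "f a = b"
    "\<And>x. x \<bullet> a = 0 \<Longrightarrow> x \<bullet> b = 0 \<Longrightarrow> f x = x"
proof -
  define w where "w = a - b"
  define f where "f x = x - (2 * (x \<bullet> w) / (w \<bullet> w)) *\<^sub>R w" for x
  have aa: "a \<bullet> a = b \<bullet> b" using ab by (simp add: norm_eq_sqrt_inner)
  have ww: "w \<bullet> w = 2 * (a \<bullet> w)"
    using aa by (simp add: w_def inner_diff_left inner_diff_right inner_commute[of b a])
  have "linear f"
  proof (rule linearI)
    show "f (x + y) = f x + f y" for x y
      by (simp add: f_def inner_left_distrib distrib_left add_divide_distrib scaleR_left_distrib)
    show "f (r *\<^sub>R x) = r *\<^sub>R f x" for r x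
      by (simp add: f_def scaleR_diff_right mult.left_commute)
  qed
  moreover have "f x \<bullet> f y = x \<bullet> y" for x y
  proof -
    have "f x \<bullet> f y = x \<bullet> y - (2 * (y \<bullet> w) / (w \<bullet> w)) * (x \<bullet> w) - (2 * (x \<bullet> w) / (w \<bullet> w)) * (y \<bullet> w)
        + (2 * (x \<bullet> w) / (w \<bullet> w)) * (2 * (y \<bullet> w) / (w \<bullet> w)) * (w \<bullet> w)"
      by (simp add: f_def inner_diff_left inner_diff_right inner_commute[of w y])
    also have "\<dots> = x \<bullet> y"
      by (cases "w = 0") (simp_all add: field_simps)
    finally show ?thesis .
  qed
  moreover have "f a = b"
  proof (cases "w = 0")
    case False
    then have "2 * (a \<bullet> w) / (w \<bullet> w) = 1" by (metis ww div_self inner_eq_zero_iff)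
    then have "f a = a - w" by (simp only: f_def scaleR_one)
    then show ?thesis by (simp add: w_def)
  qed (simp add: f_def w_def)
  moreover have "f x = x" if "x \<bullet> a = 0" "x \<bullet> b = 0" for x
    using that by (simp add: f_def w_def inner_diff_right)
  ultimately show thesis by (intro that[of f]) (simp_all add: orthogonal_transformation_def)
qed

lemma orthogonal_transformation_surj_euclidean:
  fixes f :: "'a::euclidean_space \<Rightarrow> 'a"
  assumes "orthogonal_transformation f"
  shows "surj f"
proof -
  have "linear f" "inj f"
    using assms orthogonal_transformation_inj by (auto simp: orthogonal_transformation_def)
  then show ?thesis by (rule linear_inj_imp_surj)
qed

text \<open>
  Reduces statements about an arbitrary normal and an arbitrary tangent direction to coordinate
  axes.
\<close>
lemma orthonormal_pair_rotation:
  fixes \<omega> u :: "real^'n::finite"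
    and j k :: 'n
  assumes \<omega>: "norm \<omega> = 1" and u: "norm u = 1" "u \<bullet> \<omega> = 0" and jk: "j \<noteq> k"
  obtains f where "orthogonal_transformation f" "f (axis k (1::real)) = \<omega>" "f (axis j (1::real)) = u"
proof -
  obtain f1 :: "real^'n \<Rightarrow> real^'n" where f1: "orthogonal_transformation f1" "f1 (axis k 1) = \<omega>"
    using orthogonal_transformation_exists[of "axis k 1" \<omega>] \<omega> by auto
  obtain u' where u': "u = f1 u'"
    using orthogonal_transformation_surj_euclidean[OF f1(1)] by (metis surjD)
  have dot: "f1 x \<bullet> f1 y = x \<bullet> y" for x y using f1(1) by (simp add: orthogonal_transformation_def)
  have "u' \<bullet> axis k 1 = 0" using u(2) dot by (simp add: u' f1(2)[symmetric])
  moreover have "norm u' = norm (axis j 1 :: real^'n)"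
    using u(1) f1(1) by (simp add: u' orthogonal_transformation_norm)
  ultimately have n': "norm (axis j 1 :: real^'n) = norm u'" and "axis k 1 \<bullet> u' = 0"
    by (simp_all add: inner_commute)
  moreover have "axis k 1 \<bullet> (axis j 1 :: real^'n) = 0"
    using jk by (simp add: inner_axis_axis)
  moreover obtain f2 where f2: "orthogonal_transformation f2" "f2 (axis j 1) = u'"
    and fixed: "\<And>x. x \<bullet> axis j 1 = 0 \<Longrightarrow> x \<bullet> u' = 0 \<Longrightarrow> f2 x = x"
    by (rule reflection_exists[OF n']) auto
  ultimately have "f2 (axis k 1) = axis k 1" by simp
  show thesis
  proof (rule that[of "f1 \<circ> f2"])
    show "orthogonal_transformation (f1 \<circ> f2)"
      by (rule orthogonal_transformation_compose[OF f1(1) f2(1)])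
    show "(f1 \<circ> f2) (axis k 1) = \<omega>"
      by (simp only: o_apply \<open>f2 (axis k 1) = axis k 1\<close> f1(2))
    show "(f1 \<circ> f2) (axis j 1) = u"
      by (simp only: o_apply f2(2) u')
  qed
qed

text \<open>
  After a rotation the stretched direction is a coordinate axis, where the effect of the map on
  Lebesgue measure is that of a diagonal matrix.
\<close>
lemma hausdorff_stretch_hyperplane:
  fixes \<omega> u :: "real^'n::finite"
  assumes n: "CARD('n) \<ge> 2" and \<omega>: "norm \<omega> = 1" and u: "norm u = 1" "u \<bullet> \<omega> = 0" and s: "s > 0"
    and B: "B \<subseteq> hyperplane \<omega>" "B \<in> sets borel"
  shows "hausdorff_outer (CARD('n) - 1) ((\<lambda>x. x + ((s - 1) * (u \<bullet> x)) *\<^sub>R u) ` B)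
       = ennreal s * hausdorff_outer (CARD('n) - 1) B"
proof -
  let ?H = "hausdorff_outer (CARD('n) - 1) :: (real^'n) set \<Rightarrow> ennreal"
  let ?N = "\<lambda>x. x + ((s - 1) * (u \<bullet> x)) *\<^sub>R u"
  obtain k :: 'n where True by simp
  have "UNIV \<noteq> {k}"
  proof
    assume "UNIV = {k}"
    then have "CARD('n) = card {k}" by (rule arg_cong)
    with n show False by simp
  qed
  then obtain j where kj: "j \<noteq> k" by auto
  obtain f :: "real^'n \<Rightarrow> real^'n"
    where f: "orthogonal_transformation f" "f (axis k 1) = \<omega>" "f (axis j 1) = u"
    using orthonormal_pair_rotation[OF \<omega> u kj] by blast
  have lf: "linear f" and dot: "f x \<bullet> f y = x \<bullet> y" for x y
    using f(1) by (auto simp: orthogonal_transformation_def)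
  have surj: "surj f" by (rule orthogonal_transformation_surj_euclidean[OF f(1)])
  have iso: "?H (f ` A) = ?H A" for A
  proof -
    have "?H (f ` A) = ?H ((\<lambda>x. x) ` A)"
      by (rule hausdorff_outer_isometry) (metis f(1) orthogonal_transformation_isometry)
    then show ?thesis by simp
  qed
  define D where "D x = x + ((s - 1) * (x $ j)) *\<^sub>R axis j 1" for x :: "real^'n"
  have lD: "linear D" unfolding D_def by (intro linearI) (auto simp: algebra_simps)
  have D_nth: "D x $ i = (if i = j then s else 1) * x $ i" for x i
    by (auto simp: D_def axis_def algebra_simps)
  have injD: "inj D"
    using s by (intro injI) (auto simp: vec_eq_iff D_nth split: if_splits)
  have ND: "?N (f x) = f (D x)" for x
    using dot[of "axis j 1" x]
    by (simp add: D_def f(3) linear_add[OF lf] linear_scale[OF lf] inner_axis')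
  define B' where "B' = f -` B"
  have fB': "f ` B' = B" unfolding B'_def using surj by (simp add: surj_image_vimage_eq)
  have B'k: "B' \<subseteq> hyperplane (axis k 1)"
    using B(1) dot[of _ "axis k 1"] by (auto simp: B'_def hyperplane_def f(2))
  have B'b: "B' \<in> sets borel"
  proof -
    have "f \<in> borel_measurable borel"
      using lf by (intro borel_measurable_continuous_onI linear_continuous_on linear_conv_bounded_linear[THEN iffD1])
    then show ?thesis using B(2) unfolding B'_def by (metis Int_UNIV_right measurable_sets space_borel)
  qed
  have "?N ` B = f ` (D ` B')"
    by (subst fB'[symmetric]) (simp only: image_image ND)
  then have "?H (?N ` B) = ?H (D ` B')" by (simp only: iso)
  also have "\<dots> = ennreal s * ?H B'"
  proof (rule hausdorff_linear_image_hyperplane[OF _ lD injD _ _ _ B'k B'b])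
    show "D (axis k 1) = axis k 1" using kj by (simp add: D_def axis_def)
    show "D v \<in> hyperplane (axis k 1)" if "v \<in> hyperplane (axis k 1)" for v
      using that kj by (simp add: hyperplane_def inner_axis D_nth)
    fix A :: "(real^'n) set" assume A: "A \<in> sets borel"
    let ?c = "\<lambda>b :: real^'n. if b = axis j 1 then s else 1"
    have T: "(0 :: real^'n) + (\<Sum>b\<in>Basis. (?c b * (x \<bullet> b)) *\<^sub>R b) = D x" for x
    proof -
      have "(\<Sum>b\<in>Basis. (?c b * (x \<bullet> b)) *\<^sub>R b)
          = (\<Sum>b\<in>Basis. (x \<bullet> b) *\<^sub>R b + (if b = axis j 1 then ((s - 1) * (x \<bullet> b)) *\<^sub>R b else 0))"
        by (rule sum.cong) (auto simp: algebra_simps)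
      also have "\<dots> = D x"
        by (simp add: sum.distrib euclidean_representation D_def inner_axis)
      finally show ?thesis by simp
    qed
    have prod: "(\<Prod>b\<in>Basis. \<bar>?c b\<bar>) = s"
    proof -
      have "(\<Prod>b\<in>Basis. \<bar>?c b\<bar>) = (\<Prod>b\<in>(Basis :: (real^'n) set). if b = axis j 1 then s else 1)"
        using s by (intro prod.cong) auto
      also have "\<dots> = s" by (subst prod.delta) (auto)
      finally show ?thesis .
    qed
    have DA: "D ` A \<in> sets borel" by (rule linear_inj_image_borel[OF lD injD A])
    have mD [measurable]: "D \<in> borel_measurable borel"
      using lD by (intro borel_measurable_continuous_onI linear_continuous_on linear_conv_bounded_linear[THEN iffD1])
    have "lborel = density (distr lborel borel D) (\<lambda>_. ennreal s)"
      using lborel_affine_euclidean[of ?c "0 :: real^'n"] s unfolding T prod by simp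
    then have "emeasure lborel (D ` A) = emeasure (density (distr lborel borel D) (\<lambda>_. ennreal s)) (D ` A)"
      by simp
    also have "\<dots> = ennreal s * emeasure lborel (D -` D ` A)"
      using DA by (simp add: emeasure_density nn_integral_cmult_indicator emeasure_distr)
    also have "D -` D ` A = A" using injD by (rule inj_vimage_image_eq)
    finally show "emeasure lborel (D ` A) = ennreal s * emeasure lborel A" .
  qed simp
  also have "?H B' = ?H B" using iso[of B'] by (simp add: fB')
  finally show ?thesis .
qed

text \<open>
  The tilted map \<open>v \<mapsto> v + (m \<bullet> v) \<omega>\<close> leaves the hyperplane, but on it all distances are the same as
  for the stretch \<open>N\<close> by \<open>sqrt (1 + |m|\<^sup>2)\<close> in the direction of \<open>m\<close>, which stays inside. Hausdorff measure sees only
  distances.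
\<close>
lemma hausdorff_graph_over_hyperplane:
  fixes \<omega> m :: "real^'n::finite"
  assumes n: "CARD('n) \<ge> 2" and \<omega>: "norm \<omega> = 1" and m: "m \<in> hyperplane \<omega>" and r: "r > 0"
    and B: "B \<subseteq> hyperplane \<omega>" "B \<in> sets borel"
  shows "hausdorff_outer (CARD('n) - 1) ((\<lambda>v. r *\<^sub>R (v + (m \<bullet> v) *\<^sub>R \<omega>)) ` B)
       = ennreal (r ^ (CARD('n) - 1) * sqrt (1 + (norm m)\<^sup>2)) * hausdorff_outer (CARD('n) - 1) B"
proof -
  let ?H = "hausdorff_outer (CARD('n) - 1) :: (real^'n) set \<Rightarrow> ennreal"
  define s where "s = sqrt (1 + (norm m)\<^sup>2)"
  have s: "s > 0" "s\<^sup>2 = 1 + (norm m)\<^sup>2" by (auto simp: s_def add_pos_nonneg)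
  define u where "u = m /\<^sub>R norm m"
  define N where "N x = x + ((s - 1) * (u \<bullet> x)) *\<^sub>R u" for x
  have NB: "?H (N ` B) = ennreal s * ?H B"
  proof (cases "m = 0")
    case True
    then show ?thesis by (simp add: N_def s_def u_def)
  next
    case False
    then show ?thesis
      unfolding N_def using m s
      by (intro hausdorff_stretch_hyperplane[OF n \<omega> _ _ _ B]) (auto simp: u_def hyperplane_def)
  qed
  have norm_N: "norm (v + (m \<bullet> v) *\<^sub>R \<omega>) = norm (N v)" if v: "v \<in> hyperplane \<omega>" for v
  proof -
    have mu: "m = norm m *\<^sub>R u" by (cases "m = 0") (simp_all add: u_def)
    have "(norm (N v))\<^sup>2 = (norm v)\<^sup>2 + (2 * (s - 1) + (s - 1)\<^sup>2 * (u \<bullet> u)) * (u \<bullet> v)\<^sup>2"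
      unfolding power2_norm_eq_inner N_def
      by (simp add: inner_left_distrib inner_right_distrib inner_commute[of v u] power2_eq_square algebra_simps)
    also have "(2 * (s - 1) + (s - 1)\<^sup>2 * (u \<bullet> u)) * (u \<bullet> v)\<^sup>2 = (s\<^sup>2 - 1) * (u \<bullet> v)\<^sup>2"
    proof (cases "m = 0")
      case False
      then have "u \<bullet> u = 1" by (simp add: u_def dot_square_norm power2_eq_square)
      then show ?thesis by (simp add: power2_eq_square algebra_simps)
    qed (simp add: u_def)
    also have "\<dots> = (m \<bullet> v)\<^sup>2"
      by (subst mu) (simp add: s power_mult_distrib)
    also have "(norm v)\<^sup>2 + (m \<bullet> v)\<^sup>2 = (norm (v + (m \<bullet> v) *\<^sub>R \<omega>))\<^sup>2"
    proof -
      have "\<omega> \<bullet> \<omega> = 1" using \<omega> by (simp add: dot_square_norm)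
      then show ?thesis
        using v unfolding power2_norm_eq_inner
        by (simp add: inner_left_distrib inner_right_distrib hyperplane_def
            inner_commute[of \<omega> v] power2_eq_square)
    qed
    finally show ?thesis by simp
  qed
  have linN: "N x - N y = N (x - y)" for x y
    by (simp add: N_def inner_diff_right algebra_simps)
  have "?H ((\<lambda>v. r *\<^sub>R (v + (m \<bullet> v) *\<^sub>R \<omega>)) ` B) = ennreal (r ^ (CARD('n) - 1)) * ?H (N ` B)"
  proof (rule hausdorff_outer_similarity[OF r])
    fix x y assume "x \<in> B" "y \<in> B"
    then have xy: "x - y \<in> hyperplane \<omega>" using subsetD[OF B(1), of x] subsetD[OF B(1), of y] by (simp add: hyperplane_def inner_diff_left)
    have "r *\<^sub>R (x + (m \<bullet> x) *\<^sub>R \<omega>) - r *\<^sub>R (y + (m \<bullet> y) *\<^sub>R \<omega>) = r *\<^sub>R ((x - y) + (m \<bullet> (x - y)) *\<^sub>R \<omega>)"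
      by (simp add: algebra_simps inner_diff_right)
    then show "dist (r *\<^sub>R (x + (m \<bullet> x) *\<^sub>R \<omega>)) (r *\<^sub>R (y + (m \<bullet> y) *\<^sub>R \<omega>)) = r * dist (N x) (N y)"
      using r norm_N[OF xy] by (simp add: dist_norm linN)
  qed
  also have "\<dots> = ennreal (r ^ (CARD('n) - 1) * s) * ?H B"
    unfolding NB using s r by (simp add: ennreal_mult mult.assoc)
  finally show ?thesis unfolding s_def .
qed

section \<open>The area formula for radial graphs over the sphere\<close>
lemma ennreal_le_of_le_mult_all:
  fixes x y :: ennreal
  assumes "\<And>K::real. K > 1 \<Longrightarrow> x \<le> ennreal K * y"
  shows "x \<le> y"
proof -
  have "((\<lambda>k. ennreal (1 + inverse (real (Suc k))) * y) \<longlongrightarrow> ennreal (1 + 0) * y) sequentially"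
    by (intro tendsto_mult_ennreal tendsto_ennrealI tendsto_add tendsto_const LIMSEQ_inverse_real_of_nat) auto
  moreover have "x \<le> ennreal (1 + inverse (real (Suc k))) * y" for k
    by (rule assms) simp
  ultimately show ?thesis using LIMSEQ_le_const by fastforce
qed

text \<open>
  Cutting \<open>A\<close> along a countable subcover into pieces, each within one of the neighbourhoods for a given
  \<open>K\<close>, carries the comparison from the pieces to \<open>A\<close>; then \<open>K\<close> tends to \<open>1\<close>.
\<close>
lemma emeasure_eq_of_local_comparison:
  fixes M N :: "'a::{metric_space, second_countable_topology} measure"
  assumes sets [simp, measurable_cong]: "sets M = sets borel" "sets N = sets borel"
    and loc: "\<And>K x. K > 1 \<Longrightarrow> x \<in> U \<Longrightarrow> \<exists>\<delta>>0. \<forall>A\<in>sets borel. A \<subseteq> U \<inter> ball x \<delta> \<longrightarrow>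
               emeasure M A \<le> ennreal K * emeasure N A \<and> emeasure N A \<le> ennreal K * emeasure M A"
    and A: "A \<in> sets borel" "A \<subseteq> U"
  shows "emeasure M A = emeasure N A"
proof -
  have main: "emeasure M A \<le> ennreal K * emeasure N A \<and> emeasure N A \<le> ennreal K * emeasure M A"
    if K: "K > 1" for K
  proof -
    obtain \<delta> where \<delta>: "\<And>x. x \<in> U \<Longrightarrow> \<delta> x > 0"
      and cmp: "\<And>x B. x \<in> U \<Longrightarrow> B \<in> sets borel \<Longrightarrow> B \<subseteq> U \<inter> ball x (\<delta> x) \<Longrightarrow>
               emeasure M B \<le> ennreal K * emeasure N B \<and> emeasure N B \<le> ennreal K * emeasure M B"
      using loc[OF K] by metis
    obtain \<F> where \<F>: "\<F> \<subseteq> (\<lambda>x. ball x (\<delta> x)) ` U" "countable \<F>" "\<Union>\<F> = (\<Union>x\<in>U. ball x (\<delta> x))"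
      using Lindelof[of "(\<lambda>x. ball x (\<delta> x)) ` U"] by (metis (no_types, lifting) image_iff open_ball)
    define B where "B = from_nat_into (insert {} \<F>)"
    have rB: "range B = insert {} \<F>"
      unfolding B_def using \<F>(2) by (intro range_from_nat_into) auto
    have [measurable]: "B i \<in> sets borel" for i
      using \<F>(1) rB rangeI[of B i] by (auto simp: subset_iff image_iff)
    define D where "D i = A \<inter> disjointed B i" for i
    have "range (disjointed B) \<subseteq> sets borel"
      by (rule sets.range_disjointed_sets) auto
    then have D: "D i \<in> sets borel" for i
      unfolding D_def using A(1) by (intro sets.Int) auto
    have disj: "disjoint_family D"
      using disjoint_family_disjointed[of B] unfolding D_def disjoint_family_on_def by blast
    have "A \<subseteq> \<Union>\<F>"
    proof
      fix x assume "x \<in> A"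
      then show "x \<in> \<Union>\<F>" unfolding \<F>(3) using A(2) \<delta> by (intro UN_I[of x]) auto
    qed
    also have "\<dots> \<subseteq> (\<Union>i. B i)" using rB by auto
    finally have AD: "A = (\<Union>i. D i)"
      unfolding D_def using UN_disjointed_eq[of B] by auto
    have each: "emeasure M (D i) \<le> ennreal K * emeasure N (D i) \<and> emeasure N (D i) \<le> ennreal K * emeasure M (D i)" for i
    proof -
      have "B i \<in> insert {} \<F>" using rB by auto
      then consider "B i = {}" | x where "x \<in> U" "B i = ball x (\<delta> x)" using \<F>(1) by auto
      then show ?thesis
      proof cases
        case 1
        then have "D i = {}" using disjointed_subset[of B i] by (auto simp: D_def)
        then show ?thesis by simp
      next
        case 2
        then show ?thesis using disjointed_subset[of B i] A(2) by (intro cmp D) (auto simp: D_def)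
      qed
    qed
    have sum: "emeasure M A = (\<Sum>i. emeasure M (D i))" "emeasure N A = (\<Sum>i. emeasure N (D i))"
      unfolding AD using D disj by (auto intro!: suminf_emeasure[symmetric])
    show ?thesis
      unfolding sum ennreal_suminf_cmult[symmetric] using each by (intro conjI suminf_le summableI) auto
  qed
  show ?thesis
    by (rule antisym; rule ennreal_le_of_le_mult_all) (use main in auto)
qed

lemma norm_hyperplane_proj_le: "norm \<omega> = 1 \<Longrightarrow> norm (hyperplane_proj \<omega> v) \<le> norm v"
proof -
  assume "norm \<omega> = 1"
  then have "\<omega> \<bullet> \<omega> = 1" by (simp add: dot_square_norm)
  then have "(norm (hyperplane_proj \<omega> v))\<^sup>2 = (norm v)\<^sup>2 - (v \<bullet> \<omega>)\<^sup>2"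
    unfolding power2_norm_eq_inner hyperplane_proj_def
    by (simp add: inner_diff_left inner_diff_right inner_commute[of \<omega> v] power2_eq_square)
  then have "(norm (hyperplane_proj \<omega> v))\<^sup>2 \<le> (norm v)\<^sup>2" by simp
  then show ?thesis by (rule power2_le_imp_le) simp
qed

text \<open>
  A chord of the sphere is orthogonal to the direction of its midpoint, which is within \<open>\<delta>\<close> of \<open>\<omega>\<close>.
\<close>
lemma sphere_chord_almost_tangent:
  fixes x y \<omega> :: "'a::real_inner"
  assumes "norm x = 1" "norm y = 1" "norm (x - \<omega>) \<le> \<delta>" "norm (y - \<omega>) \<le> \<delta>"
  shows "\<bar>(x - y) \<bullet> \<omega>\<bar> \<le> \<delta> * norm (x - y)"
proof -
  have "(x - y) \<bullet> (x + y) = 0"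
    using assms(1,2) by (simp add: inner_diff_left inner_add_right dot_square_norm inner_commute[of y x])
  then have eq: "(x - y) \<bullet> \<omega> = (x - y) \<bullet> (\<omega> - (1/2) *\<^sub>R (x + y))"
    by (simp add: inner_diff_right)
  have "\<omega> - (1/2) *\<^sub>R (x + y) = (-1/2) *\<^sub>R ((x - \<omega>) + (y - \<omega>))"
    by (simp add: algebra_simps flip: scaleR_add_left)
  then have "norm (\<omega> - (1/2) *\<^sub>R (x + y)) \<le> 1/2 * (norm (x - \<omega>) + norm (y - \<omega>))"
    using norm_triangle_ineq[of "x - \<omega>" "y - \<omega>"] by simp
  also have "\<dots> \<le> \<delta>" using assms by simp
  finally have "norm (\<omega> - (1/2) *\<^sub>R (x + y)) \<le> \<delta>" .
  then have "norm (x - y) * norm (\<omega> - (1/2) *\<^sub>R (x + y)) \<le> \<delta> * norm (x - y)"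
    by (subst mult.commute) (rule mult_right_mono, auto)
  then show ?thesis unfolding eq using Cauchy_Schwarz_ineq2 order_trans by blast
qed

text \<open>
  For a continuously differentiable function the linearization at \<open>\<omega>\<close> controls differences between
  any two nearby points, not only differences to \<open>\<omega>\<close> itself. This uniformity is what turns a
  derivative into a bound on distances.
\<close>
lemma radial_graph_strict_linearization:
  fixes r :: "real^'n::finite \<Rightarrow> real" and gr :: "real^'n \<Rightarrow> real^'n"
  assumes V: "open V" "\<omega> \<in> V"
    and deriv: "\<And>x. x \<in> V \<Longrightarrow> GDERIV r x :> gr x" and cont: "continuous_on V gr"
    and \<eta>: "\<eta> > 0"
  shows "\<exists>\<delta>>0. \<forall>x\<in>ball \<omega> \<delta>. \<forall>y\<in>ball \<omega> \<delta>.
     norm ((r x *\<^sub>R x - r y *\<^sub>R y) - (r \<omega> *\<^sub>R (x - y) + (gr \<omega> \<bullet> (x - y)) *\<^sub>R \<omega>)) \<le> \<eta> * norm (x - y)"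
proof -
  define e where "e x = \<bar>r x - r \<omega>\<bar> + norm (gr x - gr \<omega>) * norm x + norm (gr \<omega>) * norm (x - \<omega>)" for x
  have "isCont r \<omega>"
    using deriv[OF V(2)] unfolding gderiv_def by (rule has_derivative_continuous)
  moreover have "isCont gr \<omega>" using V cont by (simp add: continuous_on_eq_continuous_at)
  ultimately have "isCont e \<omega>" unfolding e_def by (intro continuous_intros)
  then have "(e \<longlongrightarrow> 0) (at \<omega>)" unfolding isCont_def by (simp add: e_def)
  then have "\<forall>\<^sub>F x in at \<omega>. e x < \<eta>" using \<eta> by (rule order_tendstoD)
  then obtain d1 where d1: "d1 > 0" "\<And>x. x \<noteq> \<omega> \<Longrightarrow> dist x \<omega> < d1 \<Longrightarrow> e x < \<eta>"
    by (auto simp: eventually_at)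
  obtain d2 where d2: "d2 > 0" "ball \<omega> d2 \<subseteq> V" using V by (meson openE)
  define T where "T h = r \<omega> *\<^sub>R h + (gr \<omega> \<bullet> h) *\<^sub>R \<omega>" for h
  have blT: "bounded_linear T"
    unfolding T_def by (intro bounded_linear_intros)
  define f where "f x = r x *\<^sub>R x - T x" for x
  define f' where "f' x h = (r x *\<^sub>R h + (h \<bullet> gr x) *\<^sub>R x) - T h" for x h
  have "norm (f x - f y) \<le> \<eta> * norm (x - y)" if "x \<in> ball \<omega> (min d1 d2)" "y \<in> ball \<omega> (min d1 d2)" for x y
  proof (rule differentiable_bound[OF convex_ball _ _ that, of f f'])
    fix x assume x: "x \<in> ball \<omega> (min d1 d2)"
    then have "GDERIV r x :> gr x" using deriv d2 by auto
    then have "(r has_derivative (\<lambda>h. h \<bullet> gr x)) (at x)" unfolding gderiv_def .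
    then have "(f has_derivative f' x) (at x)"
      unfolding f_def[abs_def] f'_def[abs_def]
      by (intro has_derivative_diff has_derivative_scaleR has_derivative_ident
            bounded_linear_imp_has_derivative blT)
    then show "(f has_derivative f' x) (at x within ball \<omega> (min d1 d2))" by (rule has_derivative_at_withinI)
    have ex: "e x \<le> \<eta>" using d1 x \<eta> by (cases "x = \<omega>") (auto simp: e_def dist_commute less_imp_le)
    show "onorm (f' x) \<le> \<eta>"
    proof (rule onorm_le)
      fix h
      have "f' x h = (r x - r \<omega>) *\<^sub>R h + (h \<bullet> (gr x - gr \<omega>)) *\<^sub>R x + (h \<bullet> gr \<omega>) *\<^sub>R (x - \<omega>)"
        by (simp add: f'_def T_def inner_diff_right algebra_simps inner_commute[of h "gr \<omega>"])
      also have "norm \<dots> \<le> norm ((r x - r \<omega>) *\<^sub>R h) + norm ((h \<bullet> (gr x - gr \<omega>)) *\<^sub>R x) + norm ((h \<bullet> gr \<omega>) *\<^sub>R (x - \<omega>))"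
        by (intro norm_triangle_le add_mono norm_triangle_ineq order_refl)
      also have "\<dots> \<le> \<bar>r x - r \<omega>\<bar> * norm h + (norm h * norm (gr x - gr \<omega>)) * norm x + (norm h * norm (gr \<omega>)) * norm (x - \<omega>)"
        by (auto intro!: add_mono mult_right_mono Cauchy_Schwarz_ineq2)
      also have "\<dots> = e x * norm h" by (simp add: e_def algebra_simps)
      also have "\<dots> \<le> \<eta> * norm h" using ex by (rule mult_right_mono) simp
      finally show "norm (f' x h) \<le> \<eta> * norm h" .
    qed
  qed
  moreover have "f x - f y = (r x *\<^sub>R x - r y *\<^sub>R y) - (r \<omega> *\<^sub>R (x - y) + (gr \<omega> \<bullet> (x - y)) *\<^sub>R \<omega>)" for x y
    by (simp add: f_def T_def inner_diff_right algebra_simps)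
  ultimately show ?thesis
    using d1 d2 by (intro exI[of _ "min d1 d2"]) auto
qed

text \<open>
  For two points of the sphere near \<open>\<omega>\<close>, the difference of the image points is that of the linear
  map \<open>M\<close> on the tangential part \<open>z\<close> of the chord, up to an error that is small against the chord.
  The linear map moves \<open>z\<close> by at least \<open>r \<omega> * norm z\<close>, as \<open>z\<close> and \<open>\<omega>\<close> are orthogonal, so the absolute error
  is also a relative one.
\<close>
lemma radial_graph_bilipschitz:
  fixes r :: "real^'n::finite \<Rightarrow> real" and gr :: "real^'n \<Rightarrow> real^'n"
  assumes V: "open V" "\<omega> \<in> V"
    and deriv: "\<And>x. x \<in> V \<Longrightarrow> GDERIV r x :> gr x" and cont: "continuous_on V gr"
    and \<omega>: "norm \<omega> = 1" and r: "r \<omega> > 0" and K: "K > 1"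
  defines "m \<equiv> hyperplane_proj \<omega> (gr \<omega>) /\<^sub>R r \<omega>"
  defines "M \<equiv> \<lambda>v. r \<omega> *\<^sub>R (v + (m \<bullet> v) *\<^sub>R \<omega>)"
  shows "\<exists>\<delta>>0. \<delta> < 1 \<and> (\<forall>x\<in>sphere 0 1 \<inter> ball \<omega> \<delta>. \<forall>y\<in>sphere 0 1 \<inter> ball \<omega> \<delta>.
      norm (r x *\<^sub>R x - r y *\<^sub>R y) \<le> K * norm (M (hyperplane_proj \<omega> (x - y)))
    \<and> norm (M (hyperplane_proj \<omega> (x - y))) \<le> K * norm (r x *\<^sub>R x - r y *\<^sub>R y)
    \<and> norm (x - y) \<le> K * norm (hyperplane_proj \<omega> (x - y)))"
proof -
  \<comment> \<open>the relative error: both \<open>1 + \<tau> \<le> K\<close> and \<open>1 - \<tau> = 1 / K\<close>\<close>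
  define \<tau> where "\<tau> = 1 - 1 / K"
  have \<tau>: "0 < \<tau>" "\<tau> < 1" using K by (auto simp: \<tau>_def)
  have K1: "K * (1 - \<tau>) = 1" using K by (simp add: \<tau>_def)
  have K2: "1 + \<tau> \<le> K"
  proof -
    have "(K - 1)\<^sup>2 \<ge> 0" by simp
    then show ?thesis using K by (simp add: \<tau>_def field_simps power2_eq_square)
  qed
  \<comment> \<open>a bound for the derivative at \<open>\<omega>\<close>\<close>
  define L where "L = r \<omega> + norm (gr \<omega>)"
  have L: "L > 0" using r by (simp add: L_def add_pos_nonneg)
  obtain d where d: "d > 0" and lin: "\<And>x y. x \<in> ball \<omega> d \<Longrightarrow> y \<in> ball \<omega> d \<Longrightarrow>
     norm ((r x *\<^sub>R x - r y *\<^sub>R y) - (r \<omega> *\<^sub>R (x - y) + (gr \<omega> \<bullet> (x - y)) *\<^sub>R \<omega>)) \<le> (\<tau> * r \<omega> / 4) * norm (x - y)"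
    using radial_graph_strict_linearization[OF V deriv cont, of "\<tau> * r \<omega> / 4"] \<tau> r by auto
  \<comment> \<open>the linearization error and the normal part of the chord may each use half of the admissible error \<open>\<tau> * r \<omega> / 2\<close> per length\<close>
  define \<delta> where "\<delta> = min (min d (1/2)) (min \<tau> (\<tau> * r \<omega> / (4 * L)))"
  have \<delta>: "0 < \<delta>" "\<delta> < 1" "\<delta> \<le> d" "\<delta> \<le> 1/2" "\<delta> \<le> \<tau>" "\<delta> \<le> \<tau> * r \<omega> / (4 * L)"
    using d \<tau> r L by (auto simp: \<delta>_def)
  have \<delta>L: "L * \<delta> \<le> \<tau> * r \<omega> / 4"
    using \<delta>(6) L by (simp add: field_simps)
  have \<omega>\<omega>: "\<omega> \<bullet> \<omega> = 1" using \<omega> by (simp add: dot_square_norm)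
  have key: "norm (r x *\<^sub>R x - r y *\<^sub>R y) \<le> K * norm (M (hyperplane_proj \<omega> (x - y)))
    \<and> norm (M (hyperplane_proj \<omega> (x - y))) \<le> K * norm (r x *\<^sub>R x - r y *\<^sub>R y)
    \<and> norm (x - y) \<le> K * norm (hyperplane_proj \<omega> (x - y))"
    if x: "x \<in> sphere 0 1 \<inter> ball \<omega> \<delta>" and y: "y \<in> sphere 0 1 \<inter> ball \<omega> \<delta>" for x y
  proof -
    define h where "h = x - y"
    define z where "z = hyperplane_proj \<omega> h"
    define \<Delta> where "\<Delta> = r x *\<^sub>R x - r y *\<^sub>R y"
    define T where "T v = r \<omega> *\<^sub>R v + (gr \<omega> \<bullet> v) *\<^sub>R \<omega>" for v
    have z\<omega>: "z \<bullet> \<omega> = 0" using hyperplane_proj_in_hyperplane[OF \<omega>, of h] by (simp add: z_def hyperplane_def)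
    have "\<bar>h \<bullet> \<omega>\<bar> \<le> \<delta> * norm h"
      unfolding h_def using x y by (intro sphere_chord_almost_tangent) (auto simp: dist_norm norm_minus_commute)
    moreover have hz: "h - z = (h \<bullet> \<omega>) *\<^sub>R \<omega>" by (simp add: z_def hyperplane_proj_def)
    ultimately have n1: "norm (h - z) \<le> \<delta> * norm h" using \<omega> by simp
    have "norm h \<le> norm z + norm (h - z)" by (metis add.commute diff_add_cancel norm_triangle_ineq)
    with n1 have n2: "(1 - \<delta>) * norm h \<le> norm z" by (simp add: algebra_simps)
    have TM: "T z = M z"
    proof -
      have "r \<omega> * (m \<bullet> z) = hyperplane_proj \<omega> (gr \<omega>) \<bullet> z" using r by (simp add: m_def)
      also have "\<dots> = gr \<omega> \<bullet> z"
        using z\<omega> by (simp add: hyperplane_proj_def inner_diff_left inner_commute[of \<omega> z])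
      finally show ?thesis by (simp add: T_def M_def scaleR_add_right)
    qed
    have "T h - T z = T (h - z)" by (simp add: T_def inner_diff_right algebra_simps)
    moreover have "norm (T v) \<le> L * norm v" for v
    proof -
      have "norm (T v) \<le> norm (r \<omega> *\<^sub>R v) + norm ((gr \<omega> \<bullet> v) *\<^sub>R \<omega>)" unfolding T_def by (rule norm_triangle_ineq)
      also have "\<dots> \<le> r \<omega> * norm v + norm (gr \<omega>) * norm v"
        using r \<omega> Cauchy_Schwarz_ineq2[of "gr \<omega>" v] by simp
      finally show ?thesis by (simp add: L_def algebra_simps)
    qed
    ultimately have n3: "norm (T h - M z) \<le> L * (\<delta> * norm h)"
      using n1 L TM by (metis mult_left_mono less_imp_le order_trans)
    have n4: "norm (\<Delta> - T h) \<le> (\<tau> * r \<omega> / 4) * norm h"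
      using lin[of x y] x y \<delta>(3) by (auto simp: \<Delta>_def T_def h_def)
    have "norm (\<Delta> - M z) \<le> norm (\<Delta> - T h) + norm (T h - M z)"
      using norm_triangle_ineq[of "\<Delta> - T h" "T h - M z"] by simp
    also have "\<dots> \<le> (\<tau> * r \<omega> / 4) * norm h + (\<tau> * r \<omega> / 4) * norm h"
    proof (rule add_mono[OF n4])
      show "norm (T h - M z) \<le> (\<tau> * r \<omega> / 4) * norm h"
        using n3 mult_right_mono[OF \<delta>L, of "norm h"] by (simp add: mult.assoc)
    qed
    finally have n5: "norm (\<Delta> - M z) \<le> \<tau> * (r \<omega> / 2 * norm h)" by (simp add: ac_simps)
    have n6: "r \<omega> / 2 * norm h \<le> norm (M z)"
    proof -
      have "norm h / 2 \<le> (1 - \<delta>) * norm h" using mult_right_mono[of "1/2" "1 - \<delta>" "norm h"] \<delta>(4) by simp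
      then have a: "norm h / 2 \<le> norm z" using n2 by simp
      have "(norm (z + (m \<bullet> z) *\<^sub>R \<omega>))\<^sup>2 = (norm z)\<^sup>2 + (m \<bullet> z)\<^sup>2"
        using z\<omega> \<omega>\<omega> unfolding power2_norm_eq_inner
        by (simp add: inner_left_distrib inner_right_distrib inner_commute[of \<omega> z] power2_eq_square)
      then have "(norm z)\<^sup>2 \<le> (norm (z + (m \<bullet> z) *\<^sub>R \<omega>))\<^sup>2" by simp
      then have "norm z \<le> norm (z + (m \<bullet> z) *\<^sub>R \<omega>)" by (rule power2_le_imp_le) simp
      with a have "r \<omega> * (norm h / 2) \<le> r \<omega> * norm (z + (m \<bullet> z) *\<^sub>R \<omega>)" using r by (intro mult_left_mono) auto
      then show ?thesis using r by (simp add: M_def)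
    qed
    have n7: "norm (\<Delta> - M z) \<le> \<tau> * norm (M z)"
      by (rule order_trans[OF n5 mult_left_mono[OF n6]]) (use \<tau> in simp)
    have "norm \<Delta> \<le> norm (M z) + norm (\<Delta> - M z)" by (metis add.commute diff_add_cancel norm_triangle_ineq)
    also have "\<dots> \<le> (1 + \<tau>) * norm (M z)" using n7 by (simp add: algebra_simps)
    also have "\<dots> \<le> K * norm (M z)" using K2 by (rule mult_right_mono) simp
    finally have c1: "norm \<Delta> \<le> K * norm (M z)" .
    have "norm (M z) \<le> norm \<Delta> + norm (\<Delta> - M z)"
      by (metis norm_minus_commute add.commute diff_add_cancel norm_triangle_ineq)
    with n7 have "(1 - \<tau>) * norm (M z) \<le> norm \<Delta>" by (simp add: algebra_simps)
    then have "K * ((1 - \<tau>) * norm (M z)) \<le> K * norm \<Delta>" using K by simp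
    then have c2: "norm (M z) \<le> K * norm \<Delta>" using K1 by (simp add: mult.assoc[symmetric])
    have "(1 - \<tau>) * norm h \<le> (1 - \<delta>) * norm h" using \<delta>(5) by (intro mult_right_mono) auto
    then have "(1 - \<tau>) * norm h \<le> norm z" using n2 by simp
    then have "K * ((1 - \<tau>) * norm h) \<le> K * norm z" using K by simp
    then have c3: "norm h \<le> K * norm z" using K1 by (simp add: mult.assoc[symmetric])
    show ?thesis using c1 c2 c3 unfolding \<Delta>_def z_def h_def by simp
  qed
  then show ?thesis using \<delta> by blast
qed

text \<open>
  On the open hemisphere around \<open>\<omega>\<close> the projection to the tangent hyperplane has an explicit Borel
  inverse, so the image is a preimage.
\<close>
lemma hyperplane_proj_image_borel:
  fixes \<omega> :: "real^'n::finite"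
  assumes \<omega>: "norm \<omega> = 1" and A: "A \<in> sets borel" "A \<subseteq> sphere 0 1" and pos: "\<And>x. x \<in> A \<Longrightarrow> x \<bullet> \<omega> > 0"
  shows "hyperplane_proj \<omega> ` A \<in> sets borel"
proof -
  have \<omega>\<omega>: "\<omega> \<bullet> \<omega> = 1" using \<omega> by (simp add: dot_square_norm)
  define lift where "lift v = v + sqrt (1 - (norm v)\<^sup>2) *\<^sub>R \<omega>" for v
  have [measurable]: "lift \<in> borel_measurable borel"
    unfolding lift_def by measurable
  note [measurable] = A(1)
  have "hyperplane_proj \<omega> ` A = hyperplane \<omega> \<inter> (lift -` A \<inter> space borel)"
  proof safe
    fix x assume x: "x \<in> A"
    show "hyperplane_proj \<omega> x \<in> hyperplane \<omega>" by (rule hyperplane_proj_in_hyperplane[OF \<omega>])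
    have xx: "x \<bullet> x = 1" using A(2) x by (auto simp: dot_square_norm)
    have "(norm (hyperplane_proj \<omega> x))\<^sup>2 = 1 - (x \<bullet> \<omega>)\<^sup>2"
      using xx \<omega>\<omega> unfolding power2_norm_eq_inner hyperplane_proj_def
      by (simp add: inner_diff_left inner_diff_right inner_commute[of \<omega> x] power2_eq_square)
    then have "lift (hyperplane_proj \<omega> x) = hyperplane_proj \<omega> x + sqrt ((x \<bullet> \<omega>)\<^sup>2) *\<^sub>R \<omega>" by (simp add: lift_def)
    also have "\<dots> = x" using pos[OF x] by (simp add: hyperplane_proj_def)
    finally show "hyperplane_proj \<omega> x \<in> lift -` A" using x by simp
  next
    fix v assume "v \<in> hyperplane \<omega>" "lift v \<in> A"
    moreover from this have "hyperplane_proj \<omega> (lift v) = v"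
      using \<omega>\<omega> by (simp add: hyperplane_proj_def lift_def inner_left_distrib hyperplane_def)
    ultimately show "v \<in> hyperplane_proj \<omega> ` A" by (metis image_eqI)
  qed simp
  also have "\<dots> \<in> sets borel" by measurable
  finally show ?thesis .
qed

text \<open>
  The factor by which \<open>x \<mapsto> p + r x x\<close> multiplies surface measure on the unit sphere: \<open>r x\<close> to the power \<open>n-1\<close>
  for the dilation, and the reciprocal cosine of the angle between the radius and the normal
  of the image. The gradient \<open>gr\<close> enters through its tangential part, the derivative of \<open>r\<close> along the
  sphere.
\<close>
definition radial_jacobian :: "(real^'n::finite \<Rightarrow> real) \<Rightarrow> (real^'n \<Rightarrow> real^'n) \<Rightarrow> real^'n \<Rightarrow> real" where
  "radial_jacobian r gr x =
     r x ^ (CARD('n) - 1) * sqrt (1 + (norm (hyperplane_proj x (gr x) /\<^sub>R r x))\<^sup>2)"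

lemma radial_jacobian_pos: "r x > 0 \<Longrightarrow> radial_jacobian r gr x > 0"
  unfolding radial_jacobian_def by (intro mult_pos_pos zero_less_power) (auto intro: add_pos_nonneg)

text \<open>
  The piece \<open>A\<close> of the sphere is compared with its projection to the tangent hyperplane, that with
  its linear image, and the latter with the image of \<open>A\<close>. Each use of a distance bound costs a factor \<open>K\<close> to
  the power \<open>n-1\<close>, and at most two are used in either direction.
\<close>
lemma radial_graph_local_area:
  fixes r :: "real^'n::finite \<Rightarrow> real" and gr :: "real^'n \<Rightarrow> real^'n"
  assumes n: "CARD('n) \<ge> 2" and V: "open V" "\<omega> \<in> V"
    and deriv: "\<And>x. x \<in> V \<Longrightarrow> GDERIV r x :> gr x" and cont: "continuous_on V gr"
    and \<omega>: "norm \<omega> = 1" and r: "r \<omega> > 0" and K: "K > 1"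
  shows "\<exists>\<delta>>0. \<forall>A\<in>sets borel. A \<subseteq> sphere 0 1 \<inter> ball \<omega> \<delta> \<longrightarrow>
      hausdorff_outer (CARD('n) - 1) ((\<lambda>x. p + r x *\<^sub>R x) ` A)
        \<le> ennreal (K ^ (2 * (CARD('n) - 1))) * (ennreal (radial_jacobian r gr \<omega>) * hausdorff_outer (CARD('n) - 1) A)
    \<and> ennreal (radial_jacobian r gr \<omega>) * hausdorff_outer (CARD('n) - 1) A
        \<le> ennreal (K ^ (2 * (CARD('n) - 1))) * hausdorff_outer (CARD('n) - 1) ((\<lambda>x. p + r x *\<^sub>R x) ` A)"
proof -
  let ?d = "CARD('n) - 1"
  let ?H = "hausdorff_outer (CARD('n) - 1) :: (real^'n) set \<Rightarrow> ennreal"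
  let ?J = "ennreal (radial_jacobian r gr \<omega>)" and ?F = "\<lambda>x. p + r x *\<^sub>R x"
  define m where "m = hyperplane_proj \<omega> (gr \<omega>) /\<^sub>R r \<omega>"
  define M where "M v = r \<omega> *\<^sub>R (v + (m \<bullet> v) *\<^sub>R \<omega>)" for v
  have \<omega>\<omega>: "\<omega> \<bullet> \<omega> = 1" using \<omega> by (simp add: dot_square_norm)
  have m: "m \<in> hyperplane \<omega>"
    using hyperplane_proj_in_hyperplane[OF \<omega>, of "gr \<omega>"] by (simp add: m_def hyperplane_def)
  obtain \<delta> where \<delta>: "0 < \<delta>" "\<delta> < 1"
    and lip: "\<And>x y. x \<in> sphere 0 1 \<inter> ball \<omega> \<delta> \<Longrightarrow> y \<in> sphere 0 1 \<inter> ball \<omega> \<delta> \<Longrightarrow>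
      norm (r x *\<^sub>R x - r y *\<^sub>R y) \<le> K * norm (M (hyperplane_proj \<omega> (x - y)))
    \<and> norm (M (hyperplane_proj \<omega> (x - y))) \<le> K * norm (r x *\<^sub>R x - r y *\<^sub>R y)
    \<and> norm (x - y) \<le> K * norm (hyperplane_proj \<omega> (x - y))"
    using radial_graph_bilipschitz[where r=r and gr=gr and V=V and \<omega>=\<omega> and K=K, OF V deriv cont \<omega> r K]
    unfolding M_def m_def by blast
  have "?H (?F ` A) \<le> ennreal (K ^ (2 * ?d)) * (?J * ?H A) \<and> ?J * ?H A \<le> ennreal (K ^ (2 * ?d)) * ?H (?F ` A)"
    if A: "A \<in> sets borel" "A \<subseteq> sphere 0 1 \<inter> ball \<omega> \<delta>" for A
  proof -
    let ?P = "hyperplane_proj \<omega> ` A"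
    have pos: "x \<bullet> \<omega> > 0" if "x \<in> A" for x
    proof -
      have x: "norm x = 1" "norm (x - \<omega>) < 1" using A(2) that \<delta> by (auto simp: dist_norm norm_minus_commute)
      then have "(norm (x - \<omega>))\<^sup>2 < 1" by (simp add: power_less_one_iff abs_square_less_1)
      moreover have "(norm (x - \<omega>))\<^sup>2 = 2 - 2 * (x \<bullet> \<omega>)"
      proof -
        have "x \<bullet> x = 1" using x(1) by (simp add: dot_square_norm)
        then show ?thesis
          using \<omega>\<omega> unfolding power2_norm_eq_inner
          by (simp add: inner_diff_left inner_diff_right inner_commute[of \<omega> x])
      qed
      ultimately show ?thesis by simp
    qed
    have P: "?P \<in> sets borel" using A by (intro hyperplane_proj_image_borel \<omega> pos) auto
    have P': "?P \<subseteq> hyperplane \<omega>" using hyperplane_proj_in_hyperplane[OF \<omega>] by auto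
    have MP: "?H ((\<lambda>x. M (hyperplane_proj \<omega> x)) ` A) = ?J * ?H ?P"
      using hausdorff_graph_over_hyperplane[OF n \<omega> m r P' P]
      by (simp only: M_def[abs_def] m_def[symmetric] radial_jacobian_def image_image)
    have M_diff: "M (hyperplane_proj \<omega> x) - M (hyperplane_proj \<omega> y) = M (hyperplane_proj \<omega> (x - y))" for x y
      by (simp add: M_def hyperplane_proj_diff inner_diff_right algebra_simps)
    have le1: "?H (?F ` A) \<le> ennreal (K ^ ?d) * (?J * ?H ?P)"
      unfolding MP[symmetric]
      by (rule hausdorff_outer_image_le) (use K lip A(2) in \<open>auto simp: dist_norm M_diff subset_iff\<close>)
    have le2: "?J * ?H ?P \<le> ennreal (K ^ ?d) * ?H (?F ` A)"
      unfolding MP[symmetric]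
      by (rule hausdorff_outer_image_le) (use K lip A(2) in \<open>auto simp: dist_norm M_diff subset_iff\<close>)
    have "?H ?P \<le> ennreal (1 ^ ?d) * ?H ((\<lambda>x. x) ` A)"
      by (rule hausdorff_outer_image_le) (use norm_hyperplane_proj_le[OF \<omega>] in \<open>auto simp: dist_norm simp flip: hyperplane_proj_diff\<close>)
    then have le3: "?H ?P \<le> ?H A" by simp
    have "?H ((\<lambda>x. x) ` A) \<le> ennreal (K ^ ?d) * ?H ?P"
      by (rule hausdorff_outer_image_le)
         (use K lip A(2) in \<open>auto simp: dist_norm subset_iff simp flip: hyperplane_proj_diff\<close>)
    then have le4: "?H A \<le> ennreal (K ^ ?d) * ?H ?P" by simp
    have KK: "ennreal (K ^ ?d) * ennreal (K ^ ?d) = ennreal (K ^ (2 * ?d))"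
      using K by (simp flip: ennreal_mult power_add add: mult_2)
    have K1: "1 \<le> K ^ ?d" using K by simp
    then have "K ^ ?d \<le> K ^ ?d * K ^ ?d" by (metis mult_left_mono mult.right_neutral order_trans zero_le_one)
    then have K2: "ennreal (K ^ ?d) \<le> ennreal (K ^ (2 * ?d))"
      by (intro ennreal_leI) (simp only: mult_2 power_add)
    have "?H (?F ` A) \<le> ennreal (K ^ (2 * ?d)) * (?J * ?H A)"
      by (rule order_trans[OF le1], intro mult_mono K2 le3) auto
    moreover have "?J * ?H A \<le> ennreal (K ^ (2 * ?d)) * ?H (?F ` A)"
    proof -
      have "?J * ?H A \<le> ?J * (ennreal (K ^ ?d) * ?H ?P)" using le4 by (rule mult_left_mono) simp
      also have "\<dots> = ennreal (K ^ ?d) * (?J * ?H ?P)" by (simp only: ac_simps)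
      also have "\<dots> \<le> ennreal (K ^ ?d) * (ennreal (K ^ ?d) * ?H (?F ` A))"
        using le2 by (rule mult_left_mono) simp
      also have "\<dots> = ennreal (K ^ (2 * ?d)) * ?H (?F ` A)"
        by (simp only: mult.assoc[symmetric] KK)
      finally show ?thesis .
    qed
    ultimately show ?thesis by blast
  qed
  then show ?thesis using \<delta>(1) by blast
qed

text \<open>
  Both sides are measures in \<open>A\<close>: the left one because the graph map has the Borel inverse
  \<open>\<kappa>\<close>, the direction from \<open>p\<close>, so that it is an image measure under \<open>\<kappa>\<close>; the right one by its density. They agree up to
  factors \<open>K\<close> on small pieces, where also the Jacobian is nearly constant.
\<close>
theorem hausdorff_measure_radial_graph:
  fixes r :: "real^'n::finite \<Rightarrow> real" and gr :: "real^'n \<Rightarrow> real^'n" and p :: "real^'n"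
  assumes n: "CARD('n) \<ge> 2" and V: "open V" "U \<subseteq> V"
    and deriv: "\<And>x. x \<in> V \<Longrightarrow> GDERIV r x :> gr x" and cont: "continuous_on V gr"
    and r_meas [measurable]: "r \<in> borel_measurable borel"
    and U: "U \<in> sets borel" "U \<subseteq> sphere 0 1" and pos: "\<And>x. x \<in> U \<Longrightarrow> r x > 0"
    and A: "A \<in> sets borel" "A \<subseteq> U"
  defines "F \<equiv> \<lambda>x. p + r x *\<^sub>R x"
  shows "F ` A \<in> sets borel"
    and "emeasure (hausdorff_measure (CARD('n) - 1)) (F ` A)
       = (\<integral>\<^sup>+x. ennreal (radial_jacobian r gr x) * indicator A x \<partial>hausdorff_measure (CARD('n) - 1))"
proof -
  let ?\<mu> = "hausdorff_measure (CARD('n) - 1) :: (real^'n) measure"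
  let ?H = "hausdorff_outer (CARD('n) - 1) :: (real^'n) set \<Rightarrow> ennreal"
  define \<kappa> where "\<kappa> y = (y - p) /\<^sub>R norm (y - p)" for y :: "real^'n"
  have [measurable]: "\<kappa> \<in> borel_measurable borel" unfolding \<kappa>_def by measurable
  have [measurable]: "F \<in> borel_measurable borel" unfolding F_def by measurable
  note [measurable] = U(1)
  have \<kappa>F: "\<kappa> (F x) = x" if "x \<in> U" for x
    using that U(2) pos[OF that] by (auto simp: \<kappa>_def F_def subset_iff)
  have F_image: "F ` B = {y. F (\<kappa> y) = y} \<inter> (\<kappa> -` B \<inter> space borel)" if "B \<subseteq> U" for B
  proof safe
    fix x assume "x \<in> B"
    then show "F (\<kappa> (F x)) = F x" "F x \<in> \<kappa> -` B" using \<kappa>F that by auto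
  next
    fix y assume "F (\<kappa> y) = y" "\<kappa> y \<in> B"
    then show "y \<in> F ` B" by (metis image_eqI)
  qed simp
  have F_borel: "F ` B \<in> sets borel" if [measurable]: "B \<in> sets borel" and "B \<subseteq> U" for B
    unfolding F_image[OF that(2)] by measurable
  then show "F ` A \<in> sets borel" using A by blast
  define \<mu>F where "\<mu>F = distr (density ?\<mu> (indicator (F ` U))) borel \<kappa>"
  define \<mu>J where "\<mu>J = density ?\<mu> (\<lambda>x. ennreal (radial_jacobian r gr x) * indicator U x)"
  have FU [measurable]: "F ` U \<in> sets borel" by (rule F_borel) (use U in auto)
  have gr_meas [measurable]: "(\<lambda>x. ennreal (radial_jacobian r gr x) * indicator U x) \<in> borel_measurable borel"
  proof -
    have "continuous_on U (radial_jacobian r gr)"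
    proof -
      have "continuous_on V r"
        by (intro continuous_at_imp_continuous_on ballI has_derivative_continuous[OF deriv[unfolded gderiv_def]])
      then have "continuous_on U r" "continuous_on U gr" using V(2) cont continuous_on_subset by blast+
      moreover have "\<forall>x\<in>U. r x \<noteq> 0" using pos by (metis less_irrefl)
      ultimately show ?thesis
        unfolding radial_jacobian_def[abs_def] hyperplane_proj_def by (intro continuous_intros)
    qed
    then have "(\<lambda>x. if x \<in> U then radial_jacobian r gr x else 0) \<in> borel_measurable borel"
      by (rule borel_measurable_continuous_on_if[OF U(1)]) (rule continuous_on_const)
    then have "(\<lambda>x. ennreal (if x \<in> U then radial_jacobian r gr x else 0)) \<in> borel_measurable borel" by measurable
    also have "(\<lambda>x. ennreal (if x \<in> U then radial_jacobian r gr x else 0))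
        = (\<lambda>x. ennreal (radial_jacobian r gr x) * indicator U x)"
      by (auto simp: fun_eq_iff)
    finally show ?thesis .
  qed
  have \<mu>F: "emeasure \<mu>F B = ?H (F ` B)" if B: "B \<in> sets borel" "B \<subseteq> U" for B
  proof -
    note [measurable] = B(1)
    have X [measurable]: "\<kappa> -` B \<inter> space borel \<in> sets borel" by measurable
    have "emeasure \<mu>F B = emeasure (density ?\<mu> (indicator (F ` U))) (\<kappa> -` B \<inter> space borel)"
      unfolding \<mu>F_def by (subst emeasure_distr) simp_all
    also have "\<dots> = (\<integral>\<^sup>+x. indicator (F ` U) x * indicator (\<kappa> -` B \<inter> space borel) x \<partial>?\<mu>)"
      by (rule emeasure_density) (use X in simp_all)
    also have "\<dots> = emeasure ?\<mu> (F ` U \<inter> (\<kappa> -` B \<inter> space borel))"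
      unfolding indicator_inter_arith[symmetric] by (rule nn_integral_indicator) (use FU X in simp)
    also have "F ` U \<inter> (\<kappa> -` B \<inter> space borel) = F ` B"
      unfolding F_image[OF B(2)] F_image[OF order_refl] using B(2) by auto
    finally show ?thesis using F_borel[OF B] by (simp add: emeasure_hausdorff_measure)
  qed
  have \<mu>J: "emeasure \<mu>J B = (\<integral>\<^sup>+x. ennreal (radial_jacobian r gr x) * indicator B x \<partial>?\<mu>)"
    if B: "B \<in> sets borel" "B \<subseteq> U" for B
  proof -
    have "emeasure \<mu>J B = (\<integral>\<^sup>+x. ennreal (radial_jacobian r gr x) * indicator U x * indicator B x \<partial>?\<mu>)"
      unfolding \<mu>J_def using B by (intro emeasure_density) auto
    also have "\<dots> = (\<integral>\<^sup>+x. ennreal (radial_jacobian r gr x) * indicator B x \<partial>?\<mu>)"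
      using B(2) by (intro nn_integral_cong) (auto split: split_indicator)
    finally show ?thesis .
  qed
  have "emeasure \<mu>F A = emeasure \<mu>J A"
  proof (rule emeasure_eq_of_local_comparison[OF _ _ _ A])
    fix K :: real and \<omega> assume K: "K > 1" and \<omega>U: "\<omega> \<in> U"
    let ?J = "radial_jacobian r gr"
    \<comment> \<open>the local area estimate costs \<open>k\<close> to the power \<open>2 (n-1)\<close>, and the variation of the Jacobian one more \<open>k\<close>\<close>
    define k where "k = root (2 * (CARD('n) - 1) + 1) K"
    have k: "k > 1" "k ^ (2 * (CARD('n) - 1)) * k = K"
    proof -
      show "k > 1" using K by (simp add: k_def real_root_gt_1_iff)
      have "k ^ (2 * (CARD('n) - 1) + 1) = K"
        unfolding k_def by (rule real_root_pow_pos2) (use K in auto)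
      then show "k ^ (2 * (CARD('n) - 1)) * k = K" by (simp only: power_add power_one_right)
    qed
    have \<omega>: "norm \<omega> = 1" "\<omega> \<in> V" using U(2) V(2) \<omega>U by auto
    have Jpos: "?J \<omega> > 0" using pos[OF \<omega>U] by (rule radial_jacobian_pos)
    obtain d1 where d1: "d1 > 0" and area: "\<And>B. B \<in> sets borel \<Longrightarrow> B \<subseteq> sphere 0 1 \<inter> ball \<omega> d1 \<Longrightarrow>
        ?H (F ` B) \<le> ennreal (k ^ (2 * (CARD('n) - 1))) * (ennreal (?J \<omega>) * ?H B)
      \<and> ennreal (?J \<omega>) * ?H B \<le> ennreal (k ^ (2 * (CARD('n) - 1))) * ?H (F ` B)"
      using radial_graph_local_area[OF n V(1) \<omega>(2) deriv cont \<omega>(1) pos[OF \<omega>U] k(1), of p] unfolding F_def by blast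
    have "isCont ?J \<omega>"
    proof -
      have "isCont r \<omega>" using deriv[OF \<omega>(2)] unfolding gderiv_def by (rule has_derivative_continuous)
      moreover have "isCont gr \<omega>" using V \<omega> cont by (simp add: continuous_on_eq_continuous_at)
      ultimately show ?thesis
        unfolding radial_jacobian_def[abs_def] hyperplane_proj_def using pos[OF \<omega>U] by (intro continuous_intros) auto
    qed
    then have "(?J \<longlongrightarrow> ?J \<omega>) (nhds \<omega>)" unfolding isCont_def tendsto_at_iff_tendsto_nhds .
    then have "\<forall>\<^sub>F x in nhds \<omega>. ?J x < k * ?J \<omega>" "\<forall>\<^sub>F x in nhds \<omega>. ?J \<omega> / k < ?J x"
      by (rule order_tendstoD; use k Jpos in \<open>simp add: divide_less_eq\<close>)+
    then have "\<forall>\<^sub>F x in nhds \<omega>. ?J x < k * ?J \<omega> \<and> ?J \<omega> / k < ?J x" by (rule eventually_conj)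
    then obtain d2 where d2: "d2 > 0" "\<And>x. dist x \<omega> < d2 \<Longrightarrow> ?J x < k * ?J \<omega> \<and> ?J \<omega> / k < ?J x"
      unfolding eventually_nhds_metric by blast
    have "emeasure \<mu>F B \<le> ennreal K * emeasure \<mu>J B \<and> emeasure \<mu>J B \<le> ennreal K * emeasure \<mu>F B"
      if B: "B \<in> sets borel" "B \<subseteq> U \<inter> ball \<omega> (min d1 d2)" for B
    proof -
      have BU: "B \<subseteq> U" and Bd: "B \<subseteq> sphere 0 1 \<inter> ball \<omega> d1" using B(2) U(2) by auto
      have near: "?J x \<le> k * ?J \<omega>" "?J \<omega> \<le> k * ?J x" if "x \<in> B" for x
      proof -
        have "dist x \<omega> < d2" using B(2) that by (auto simp: dist_commute)
        from d2(2)[OF this] k show "?J x \<le> k * ?J \<omega>" "?J \<omega> \<le> k * ?J x" by (auto simp: divide_less_eq mult.commute)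
      qed
      have const: "(\<integral>\<^sup>+x. ennreal c * indicator B x \<partial>?\<mu>) = ennreal c * ?H B" for c
        using B(1) by (simp add: nn_integral_cmult_indicator emeasure_hausdorff_measure)
      have "emeasure \<mu>J B \<le> (\<integral>\<^sup>+x. ennreal (k * ?J \<omega>) * indicator B x \<partial>?\<mu>)"
        unfolding \<mu>J[OF B(1) BU] using near by (intro nn_integral_mono) (auto split: split_indicator intro!: ennreal_leI)
      then have J1: "emeasure \<mu>J B \<le> ennreal k * (ennreal (?J \<omega>) * ?H B)"
        unfolding const using k Jpos by (simp add: ennreal_mult mult.assoc)
      have J2: "ennreal (?J \<omega>) * ?H B \<le> ennreal k * emeasure \<mu>J B"
      proof -
        have "ennreal (?J \<omega>) * ?H B = (\<integral>\<^sup>+x. ennreal (?J \<omega>) * indicator B x \<partial>?\<mu>)" by (rule const[symmetric])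
        also have "\<dots> \<le> (\<integral>\<^sup>+x. ennreal k * (ennreal (?J x) * indicator U x * indicator B x) \<partial>?\<mu>)"
        proof (rule nn_integral_mono)
          fix x
          show "ennreal (?J \<omega>) * indicator B x \<le> ennreal k * (ennreal (?J x) * indicator U x * indicator B x)"
          proof (cases "x \<in> B")
            case True
            then have "?J x > 0" using BU pos radial_jacobian_pos by blast
            then show ?thesis using True near(2)[OF True] BU k by (auto simp flip: ennreal_mult intro!: ennreal_leI)
          qed simp
        qed
        also have "\<dots> = ennreal k * (\<integral>\<^sup>+x. ennreal (?J x) * indicator U x * indicator B x \<partial>?\<mu>)"
          using B(1) by (intro nn_integral_cmult) auto
        also have "(\<integral>\<^sup>+x. ennreal (?J x) * indicator U x * indicator B x \<partial>?\<mu>) = emeasure \<mu>J B"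
          unfolding \<mu>J_def using B(1) by (intro emeasure_density[symmetric]) auto
        finally show ?thesis .
      qed
      let ?k' = "ennreal (k ^ (2 * (CARD('n) - 1)))"
      have kK: "?k' * ennreal k = ennreal K"
        using k by (simp flip: ennreal_mult)
      have "emeasure \<mu>F B \<le> ?k' * (ennreal (?J \<omega>) * ?H B)"
        unfolding \<mu>F[OF B(1) BU] using area[OF B(1) Bd] by blast
      also have "\<dots> \<le> ?k' * (ennreal k * emeasure \<mu>J B)" using J2 by (rule mult_left_mono) simp
      also have "\<dots> = ennreal K * emeasure \<mu>J B" by (simp only: mult.assoc[symmetric] kK)
      finally have 1: "emeasure \<mu>F B \<le> ennreal K * emeasure \<mu>J B" .
      have "emeasure \<mu>J B \<le> ennreal k * (?k' * emeasure \<mu>F B)"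
        using area[OF B(1) Bd] unfolding \<mu>F[OF B(1) BU]
        by (intro order_trans[OF J1] mult_left_mono) auto
      also have "\<dots> = ennreal K * emeasure \<mu>F B"
        by (simp only: mult.assoc[symmetric] mult.commute[of "ennreal k"] kK)
      finally show ?thesis using 1 by blast
    qed
    then show "\<exists>\<delta>>0. \<forall>B\<in>sets borel. B \<subseteq> U \<inter> ball \<omega> \<delta> \<longrightarrow>
        emeasure \<mu>F B \<le> ennreal K * emeasure \<mu>J B \<and> emeasure \<mu>J B \<le> ennreal K * emeasure \<mu>F B"
      using d1 d2(1) by (intro exI[of _ "min d1 d2"]) auto
  qed (auto simp: \<mu>F_def \<mu>J_def)
  then show "emeasure ?\<mu> (F ` A) = (\<integral>\<^sup>+x. ennreal (radial_jacobian r gr x) * indicator A x \<partial>?\<mu>)"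
    using \<mu>F[OF A] \<mu>J[OF A] F_borel[OF A] by (simp add: emeasure_hausdorff_measure)
qed

corollary integral_radial_graph:
  fixes r :: "real^'n::finite \<Rightarrow> real" and gr :: "real^'n \<Rightarrow> real^'n" and p :: "real^'n"
  assumes n: "CARD('n) \<ge> 2" and V: "open V" "U \<subseteq> V"
    and deriv: "\<And>x. x \<in> V \<Longrightarrow> GDERIV r x :> gr x" and cont: "continuous_on V gr"
    and r_meas [measurable]: "r \<in> borel_measurable borel"
    and gr_meas [measurable]: "gr \<in> borel_measurable borel"
    and U: "U \<in> sets borel" "U \<subseteq> sphere 0 1" and pos: "\<And>x. x \<in> U \<Longrightarrow> r x > 0"
    and h [measurable]: "h \<in> borel_measurable borel"
  defines "F \<equiv> \<lambda>x. p + r x *\<^sub>R x"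
  shows "F ` U \<in> sets borel"
    and "(LINT y|hausdorff_measure (CARD('n) - 1). indicator (F ` U) y * h y)
       = (LINT x|hausdorff_measure (CARD('n) - 1). indicator U x * (radial_jacobian r gr x * h (F x)) :: real)"
proof -
  let ?\<mu> = "hausdorff_measure (CARD('n) - 1) :: (real^'n) measure"
  let ?J = "radial_jacobian r gr"
  note area = hausdorff_measure_radial_graph[OF n V deriv cont r_meas U pos, of _ p, folded F_def]
  note [measurable] = U(1)
  show FU: "F ` U \<in> sets borel" by (rule area(1)[OF _ _ U(1) order_refl])
  note [measurable] = FU
  have F_meas [measurable]: "F \<in> borel_measurable borel" unfolding F_def by measurable
  have J_meas [measurable]: "?J \<in> borel_measurable borel"
    unfolding radial_jacobian_def[abs_def] hyperplane_proj_def by measurable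
  have "density ?\<mu> (\<lambda>y. ennreal (indicator (F ` U) y))
      = distr (density ?\<mu> (\<lambda>x. ennreal (indicator U x * ?J x))) borel F" (is "?L = ?R")
  proof (rule measure_eqI)
    fix B assume "B \<in> sets ?L"
    then have B [measurable]: "B \<in> sets borel" by simp
    define A where "A = U \<inter> (F -` B \<inter> space borel)"
    have A: "A \<in> sets borel" "A \<subseteq> U" unfolding A_def by measurable
    have "emeasure ?L B = (\<integral>\<^sup>+y. ennreal (indicator (F ` U) y) * indicator B y \<partial>?\<mu>)"
      by (rule emeasure_density) (use B FU in auto)
    also have "\<dots> = (\<integral>\<^sup>+y. indicator (F ` U \<inter> B) y \<partial>?\<mu>)"
      by (rule nn_integral_cong) (auto split: split_indicator)
    also have "\<dots> = emeasure ?\<mu> (F ` U \<inter> B)"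
      by (rule nn_integral_indicator) (use B FU in simp)
    also have "F ` U \<inter> B = F ` A" by (auto simp: A_def)
    also have "emeasure ?\<mu> (F ` A) = (\<integral>\<^sup>+x. ennreal (?J x) * indicator A x \<partial>?\<mu>)"
      by (rule area(2)[OF _ _ A])
    also have "\<dots> = (\<integral>\<^sup>+x. ennreal (indicator U x * ?J x) * indicator (F -` B \<inter> space borel) x \<partial>?\<mu>)"
      by (rule nn_integral_cong) (auto simp: A_def split: split_indicator)
    also have "\<dots> = emeasure (density ?\<mu> (\<lambda>x. ennreal (indicator U x * ?J x))) (F -` B \<inter> space borel)"
      by (rule emeasure_density[symmetric]) (use measurable_sets[OF F_meas B] in simp_all)
    also have "\<dots> = emeasure ?R B"
      by (subst emeasure_distr) simp_all
    finally show "emeasure ?L B = emeasure ?R B" .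
  qed simp
  then have "integral\<^sup>L ?L h = integral\<^sup>L ?R h" by simp
  moreover have "integral\<^sup>L ?L h = (LINT y|?\<mu>. indicator (F ` U) y *\<^sub>R h y)"
    by (rule integral_density) auto
  moreover have "integral\<^sup>L ?R h = (LINT x|density ?\<mu> (\<lambda>x. ennreal (indicator U x * ?J x)). h (F x))"
    by (rule integral_distr) auto
  moreover have "(LINT x|density ?\<mu> (\<lambda>x. ennreal (indicator U x * ?J x)). h (F x))
      = (LINT x|?\<mu>. (indicator U x * ?J x) *\<^sub>R h (F x))"
    by (rule integral_density)
       (auto intro!: AE_I2 split: split_indicator dest: pos radial_jacobian_pos[of r _ gr] less_imp_le)
  ultimately show "(LINT y|?\<mu>. indicator (F ` U) y * h y) = (LINT x|?\<mu>. indicator U x * (?J x * h (F x)))"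
    by (simp add: mult.assoc)
qed

section \<open>Kinematics of a relativistic collision\<close>
lemma energy_sq: "(energy c x)\<^sup>2 = c\<^sup>2 + (norm x)\<^sup>2"
  by (simp add: energy_def)

lemma energy_nonneg: "0 \<le> energy c x"
  by (simp add: energy_def)

lemma energy_minus [simp]: "energy c (- x) = energy c x"
  by (simp add: energy_def)

locale collision =
  fixes c :: real and p q :: "real^'n::finite"
  assumes c_pos: "c > 0" and distinct: "p \<noteq> q"
begin

lemma energy_pos: "0 < energy c x"
  using c_pos by (simp add: energy_def add_pos_nonneg)

lemma norm_less_energy: "norm x < energy c x"
  unfolding energy_def using c_pos by (intro real_less_rsqrt) simp

text \<open>
  The energy is the Euclidean length of \<open>(c, x)\<close>.
\<close>
lemma energy_lipschitz: "energy c x - energy c y \<le> norm (x - y)"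
proof -
  have "norm (c, x) - norm (c, y) \<le> norm ((c, x) - (c, y))" by (rule norm_triangle_ineq2)
  then show ?thesis by (simp add: norm_Pair energy_def)
qed

definition total_energy :: real where "total_energy = energy c p + energy c q"

text \<open>
  Up to the factor \<open>p\<^sup>0 q\<^sup>0\<close>, the difference of the incoming velocities \<open>q / q\<^sup>0\<close> and \<open>p / p\<^sup>0\<close>.
\<close>
definition collision_vector :: "real^'n" where "collision_vector = energy c p *\<^sub>R q - energy c q *\<^sub>R p"

lemma total_energy_pos: "0 < total_energy"
  by (simp add: total_energy_def energy_pos add_pos_pos)

lemma norm_less_total_energy: "norm (p + q) < total_energy"
  unfolding total_energy_def using norm_triangle_ineq[of p q] norm_less_energy[of p] norm_less_energy[of q] by linarith

lemma coll_denom_eq: "coll_denom c p q \<omega> = total_energy\<^sup>2 - (\<omega> \<bullet> (p + q))\<^sup>2"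
  by (simp add: coll_denom_def total_energy_def)

lemma coll_denom_pos: "norm \<omega> = 1 \<Longrightarrow> 0 < coll_denom c p q \<omega>"
proof -
  assume "norm \<omega> = 1"
  then have "\<bar>\<omega> \<bullet> (p + q)\<bar> < total_energy"
    using Cauchy_Schwarz_ineq2[of \<omega> "p + q"] norm_less_total_energy by simp
  then show ?thesis unfolding coll_denom_eq using power_strict_mono[of "\<bar>\<omega> \<bullet> (p + q)\<bar>" total_energy 2] by simp
qed

lemma coll_a_eq: "coll_a c p q \<omega> = 2 * total_energy * (\<omega> \<bullet> collision_vector) / coll_denom c p q \<omega>"
  by (simp add: coll_a_def total_energy_def collision_vector_def)

lemma coll_a_times_denom:
  "norm \<omega> = 1 \<Longrightarrow> coll_a c p q \<omega> * (total_energy\<^sup>2 - (\<omega> \<bullet> (p + q))\<^sup>2) = 2 * total_energy * (\<omega> \<bullet> collision_vector)"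
  using coll_denom_pos[of \<omega>] by (simp add: coll_a_eq coll_denom_eq)

lemma coll_a_minus: "coll_a c p q (- \<omega>) = - coll_a c p q \<omega>"
  by (simp add: coll_a_def coll_denom_def)

lemma post_q_eq: "p + q - post_p c p q \<omega> = post_q c p q \<omega>"
  by (simp add: post_p_def post_q_def)

lemma collision_vector_inner: "\<omega> \<bullet> collision_vector = energy c p * (\<omega> \<bullet> q) - energy c q * (\<omega> \<bullet> p)"
  by (simp add: collision_vector_def inner_diff_right)

lemma norm_sq_shift: "norm \<omega> = 1 \<Longrightarrow> (norm (x + t *\<^sub>R \<omega>))\<^sup>2 = (norm x)\<^sup>2 + 2 * t * (\<omega> \<bullet> x) + t\<^sup>2"
proof -
  assume "norm \<omega> = 1"
  then have "\<omega> \<bullet> \<omega> = 1" by (simp add: dot_square_norm)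
  then show ?thesis
    unfolding power2_norm_eq_inner
    by (simp add: inner_left_distrib inner_right_distrib inner_commute[of x \<omega>] power2_eq_square distrib_left)
qed

text \<open>
  The definition of \<open>a\<close> makes the squares of both sides agree. The signs are the point: if one of the two
  right-hand sides, which add up to the total energy, were negative, the outgoing
  energies would differ by the total energy; but they differ by at most \<open>|p + q|\<close>, which is smaller.
\<close>
lemma post_energies:
  assumes \<omega>: "norm \<omega> = 1"
  shows "energy c (post_p c p q \<omega>) = energy c p + coll_a c p q \<omega> * (\<omega> \<bullet> (p + q)) / total_energy"
    and "energy c (post_q c p q \<omega>) = energy c q - coll_a c p q \<omega> * (\<omega> \<bullet> (p + q)) / total_energy"
proof -
  let ?e = total_energy and ?a = "coll_a c p q \<omega>" and ?m = "\<omega> \<bullet> (p + q)"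
  define P where "P = energy c p + ?a * ?m / ?e"
  define Q where "Q = energy c q - ?a * ?m / ?e"
  have e: "?e > 0" by (rule total_energy_pos)
  have m: "?m = \<omega> \<bullet> p + \<omega> \<bullet> q" by (simp add: inner_right_distrib)
  have "?a * ?a * ?e\<^sup>2 - ?a * ?a * ?m\<^sup>2 = ?a * (2 * ?e * (\<omega> \<bullet> collision_vector))"
    using coll_a_times_denom[OF \<omega>] by (simp add: algebra_simps)
  \<comment> \<open>the defining equation of \<open>a\<close>, multiplied by \<open>a\<close> and cleared of denominators\<close>
  then have key: "?a\<^sup>2 * ?e\<^sup>2 - ?a\<^sup>2 * ?m\<^sup>2 = 2 * ?a * ?e * (energy c p * (\<omega> \<bullet> q) - energy c q * (\<omega> \<bullet> p))"
    by (simp add: power2_eq_square collision_vector_inner ac_simps)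
  have "(P * ?e)\<^sup>2 = (energy c p * ?e + ?a * ?m)\<^sup>2" using e by (simp add: P_def distrib_right)
  also have "\<dots> = ((energy c p)\<^sup>2 + 2 * ?a * (\<omega> \<bullet> p) + ?a\<^sup>2) * ?e\<^sup>2"
    using key unfolding m total_energy_def by (simp add: power2_eq_square algebra_simps)
  also have "(energy c p)\<^sup>2 + 2 * ?a * (\<omega> \<bullet> p) + ?a\<^sup>2 = (energy c (post_p c p q \<omega>))\<^sup>2"
    by (simp add: energy_sq post_p_def norm_sq_shift[OF \<omega>])
  finally have P2: "P\<^sup>2 = (energy c (post_p c p q \<omega>))\<^sup>2" using e by (simp add: power_mult_distrib)
  have "(Q * ?e)\<^sup>2 = (energy c q * ?e - ?a * ?m)\<^sup>2" using e by (simp add: Q_def left_diff_distrib)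
  also have "\<dots> = ((energy c q)\<^sup>2 - 2 * ?a * (\<omega> \<bullet> q) + ?a\<^sup>2) * ?e\<^sup>2"
    using key unfolding m total_energy_def by (simp add: power2_eq_square algebra_simps)
  also have "(energy c q)\<^sup>2 - 2 * ?a * (\<omega> \<bullet> q) + ?a\<^sup>2 = (energy c (post_q c p q \<omega>))\<^sup>2"
    using norm_sq_shift[OF \<omega>, of q "- ?a"] by (simp add: energy_sq post_q_def)
  finally have Q2: "Q\<^sup>2 = (energy c (post_q c p q \<omega>))\<^sup>2" using e by (simp add: power_mult_distrib)
  have PQ: "P + Q = ?e" by (simp add: P_def Q_def total_energy_def)
  have sum: "post_p c p q \<omega> + post_q c p q \<omega> = p + q" by (simp add: post_p_def post_q_def)
  have "energy c (post_q c p q \<omega>) - energy c (post_p c p q \<omega>) < ?e"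
    using energy_lipschitz[of "post_q c p q \<omega>" "- post_p c p q \<omega>"] norm_less_total_energy sum
    by (simp add: add.commute)
  moreover have "energy c (post_p c p q \<omega>) - energy c (post_q c p q \<omega>) < ?e"
    using energy_lipschitz[of "post_p c p q \<omega>" "- post_q c p q \<omega>"] norm_less_total_energy sum
    by simp
  moreover have "\<bar>P\<bar> = energy c (post_p c p q \<omega>)" "\<bar>Q\<bar> = energy c (post_q c p q \<omega>)"
    using P2 Q2 energy_nonneg by (metis abs_of_nonneg real_sqrt_abs)+
  ultimately have "P \<ge> 0" "Q \<ge> 0" using PQ e by linarith+
  then show "energy c (post_p c p q \<omega>) = energy c p + ?a * ?m / ?e"
    and "energy c (post_q c p q \<omega>) = energy c q - ?a * ?m / ?e"
    using \<open>\<bar>P\<bar> = _\<close> \<open>\<bar>Q\<bar> = _\<close> by (simp_all add: P_def Q_def)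
qed

text \<open>
  The function whose zero set is the energy shell, and in which the energy delta is taken.
\<close>
definition energy_gap :: "real^'n \<Rightarrow> real" where
  "energy_gap x = energy c p + energy c q - energy c x - energy c (p + q - x)"

lemma energy_gap_post: "norm \<omega> = 1 \<Longrightarrow> energy_gap (post_p c p q \<omega>) = 0"
  using post_energies[of \<omega>] by (simp add: energy_gap_def post_q_eq)

text \<open>
  On the shell the sum of the two energies is known and, from the difference of their squares, so
  is their difference, as an affine function of \<open>t\<close>. Squaring one of them leaves a quadratic equation in \<open>t\<close>
  with the roots \<open>0\<close> and \<open>a\<close>.
\<close>
lemma energy_gap_ray:
  assumes \<omega>: "norm \<omega> = 1" and gap: "energy_gap (p + t *\<^sub>R \<omega>) = 0" and t: "t \<noteq> 0"
  shows "t = coll_a c p q \<omega>"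
proof -
  let ?e = total_energy and ?m = "\<omega> \<bullet> (p + q)"
  define P where "P = energy c (p + t *\<^sub>R \<omega>)"
  define Q where "Q = energy c (q - t *\<^sub>R \<omega>)"
  have e: "?e > 0" by (rule total_energy_pos)
  have PQ: "P + Q = ?e" using gap by (simp add: energy_gap_def P_def Q_def total_energy_def)
  have P2: "P\<^sup>2 = (energy c p)\<^sup>2 + 2 * t * (\<omega> \<bullet> p) + t\<^sup>2"
    by (simp add: P_def energy_sq norm_sq_shift[OF \<omega>])
  have Q2: "Q\<^sup>2 = (energy c q)\<^sup>2 - 2 * t * (\<omega> \<bullet> q) + t\<^sup>2"
    using norm_sq_shift[OF \<omega>, of q "- t"] by (simp add: Q_def energy_sq)
  have m: "?m = \<omega> \<bullet> p + \<omega> \<bullet> q" by (simp add: inner_right_distrib)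
  have "?e * (P - Q) = P\<^sup>2 - Q\<^sup>2" unfolding PQ[symmetric] by (simp add: power2_eq_square algebra_simps)
  also have "\<dots> = ?e * (energy c p - energy c q) + 2 * t * ?m"
    unfolding P2 Q2 m total_energy_def by (simp add: power2_eq_square algebra_simps)
  finally have diff: "?e * (P - Q) = ?e * (energy c p - energy c q) + 2 * t * ?m" .
  have "?e * (2 * P) = ?e * (P - Q) + ?e * (P + Q)" by (simp add: algebra_simps)
  also have "?e * (P + Q) = ?e * (energy c p + energy c q)" by (simp add: PQ total_energy_def)
  finally have "?e * (2 * P) = ?e * (2 * energy c p) + 2 * t * ?m"
    unfolding diff by (simp add: algebra_simps)
  then have eP: "?e * P = ?e * energy c p + t * ?m" by simp
  have "(?e * P)\<^sup>2 = ?e\<^sup>2 * ((energy c p)\<^sup>2 + 2 * t * (\<omega> \<bullet> p) + t\<^sup>2)" by (simp add: power_mult_distrib P2)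
  then have "t * (t * (?e\<^sup>2 - ?m\<^sup>2)) = t * (2 * ?e * (energy c p * ?m - ?e * (\<omega> \<bullet> p)))"
    unfolding eP by (simp add: power2_eq_square algebra_simps)
  then have "t * (?e\<^sup>2 - ?m\<^sup>2) = 2 * ?e * (energy c p * ?m - ?e * (\<omega> \<bullet> p))" using t by simp
  also have "energy c p * ?m - ?e * (\<omega> \<bullet> p) = \<omega> \<bullet> collision_vector"
    unfolding collision_vector_inner m total_energy_def by (simp add: algebra_simps)
  finally show ?thesis using coll_denom_pos[OF \<omega>] unfolding coll_a_eq by (simp add: coll_denom_eq field_simps)
qed

text \<open>
  Of each pair of opposite directions, which produce the same collision, the one with \<open>a > 0\<close>.
\<close>
definition half_sphere :: "(real^'n) set" where
  "half_sphere = {\<omega> \<in> sphere 0 1. 0 < \<omega> \<bullet> collision_vector}"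

lemma coll_a_pos: "\<omega> \<in> half_sphere \<Longrightarrow> 0 < coll_a c p q \<omega>"
  using coll_denom_pos[of \<omega>] total_energy_pos by (auto simp: half_sphere_def coll_a_eq)

lemma energy_shell:
  "{x. energy_gap x = 0} - {p} = (\<lambda>\<omega>. p + coll_a c p q \<omega> *\<^sub>R \<omega>) ` half_sphere"
proof (intro equalityI subsetI)
  fix x assume "x \<in> {x. energy_gap x = 0} - {p}"
  then have x: "energy_gap x = 0" "x \<noteq> p" by auto
  define \<omega> where "\<omega> = (x - p) /\<^sub>R norm (x - p)"
  have \<omega>: "norm \<omega> = 1" "p + norm (x - p) *\<^sub>R \<omega> = x" using x(2) by (auto simp: \<omega>_def)
  have t: "norm (x - p) = coll_a c p q \<omega>"
    by (rule energy_gap_ray[OF \<omega>(1)]) (use x \<omega>(2) in auto)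
  have "0 < norm (x - p)" using x(2) by simp
  then have "0 < \<omega> \<bullet> collision_vector"
    unfolding t coll_a_eq using coll_denom_pos[OF \<omega>(1)] total_energy_pos
    by (simp add: zero_less_divide_iff zero_less_mult_iff)
  then show "x \<in> (\<lambda>\<omega>. p + coll_a c p q \<omega> *\<^sub>R \<omega>) ` half_sphere"
    using \<omega> t by (intro image_eqI[of _ _ \<omega>]) (auto simp: half_sphere_def)
next
  fix x assume "x \<in> (\<lambda>\<omega>. p + coll_a c p q \<omega> *\<^sub>R \<omega>) ` half_sphere"
  then obtain \<omega> where \<omega>: "\<omega> \<in> half_sphere" "x = p + coll_a c p q \<omega> *\<^sub>R \<omega>" by auto
  then have "energy_gap x = 0"
    using energy_gap_post[of \<omega>] by (simp add: half_sphere_def post_p_def)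
  moreover have "x \<noteq> p" using coll_a_pos[OF \<omega>(1)] \<omega> by (auto simp: half_sphere_def)
  ultimately show "x \<in> {x. energy_gap x = 0} - {p}" by simp
qed

definition gap_gradient :: "real^'n \<Rightarrow> real^'n" where
  "gap_gradient x = (p + q - x) /\<^sub>R energy c (p + q - x) - x /\<^sub>R energy c x"

lemma energy_has_derivative:
  fixes x :: "real^'n"
  shows "((energy c) has_derivative (\<lambda>h. h \<bullet> (x /\<^sub>R energy c x))) (at x)"
proof -
  have pos: "0 < c\<^sup>2 + x \<bullet> x" using c_pos by (simp add: add_pos_nonneg)
  have der: "((\<lambda>x. sqrt (c\<^sup>2 + x \<bullet> x)) has_derivative
      (\<lambda>h. (x \<bullet> h + h \<bullet> x) * (inverse (sqrt (c\<^sup>2 + x \<bullet> x)) / 2))) (at x)"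
    using pos by (auto intro!: derivative_eq_intros simp: fun_eq_iff field_simps)
  have E1: "(\<lambda>h. (x \<bullet> h + h \<bullet> x) * (inverse (sqrt (c\<^sup>2 + x \<bullet> x)) / 2))
      = (\<lambda>h. h \<bullet> (x /\<^sub>R sqrt (c\<^sup>2 + x \<bullet> x)))"
    by (simp add: fun_eq_iff inner_commute)
  have E2: "energy c = (\<lambda>x :: real^'n. sqrt (c\<^sup>2 + x \<bullet> x))"
    by (simp add: energy_def fun_eq_iff power2_norm_eq_inner)
  show ?thesis unfolding E2 using der unfolding E1 .
qed

lemma gap_GDERIV: "GDERIV energy_gap x :> gap_gradient x"
proof -
  let ?A = "x /\<^sub>R energy c x" and ?B = "(p + q - x) /\<^sub>R energy c (p + q - x)"
  have "((\<lambda>x. p + q - x) has_derivative (\<lambda>h. 0 - h)) (at x)"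
    by (intro has_derivative_diff has_derivative_const has_derivative_ident)
  then have "((\<lambda>x. energy c (p + q - x)) has_derivative (\<lambda>h. (0 - h) \<bullet> ?B)) (at x)"
    by (rule has_derivative_compose) (rule energy_has_derivative)
  then have "((\<lambda>x. energy c p + energy c q - energy c x - energy c (p + q - x)) has_derivative
     (\<lambda>h. 0 - h \<bullet> ?A - (0 - h) \<bullet> ?B)) (at x)"
    by (intro has_derivative_diff has_derivative_const energy_has_derivative)
  moreover have "(\<lambda>h. 0 - h \<bullet> ?A - (0 - h) \<bullet> ?B) = (\<lambda>h. h \<bullet> gap_gradient x)"
    unfolding gap_gradient_def by (simp add: fun_eq_iff inner_diff_right algebra_simps)
  ultimately show ?thesis
    unfolding gderiv_def energy_gap_def[abs_def] by (simp only:)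
qed

lemma gradient_energy_gap: "gradient energy_gap x = gap_gradient x"
  unfolding gradient_def
proof (rule the_equality)
  show "GDERIV energy_gap x :> gap_gradient x" by (rule gap_GDERIV)
next
  fix D assume "GDERIV energy_gap x :> D"
  then have "(\<lambda>h. h \<bullet> D) = (\<lambda>h. h \<bullet> gap_gradient x)"
    using gap_GDERIV[of x] unfolding gderiv_def by (rule has_derivative_unique)
  then show "D = gap_gradient x" by (metis vector_eq_ldot)
qed

text \<open>
  The collision reverses the component in direction \<open>\<omega>\<close> of the relative velocity, apart from the product
  of the energies in its denominator.
\<close>
lemma radial_gap_gradient:
  assumes \<omega>: "norm \<omega> = 1"
  shows "\<omega> \<bullet> gap_gradient (post_p c p q \<omega>)
       = - (\<omega> \<bullet> collision_vector) / (energy c (post_p c p q \<omega>) * energy c (post_q c p q \<omega>))"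
proof -
  let ?e = total_energy and ?a = "coll_a c p q \<omega>" and ?m = "\<omega> \<bullet> (p + q)"
  let ?P = "energy c (post_p c p q \<omega>)" and ?Q = "energy c (post_q c p q \<omega>)"
  have e: "?e > 0" by (rule total_energy_pos)
  have \<omega>\<omega>: "\<omega> \<bullet> \<omega> = 1" using \<omega> by (simp add: dot_square_norm)
  have m: "?m = \<omega> \<bullet> p + \<omega> \<bullet> q" by (simp add: inner_right_distrib)
  define k where "k = ?a * ?m / ?e"
  have ke: "k * ?e = ?a * ?m" using e by (simp add: k_def)
  have P: "?P = energy c p + k" and Q: "?Q = energy c q - k" unfolding k_def by (rule post_energies[OF \<omega>])+
  have "?e * (?P * (\<omega> \<bullet> q - ?a) - ?Q * (\<omega> \<bullet> p + ?a)) = ?e * (\<omega> \<bullet> collision_vector) + (k * ?e) * ?m - ?a * ?e\<^sup>2"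
    unfolding P Q collision_vector_inner m by (simp add: total_energy_def power2_eq_square algebra_simps)
  also have "\<dots> = ?e * (\<omega> \<bullet> collision_vector) - ?a * (?e\<^sup>2 - ?m\<^sup>2)"
    unfolding ke by (simp add: power2_eq_square algebra_simps)
  also have "\<dots> = ?e * (- (\<omega> \<bullet> collision_vector))"
    unfolding coll_a_times_denom[OF \<omega>] by simp
  finally have num: "?P * (\<omega> \<bullet> q - ?a) - ?Q * (\<omega> \<bullet> p + ?a) = - (\<omega> \<bullet> collision_vector)"
    using e by (simp only: mult_cancel_left) simp
  have "\<omega> \<bullet> gap_gradient (post_p c p q \<omega>) = (\<omega> \<bullet> q - ?a) / ?Q - (\<omega> \<bullet> p + ?a) / ?P"
    unfolding gap_gradient_def post_q_eq using \<omega>\<omega>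
    by (simp add: inner_diff_right inner_right_distrib post_p_def post_q_def divide_inverse mult.commute)
  also have "\<dots> = (?P * (\<omega> \<bullet> q - ?a) - ?Q * (\<omega> \<bullet> p + ?a)) / (?P * ?Q)"
    using energy_pos[of "post_p c p q \<omega>"] energy_pos[of "post_q c p q \<omega>"] by (simp add: field_simps)
  finally show ?thesis unfolding num .
qed

definition coll_a_gradient :: "real^'n \<Rightarrow> real^'n" where
  "coll_a_gradient x = (2 * total_energy / coll_denom c p q x) *\<^sub>R collision_vector
     + (4 * total_energy * (x \<bullet> collision_vector) * (x \<bullet> (p + q)) / (coll_denom c p q x)\<^sup>2) *\<^sub>R (p + q)"

lemma coll_a_GDERIV:
  assumes "coll_denom c p q x \<noteq> 0"
  shows "GDERIV (coll_a c p q) x :> coll_a_gradient x"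
proof -
  define u where "u = p + q"
  define D where "D = total_energy\<^sup>2 - (x \<bullet> u)\<^sup>2"
  have D: "D \<noteq> 0" "coll_denom c p q x = D" using assms by (simp_all add: coll_denom_eq D_def u_def)
  have "((\<lambda>x. 2 * total_energy * (x \<bullet> collision_vector) / (total_energy\<^sup>2 - (x \<bullet> u)\<^sup>2)) has_derivative
      (\<lambda>h. ((2 * total_energy * (h \<bullet> collision_vector)) * D - (2 * total_energy * (x \<bullet> collision_vector)) * (- (2 * (x \<bullet> u) * (h \<bullet> u)))) / (D * D))) (at x)"
    using D(1) unfolding D_def
    by (auto intro!: derivative_eq_intros simp: fun_eq_iff)
  moreover have "(\<lambda>x. 2 * total_energy * (x \<bullet> collision_vector) / (total_energy\<^sup>2 - (x \<bullet> u)\<^sup>2)) = coll_a c p q"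
    by (simp add: fun_eq_iff coll_a_eq coll_denom_eq u_def)
  moreover have "(\<lambda>h. ((2 * total_energy * (h \<bullet> collision_vector)) * D - (2 * total_energy * (x \<bullet> collision_vector)) * (- (2 * (x \<bullet> u) * (h \<bullet> u)))) / (D * D))
      = (\<lambda>h. h \<bullet> coll_a_gradient x)"
    using D unfolding coll_a_gradient_def u_def[symmetric]
    by (simp add: fun_eq_iff inner_add_right field_simps power2_eq_square)
  ultimately show ?thesis unfolding gderiv_def by simp
qed

text \<open>
  The energy gap vanishes along the image of every great circle through \<open>\<omega>\<close>; this is the derivative of that identity.
  It makes the Jacobian accessible without computing with the gradient of \<open>a\<close>.
\<close>
lemma coll_a_tangency:
  assumes \<omega>: "norm \<omega> = 1" and v: "v \<bullet> \<omega> = 0"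
  shows "coll_a c p q \<omega> * (v \<bullet> gap_gradient (post_p c p q \<omega>))
       + (v \<bullet> coll_a_gradient \<omega>) * (\<omega> \<bullet> gap_gradient (post_p c p q \<omega>)) = 0"
proof (cases "v = 0")
  case False
  define G where "G = gap_gradient (post_p c p q \<omega>)"
  define y where "y = v /\<^sub>R norm v"
  have y: "norm y = 1" "y \<bullet> \<omega> = 0" "v = norm v *\<^sub>R y" using False v by (auto simp: y_def)
  \<comment> \<open>the great circle through \<open>\<omega>\<close> with initial velocity \<open>y\<close>\<close>
  define \<gamma> where "\<gamma> t = cos t *\<^sub>R \<omega> + sin t *\<^sub>R y" for t
  have unit: "norm (\<gamma> t) = 1" for t
  proof -
    have "\<omega> \<bullet> \<omega> = 1" "y \<bullet> y = 1" using \<omega> y(1) by (simp_all add: dot_square_norm)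
    then have "(norm (\<gamma> t))\<^sup>2 = (cos t)\<^sup>2 + (sin t)\<^sup>2"
      using y(2) unfolding power2_norm_eq_inner \<gamma>_def
      by (simp add: inner_left_distrib inner_right_distrib inner_commute[of \<omega> y] power2_eq_square)
    then show ?thesis by (simp add: power2_eq_1_iff) (smt (verit) norm_ge_zero)
  qed
  have \<gamma>0: "\<gamma> 0 = \<omega>" by (simp add: \<gamma>_def)
  have "(\<gamma> has_derivative (\<lambda>h. h *\<^sub>R y)) (at 0)"
    unfolding \<gamma>_def[abs_def] by (auto intro!: derivative_eq_intros)
  moreover have "((\<lambda>x. p + coll_a c p q x *\<^sub>R x) has_derivative
      (\<lambda>h. coll_a c p q \<omega> *\<^sub>R h + (h \<bullet> coll_a_gradient \<omega>) *\<^sub>R \<omega>)) (at (\<gamma> 0))"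
  proof -
    have "(coll_a c p q has_derivative (\<lambda>h. h \<bullet> coll_a_gradient \<omega>)) (at \<omega>)"
      using coll_a_GDERIV[of \<omega>] coll_denom_pos[OF \<omega>] by (simp add: gderiv_def)
    then have "((\<lambda>x. p + coll_a c p q x *\<^sub>R x) has_derivative
      (\<lambda>h. 0 + (coll_a c p q \<omega> *\<^sub>R h + (h \<bullet> coll_a_gradient \<omega>) *\<^sub>R \<omega>))) (at \<omega>)"
      by (intro has_derivative_add has_derivative_const has_derivative_scaleR has_derivative_ident)
    then show ?thesis by (simp add: \<gamma>0)
  qed
  ultimately have "((\<lambda>t. p + coll_a c p q (\<gamma> t) *\<^sub>R \<gamma> t) has_derivative
      (\<lambda>h. coll_a c p q \<omega> *\<^sub>R (h *\<^sub>R y) + ((h *\<^sub>R y) \<bullet> coll_a_gradient \<omega>) *\<^sub>R \<omega>)) (at 0)"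
    by (rule has_derivative_compose)
  moreover have "(energy_gap has_derivative (\<lambda>h. h \<bullet> G)) (at (p + coll_a c p q (\<gamma> 0) *\<^sub>R \<gamma> 0))"
    using gap_GDERIV unfolding gderiv_def G_def post_p_def \<gamma>0 .
  ultimately have "((\<lambda>t. energy_gap (p + coll_a c p q (\<gamma> t) *\<^sub>R \<gamma> t)) has_derivative
      (\<lambda>h. (coll_a c p q \<omega> *\<^sub>R (h *\<^sub>R y) + ((h *\<^sub>R y) \<bullet> coll_a_gradient \<omega>) *\<^sub>R \<omega>) \<bullet> G)) (at 0)"
    by (rule has_derivative_compose)
  moreover have "(\<lambda>t. energy_gap (p + coll_a c p q (\<gamma> t) *\<^sub>R \<gamma> t)) = (\<lambda>t. 0)"
    using energy_gap_post[OF unit] by (simp add: post_p_def)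
  ultimately have "((\<lambda>t::real. 0::real) has_derivative
      (\<lambda>h. (coll_a c p q \<omega> *\<^sub>R (h *\<^sub>R y) + ((h *\<^sub>R y) \<bullet> coll_a_gradient \<omega>) *\<^sub>R \<omega>) \<bullet> G)) (at 0)"
    by simp
  then have "(\<lambda>h::real. (coll_a c p q \<omega> *\<^sub>R (h *\<^sub>R y) + ((h *\<^sub>R y) \<bullet> coll_a_gradient \<omega>) *\<^sub>R \<omega>) \<bullet> G) = (\<lambda>h. 0)"
    using has_derivative_const by (rule has_derivative_unique)
  from fun_cong[OF this, of "norm v"] show ?thesis
    unfolding y(3)[symmetric] by (simp add: inner_left_distrib G_def)
qed simp

section \<open>Transfer of the energy delta to the sphere\<close>

lemma open_coll_denom_nonzero: "open {x. coll_denom c p q x \<noteq> 0}"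
  unfolding coll_denom_def by (intro open_Collect_neq continuous_intros)

lemma continuous_on_coll_a_gradient: "continuous_on {x. coll_denom c p q x \<noteq> 0} coll_a_gradient"
  unfolding coll_a_gradient_def coll_denom_eq by (intro continuous_intros) auto

lemma coll_a_borel [measurable]: "coll_a c p q \<in> borel_measurable borel"
  unfolding coll_a_def[abs_def] coll_denom_def by measurable

lemma coll_a_gradient_borel [measurable]: "coll_a_gradient \<in> borel_measurable borel"
  unfolding coll_a_gradient_def[abs_def] coll_denom_def by measurable

lemma half_sphere_borel [measurable]: "half_sphere \<in> sets borel"
proof -
  have "half_sphere = sphere 0 1 \<inter> {\<omega>. 0 < \<omega> \<bullet> collision_vector}" by (auto simp: half_sphere_def)
  also have "\<dots> \<in> sets borel"
    by (intro sets.Int borel_closed borel_open closed_sphere open_Collect_less continuous_intros)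
  finally show ?thesis .
qed

lemma energy_borel [measurable]: "energy c \<in> borel_measurable borel"
  unfolding energy_def[abs_def] by measurable

text \<open>
  Two timelike momenta of equal mass have \<open>p\<^sup>0 q\<^sup>0 - p \<cdot> q > c\<^sup>2\<close> unless they coincide, which makes \<open>\<rho>\<close> positive; this is the
  Cauchy-Schwarz inequality for \<open>p\<close> and \<open>q\<close> together with the positive term \<open>c\<^sup>2 |p - q|\<^sup>2\<close>.
\<close>
lemma rho_sq: "(rho c p q)\<^sup>2 = (norm (p - q))\<^sup>2 - (energy c p - energy c q)\<^sup>2"
  and rho_pos: "0 < rho c p q"
proof -
  have eq: "minkowski (four_momentum c p - four_momentum c q) (four_momentum c p - four_momentum c q)
      = (norm (p - q))\<^sup>2 - (energy c p - energy c q)\<^sup>2"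
    by (simp add: minkowski_def four_momentum_def dot_square_norm power2_eq_square)
  have rel: "energy c p * energy c q - p \<bullet> q > c\<^sup>2"
  proof -
    \<comment> \<open>the excess consists of a positive term and the Cauchy-Schwarz defect\<close>
    have "(energy c p * energy c q)\<^sup>2 = (c\<^sup>2 + p \<bullet> q)\<^sup>2 + c\<^sup>2 * (norm (p - q))\<^sup>2 + ((p \<bullet> p) * (q \<bullet> q) - (p \<bullet> q)\<^sup>2)"
      unfolding power_mult_distrib energy_sq power2_norm_eq_inner
      by (simp add: inner_diff_left inner_diff_right inner_commute[of q p] power2_eq_square algebra_simps)
    moreover have "(p \<bullet> q)\<^sup>2 \<le> (p \<bullet> p) * (q \<bullet> q)" by (rule Cauchy_Schwarz_ineq)
    moreover have "0 < c\<^sup>2 * (norm (p - q))\<^sup>2" using c_pos distinct by simp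
    ultimately have "(c\<^sup>2 + p \<bullet> q)\<^sup>2 < (energy c p * energy c q)\<^sup>2" by linarith
    then have "c\<^sup>2 + p \<bullet> q < energy c p * energy c q"
      by (rule power2_less_imp_less) (simp add: energy_nonneg)
    then show ?thesis by simp
  qed
  have "(norm (p - q))\<^sup>2 - (energy c p - energy c q)\<^sup>2 = 2 * (energy c p * energy c q - p \<bullet> q - c\<^sup>2)"
    unfolding power2_diff energy_sq power2_norm_eq_inner
    by (simp add: inner_diff_left inner_diff_right inner_commute[of q p])
  then have pos: "(norm (p - q))\<^sup>2 - (energy c p - energy c q)\<^sup>2 > 0" using rel by simp
  then show "(rho c p q)\<^sup>2 = (norm (p - q))\<^sup>2 - (energy c p - energy c q)\<^sup>2" "0 < rho c p q"
    by (simp_all add: rho_def eq)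
qed

lemma theta_post:
  assumes \<omega>: "norm \<omega> = 1"
  shows "theta c p q (post_p c p q \<omega>) (post_q c p q \<omega>) = theta_omega c p q \<omega>"
proof -
  let ?e = total_energy and ?a = "coll_a c p q \<omega>" and ?m = "\<omega> \<bullet> (p + q)"
  let ?M = "minkowski (four_momentum c p - four_momentum c q)
     (four_momentum c (post_p c p q \<omega>) - four_momentum c (post_q c p q \<omega>))"
  have e: "?e > 0" by (rule total_energy_pos)
  define k where "k = ?a * ?m / ?e"
  have ke: "k * ?e = ?a * ?m" using e by (simp add: k_def)
  have P: "energy c (post_p c p q \<omega>) = energy c p + k" and Q: "energy c (post_q c p q \<omega>) = energy c q - k"
    unfolding k_def by (rule post_energies[OF \<omega>])+
  have "?M = - ((energy c p - energy c q) * (energy c p - energy c q + 2 * k)) + (p - q) \<bullet> ((p - q) + (2 * ?a) *\<^sub>R \<omega>)"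
    unfolding minkowski_def four_momentum_def
    by (simp add: P Q) (simp add: post_p_def post_q_def algebra_simps scaleR_2 flip: scaleR_add_left)
  also have "\<dots> = (rho c p q)\<^sup>2 + 2 * (?a * ((p - q) \<bullet> \<omega>) - (energy c p - energy c q) * k)"
  proof -
    obtain v where v: "v = p - q" by blast
    show ?thesis
      unfolding rho_sq v[symmetric] power2_norm_eq_inner
      by (simp add: inner_add_right power2_eq_square algebra_simps)
  qed
  finally have M: "?M = (rho c p q)\<^sup>2 + 2 * (?a * ((p - q) \<bullet> \<omega>) - (energy c p - energy c q) * k)" .
  have "?e * (?a * ((p - q) \<bullet> \<omega>) - (energy c p - energy c q) * k)
      = ?a * (?e * ((p - q) \<bullet> \<omega>)) - (energy c p - energy c q) * (k * ?e)" by (simp add: algebra_simps)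
  also have "\<dots> = ?a * (?e * ((p - q) \<bullet> \<omega>) - (energy c p - energy c q) * ?m)"
    unfolding ke by (simp add: algebra_simps)
  also have "?e * ((p - q) \<bullet> \<omega>) - (energy c p - energy c q) * ?m = - 2 * (\<omega> \<bullet> collision_vector)"
    by (simp add: collision_vector_inner total_energy_def inner_diff_left inner_add_right inner_commute[of p \<omega>] inner_commute[of q \<omega>] algebra_simps)
  finally have "?e * (?a * ((p - q) \<bullet> \<omega>) - (energy c p - energy c q) * k) = ?a * (- 2 * (\<omega> \<bullet> collision_vector))" .
  also have "\<dots> = ?e * (- 4 * (\<omega> \<bullet> collision_vector)\<^sup>2 / coll_denom c p q \<omega>)"
    by (simp add: coll_a_eq power2_eq_square)
  finally have "?a * ((p - q) \<bullet> \<omega>) - (energy c p - energy c q) * k = - 4 * (\<omega> \<bullet> collision_vector)\<^sup>2 / coll_denom c p q \<omega>"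
    using e by (simp only: mult_cancel_left) simp
  then have "?M = (rho c p q)\<^sup>2 - 8 * ((\<omega> \<bullet> collision_vector)\<^sup>2 / coll_denom c p q \<omega>)"
    unfolding M by simp
  then have "?M / (rho c p q)\<^sup>2 = 1 - 8 / (rho c p q)\<^sup>2 * ((\<omega> \<bullet> collision_vector)\<^sup>2 / coll_denom c p q \<omega>)"
    using rho_pos by (simp add: diff_divide_distrib)
  then show ?thesis by (simp add: theta_def theta_omega_def collision_vector_def)
qed

lemma kernel_numerator:
  "energy c p * energy c q * \<bar>\<omega> \<bullet> (p /\<^sub>R energy c p - q /\<^sub>R energy c q)\<bar> = \<bar>\<omega> \<bullet> collision_vector\<bar>"
proof -
  have "energy c p * energy c q * \<bar>\<omega> \<bullet> (p /\<^sub>R energy c p - q /\<^sub>R energy c q)\<bar>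
      = \<bar>energy c p * energy c q * (\<omega> \<bullet> (p /\<^sub>R energy c p - q /\<^sub>R energy c q))\<bar>"
    using energy_pos[of p] energy_pos[of q] by (simp add: abs_mult)
  also have "energy c p * energy c q * (\<omega> \<bullet> (p /\<^sub>R energy c p - q /\<^sub>R energy c q)) = - (\<omega> \<bullet> collision_vector)"
    using energy_pos[of p] energy_pos[of q] unfolding collision_vector_inner by (simp add: inner_diff_right field_simps)
  finally show ?thesis by simp
qed

lemma kernel_B_eq: "kernel_B c p q \<omega> = c * total_energy\<^sup>2 * \<bar>\<omega> \<bullet> collision_vector\<bar> / (coll_denom c p q \<omega>)\<^sup>2"
  unfolding kernel_B_def kernel_numerator[symmetric] by (simp add: total_energy_def ac_simps)

lemma kernel_A_eq: "norm \<omega> = 1 \<Longrightarrow> kernel_A c p q \<omega> = 2 * \<bar>coll_a c p q \<omega>\<bar> / rho c p q"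
proof -
  assume \<omega>: "norm \<omega> = 1"
  have "kernel_A c p q \<omega> = total_energy * \<bar>\<omega> \<bullet> collision_vector\<bar> / coll_denom c p q \<omega> * (4 / rho c p q)"
    unfolding kernel_A_def kernel_numerator[symmetric] by (simp add: total_energy_def ac_simps)
  also have "\<dots> = 2 * \<bar>coll_a c p q \<omega>\<bar> / rho c p q"
    using coll_denom_pos[OF \<omega>] total_energy_pos by (simp add: coll_a_eq abs_mult)
  finally show ?thesis .
qed

text \<open>
  The kernel of the theorem in terms of \<open>a\<close>: \<open>B\<close> is \<open>c / 4\<close> times \<open>a\<^sup>2 / (\<omega> \<cdot> (p\<^sup>0 q - q\<^sup>0 p))\<close> and \<open>A\<close> is
  \<open>2 a / \<rho>\<close>, where \<open>\<rho>\<close> is the relative momentum.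
\<close>
lemma kernel_Bn_eq:
  assumes \<omega>: "\<omega> \<in> half_sphere" and n: "CARD('n) \<ge> 2"
  shows "kernel_Bn c p q \<omega>
       = c / 4 * (rho c p q / 2) powi (3 - int CARD('n)) * coll_a c p q \<omega> ^ (CARD('n) - 1) / (\<omega> \<bullet> collision_vector)"
proof -
  let ?a = "coll_a c p q \<omega>" and ?n = "int CARD('n)"
  have \<omega>1: "norm \<omega> = 1" and w: "0 < \<omega> \<bullet> collision_vector" using \<omega> by (auto simp: half_sphere_def)
  have a: "?a > 0" by (rule coll_a_pos[OF \<omega>])
  have r: "rho c p q / 2 > 0" using rho_pos by simp
  have "(coll_a c p q \<omega>)\<^sup>2 = 4 * total_energy\<^sup>2 * (\<omega> \<bullet> collision_vector)\<^sup>2 / (coll_denom c p q \<omega>)\<^sup>2"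
    by (simp add: coll_a_eq power_divide power_mult_distrib)
  then have B: "kernel_B c p q \<omega> = c / 4 * ?a\<^sup>2 / (\<omega> \<bullet> collision_vector)"
    using w by (simp add: kernel_B_eq power2_eq_square)
  have "kernel_A c p q \<omega> = ?a / (rho c p q / 2)" using a by (simp add: kernel_A_eq[OF \<omega>1])
  then have "kernel_A c p q \<omega> powi (?n - 3) = ?a powi (?n - 3) / (rho c p q / 2) powi (?n - 3)"
    by (simp only: power_int_divide_distrib)
  also have "\<dots> = ?a powi (?n - 3) * (rho c p q / 2) powi (- (?n - 3))"
    by (simp only: power_int_minus divide_inverse)
  also have "- (?n - 3) = 3 - ?n" by simp
  finally have A: "kernel_A c p q \<omega> powi (?n - 3) = ?a powi (?n - 3) * (rho c p q / 2) powi (3 - ?n)" .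
  have "?a\<^sup>2 * ?a powi (?n - 3) = ?a powi (2 + (?n - 3))"
    using a by (subst power_int_add) auto
  also have "2 + (?n - 3) = int (CARD('n) - 1)" using n by simp
  also have "?a powi int (CARD('n) - 1) = ?a ^ (CARD('n) - 1)" by (rule power_int_of_nat)
  finally have pow: "?a\<^sup>2 * ?a powi (?n - 3) = ?a ^ (CARD('n) - 1)" .
  show ?thesis unfolding kernel_Bn_def B A pow[symmetric] by (simp add: ac_simps)
qed

text \<open>
  By tangency the tangential gradient of \<open>a\<close>, divided by \<open>a\<close>, is minus the tangential part of the shell
  normal \<open>G\<close> divided by its radial part, so the square root in the Jacobian is \<open>|G| / |\<omega> \<cdot> G|\<close>.
\<close>
lemma radial_jacobian_coll_a:
  assumes \<omega>: "\<omega> \<in> half_sphere"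
  shows "radial_jacobian (coll_a c p q) coll_a_gradient \<omega> =
     coll_a c p q \<omega> ^ (CARD('n) - 1) * (norm (gap_gradient (post_p c p q \<omega>))
       * (energy c (post_p c p q \<omega>) * energy c (post_q c p q \<omega>)) / (\<omega> \<bullet> collision_vector))"
proof -
  let ?a = "coll_a c p q \<omega>"
  define G where "G = gap_gradient (post_p c p q \<omega>)"
  define PQ where "PQ = energy c (post_p c p q \<omega>) * energy c (post_q c p q \<omega>)"
  have PQ: "PQ > 0" unfolding PQ_def by (intro mult_pos_pos energy_pos)
  have \<omega>1: "norm \<omega> = 1" and w: "0 < \<omega> \<bullet> collision_vector" using \<omega> by (auto simp: half_sphere_def)
  have \<omega>\<omega>: "\<omega> \<bullet> \<omega> = 1" using \<omega>1 by (simp add: dot_square_norm)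
  have a: "?a > 0" by (rule coll_a_pos[OF \<omega>])
  have \<omega>G: "\<omega> \<bullet> G = - (\<omega> \<bullet> collision_vector) / PQ"
    unfolding G_def PQ_def by (rule radial_gap_gradient[OF \<omega>1])
  have \<omega>G0: "\<omega> \<bullet> G \<noteq> 0" using w PQ by (simp add: \<omega>G)
  have self_adjoint: "v \<bullet> hyperplane_proj \<omega> x = hyperplane_proj \<omega> v \<bullet> x" for v x
    by (simp add: hyperplane_proj_def inner_diff_left inner_diff_right inner_commute[of x \<omega>])
  have "hyperplane_proj \<omega> (coll_a_gradient \<omega>) /\<^sub>R ?a = (- 1 / (\<omega> \<bullet> G)) *\<^sub>R hyperplane_proj \<omega> G"
  proof (rule vector_eq_ldot[THEN iffD1], rule allI)
    fix v
    have "hyperplane_proj \<omega> v \<bullet> \<omega> = 0"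
      using hyperplane_proj_in_hyperplane[OF \<omega>1, of v] by (simp add: hyperplane_def)
    from coll_a_tangency[OF \<omega>1 this]
    have "(hyperplane_proj \<omega> v \<bullet> coll_a_gradient \<omega>) * (\<omega> \<bullet> G) = - (?a * (hyperplane_proj \<omega> v \<bullet> G))"
      unfolding G_def by linarith
    then have "(hyperplane_proj \<omega> v \<bullet> coll_a_gradient \<omega>) / ?a = - (hyperplane_proj \<omega> v \<bullet> G) / (\<omega> \<bullet> G)"
      using a \<omega>G0 by (simp add: field_simps)
    then show "v \<bullet> (hyperplane_proj \<omega> (coll_a_gradient \<omega>) /\<^sub>R ?a) = v \<bullet> ((- 1 / (\<omega> \<bullet> G)) *\<^sub>R hyperplane_proj \<omega> G)"
      by (simp add: self_adjoint divide_inverse mult.commute)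
  qed
  then have "(norm (hyperplane_proj \<omega> (coll_a_gradient \<omega>) /\<^sub>R ?a))\<^sup>2 = (norm (hyperplane_proj \<omega> G))\<^sup>2 / (\<omega> \<bullet> G)\<^sup>2"
    by (simp add: power_divide power_mult_distrib)
  also have "(norm (hyperplane_proj \<omega> G))\<^sup>2 = (norm G)\<^sup>2 - (\<omega> \<bullet> G)\<^sup>2"
    using \<omega>\<omega> unfolding power2_norm_eq_inner hyperplane_proj_def
    by (simp add: inner_diff_left inner_diff_right inner_commute[of G \<omega>] power2_eq_square)
  finally have "1 + (norm (hyperplane_proj \<omega> (coll_a_gradient \<omega>) /\<^sub>R ?a))\<^sup>2 = (norm G)\<^sup>2 / (\<omega> \<bullet> G)\<^sup>2"
    using \<omega>G0 by (simp add: diff_divide_distrib)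
  then have "sqrt (1 + (norm (hyperplane_proj \<omega> (coll_a_gradient \<omega>) /\<^sub>R ?a))\<^sup>2) = norm G / \<bar>\<omega> \<bullet> G\<bar>"
    by (simp add: real_sqrt_divide)
  also have "\<bar>\<omega> \<bullet> G\<bar> = (\<omega> \<bullet> collision_vector) / PQ" using w PQ by (simp add: \<omega>G)
  finally show ?thesis
    unfolding radial_jacobian_def G_def[symmetric] PQ_def[symmetric] by simp
qed

lemma gap_gradient_post_nonzero:
  assumes "\<omega> \<in> half_sphere" shows "gap_gradient (post_p c p q \<omega>) \<noteq> 0"
proof
  assume "gap_gradient (post_p c p q \<omega>) = 0"
  then have "\<omega> \<bullet> collision_vector / (energy c (post_p c p q \<omega>) * energy c (post_q c p q \<omega>)) = 0"
    using radial_gap_gradient[of \<omega>] assms by (simp add: half_sphere_def)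
  then show False
    using assms energy_pos[of "post_p c p q \<omega>"] energy_pos[of "post_q c p q \<omega>"]
    by (auto simp: half_sphere_def)
qed

text \<open>
  The energy delta as a measure on directions. The gradient of the energy gap, which
  the delta measure divides by, cancels against the one in the Jacobian of the radial graph.
\<close>
lemma integral_delta_level_energy_gap:
  assumes n: "CARD('n) \<ge> 2" and h [measurable]: "h \<in> borel_measurable borel"
  shows "(LINT x|delta_level energy_gap. h x) =
    (LINT \<omega>|hausdorff_measure (CARD('n) - 1). indicator half_sphere \<omega> *
       (coll_a c p q \<omega> ^ (CARD('n) - 1) * (energy c (post_p c p q \<omega>) * energy c (post_q c p q \<omega>))
          / (\<omega> \<bullet> collision_vector) * h (post_p c p q \<omega>)) :: real)"
proof -
  let ?\<mu> = "hausdorff_measure (CARD('n) - 1) :: (real^'n) measure"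
  let ?E = "{x. energy_gap x = 0}"
  have [measurable]: "energy_gap \<in> borel_measurable borel"
    unfolding energy_gap_def[abs_def] by measurable
  have [measurable]: "gap_gradient \<in> borel_measurable borel"
    unfolding gap_gradient_def[abs_def] by measurable
  have E [measurable]: "?E \<in> sets borel" by measurable
  define k where "k x = 1 / norm (gap_gradient x) * h x" for x
  have k [measurable]: "k \<in> borel_measurable borel" unfolding k_def by measurable
  have "(LINT x|delta_level energy_gap. h x)
      = (LINT x|restrict_space ?\<mu> ?E. (1 / norm (gap_gradient x)) *\<^sub>R h x)"
    unfolding delta_level_def gradient_energy_gap
    by (rule integral_density) (auto intro!: measurable_restrict_space1)
  also have "\<dots> = (LINT x|?\<mu>. indicator ?E x *\<^sub>R k x)"
    by (subst integral_restrict_space) (use E in \<open>auto simp: k_def\<close>)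
  also have "\<dots> = (LINT x|?\<mu>. indicator (?E - {p}) x * k x)"
  proof (rule integral_cong_AE)
    \<comment> \<open>the point \<open>p\<close> itself is not reached by the graph; it is a null set as \<open>n - 1 > 0\<close>\<close>
    have "{p} \<in> null_sets ?\<mu>" using n by (auto intro!: null_setsI hausdorff_measure_singleton)
    then have "AE x in ?\<mu>. x \<notin> {p}" by (rule AE_not_in)
    then show "AE x in ?\<mu>. indicator ?E x *\<^sub>R k x = indicator (?E - {p}) x * k x"
      by (rule AE_mp) (auto intro!: AE_I2 split: split_indicator)
  qed measurable
  also have "\<dots> = (LINT \<omega>|?\<mu>. indicator half_sphere \<omega> *
      (radial_jacobian (coll_a c p q) coll_a_gradient \<omega> * k (p + coll_a c p q \<omega> *\<^sub>R \<omega>)))"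
    unfolding energy_shell
  proof (rule integral_radial_graph(2)[OF n open_coll_denom_nonzero])
    show "half_sphere \<subseteq> {x. coll_denom c p q x \<noteq> 0}"
      using coll_denom_pos by (force simp: half_sphere_def)
    show "half_sphere \<subseteq> sphere 0 1" by (auto simp: half_sphere_def)
  qed (auto intro: coll_a_GDERIV continuous_on_coll_a_gradient coll_a_pos)
  also have "\<dots> = (LINT \<omega>|?\<mu>. indicator half_sphere \<omega> *
       (coll_a c p q \<omega> ^ (CARD('n) - 1) * (energy c (post_p c p q \<omega>) * energy c (post_q c p q \<omega>))
          / (\<omega> \<bullet> collision_vector) * h (post_p c p q \<omega>)))"
  proof (rule Bochner_Integration.integral_cong[OF refl])
    fix \<omega>
    show "indicator half_sphere \<omega> *
      (radial_jacobian (coll_a c p q) coll_a_gradient \<omega> * k (p + coll_a c p q \<omega> *\<^sub>R \<omega>))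
      = indicator half_sphere \<omega> * (coll_a c p q \<omega> ^ (CARD('n) - 1)
          * (energy c (post_p c p q \<omega>) * energy c (post_q c p q \<omega>)) / (\<omega> \<bullet> collision_vector) * h (post_p c p q \<omega>))"
    proof (cases "\<omega> \<in> half_sphere")
      case True
      then show ?thesis
        using gap_gradient_post_nonzero[OF True]
        by (simp add: radial_jacobian_coll_a k_def post_p_def[symmetric])
    qed simp
  qed
  finally show ?thesis .
qed

lemma post_minus: "post_p c p q (- \<omega>) = post_p c p q \<omega>" "post_q c p q (- \<omega>) = post_q c p q \<omega>"
  by (simp_all add: post_p_def post_q_def coll_a_minus)

lemma kernel_Bn_minus: "kernel_Bn c p q (- \<omega>) = kernel_Bn c p q \<omega>"
  by (simp add: kernel_Bn_def kernel_B_def kernel_A_def coll_denom_def)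

lemma theta_omega_minus: "theta_omega c p q (- \<omega>) = theta_omega c p q \<omega>"
  by (simp add: theta_omega_def coll_denom_def)

lemma kernel_Bn_equator: "\<omega> \<bullet> collision_vector = 0 \<Longrightarrow> kernel_Bn c p q \<omega> = 0"
  by (simp add: kernel_Bn_def kernel_B_eq)

text \<open>
  The equator has to be excluded by a hypothesis on \<open>R\<close>, as it lies in neither of the two open
  halves.
\<close>
lemma integral_sphere_even:
  fixes R :: "real^'n \<Rightarrow> real"
  assumes int: "integrable sphere_measure R"
    and even: "\<And>\<omega>. R (- \<omega>) = R \<omega>" and equator: "\<And>\<omega>. \<omega> \<bullet> collision_vector = 0 \<Longrightarrow> R \<omega> = 0"
  shows "(LINT \<omega>|sphere_measure. R \<omega>)
       = (LINT \<omega>|hausdorff_measure (CARD('n) - 1). indicator half_sphere \<omega> * (2 * R \<omega>))"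
proof -
  let ?\<mu> = "hausdorff_measure (CARD('n) - 1) :: (real^'n) measure"
  let ?S = "sphere (0 :: real^'n) 1"
  have S: "?S \<inter> space ?\<mu> \<in> sets ?\<mu>" by (simp add: borel_closed)
  define f where "f \<omega> = indicator half_sphere \<omega> * R \<omega>" for \<omega>
  have "integrable ?\<mu> (\<lambda>\<omega>. indicator ?S \<omega> *\<^sub>R R \<omega>)"
    using int unfolding sphere_measure_def by (subst (asm) integrable_restrict_space[OF S])
  then have "integrable ?\<mu> (\<lambda>\<omega>. indicator half_sphere \<omega> *\<^sub>R (indicator ?S \<omega> *\<^sub>R R \<omega>))"
    by (rule integrable_mult_indicator[rotated]) simp
  moreover have "(\<lambda>\<omega>. indicator half_sphere \<omega> *\<^sub>R (indicator ?S \<omega> *\<^sub>R R \<omega>)) = f"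
    by (auto simp: fun_eq_iff f_def half_sphere_def split: split_indicator)
  ultimately have f: "integrable ?\<mu> f" by (simp only:)
  have m: "uminus \<in> measurable ?\<mu> borel"
    by (subst measurable_cong_sets[OF sets_hausdorff_measure refl])
       (intro borel_measurable_continuous_onI continuous_intros)
  have fm: "f \<in> borel_measurable borel"
    using borel_measurable_integrable[OF f] by (simp cong: measurable_cong_sets)
  have fd: "integrable (distr ?\<mu> borel uminus) f" using f by (simp add: hausdorff_measure_uminus)
  have f': "integrable ?\<mu> (\<lambda>\<omega>. f (- \<omega>))"
    using fd by (subst (asm) integrable_distr_eq[OF m fm])
  have "(LINT \<omega>|sphere_measure. R \<omega>) = (LINT \<omega>|?\<mu>. indicator ?S \<omega> *\<^sub>R R \<omega>)"
    unfolding sphere_measure_def by (rule integral_restrict_space[OF S])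
  also have "\<dots> = (LINT \<omega>|?\<mu>. f \<omega> + f (- \<omega>))"
  proof (rule Bochner_Integration.integral_cong[OF refl])
    fix \<omega>
    show "indicator ?S \<omega> *\<^sub>R R \<omega> = f \<omega> + f (- \<omega>)"
      using equator[of \<omega>] even[of \<omega>]
      by (cases "\<omega> \<bullet> collision_vector" "0 :: real" rule: linorder_cases)
         (auto simp: f_def half_sphere_def split: split_indicator)
  qed
  also have "\<dots> = (LINT \<omega>|?\<mu>. f \<omega>) + (LINT \<omega>|?\<mu>. f (- \<omega>))"
    by (rule Bochner_Integration.integral_add[OF f f'])
  also have "(LINT \<omega>|?\<mu>. f (- \<omega>)) = (LINT \<omega>|distr ?\<mu> borel uminus. f \<omega>)"
    by (rule integral_distr[OF m fm, symmetric])
  also have "distr ?\<mu> borel uminus = ?\<mu>" by (rule hausdorff_measure_uminus)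
  also have "(LINT \<omega>|?\<mu>. f \<omega>) + (LINT \<omega>|?\<mu>. f \<omega>) = (LINT \<omega>|?\<mu>. 2 * f \<omega>)" by simp
  also have "\<dots> = (LINT \<omega>|?\<mu>. indicator half_sphere \<omega> * (2 * R \<omega>))"
    by (rule Bochner_Integration.integral_cong[OF refl]) (simp add: f_def)
  finally show ?thesis .
qed

text \<open>
  The two integrands agree pointwise on the half sphere, the left one with the factor \<open>1/2\<close> of the transition rate
  against the factor \<open>1/4\<close> in the kernel; the resulting factor \<open>2\<close> accounts for the other half.
\<close>
lemma collision_integral_identity:
  assumes n: "CARD('n) \<ge> 2"
    and f: "integrable (collision_delta c p q)
           (\<lambda>(p', q'). 1 / energy c q' * (1 / energy c p') * W_factor c \<sigma> p q p' q' * G p q p' q')"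
    and R: "integrable sphere_measure
           (\<lambda>\<omega>. mandelstam_s c p q * \<sigma> (rho c p q) (theta_omega c p q \<omega>)
                  / (energy c p * energy c q)
                * kernel_Bn c p q \<omega> * G p q (post_p c p q \<omega>) (post_q c p q \<omega>))"
  shows "c / (energy c p * energy c q)
           * (LINT (p', q')|collision_delta c p q.
                1 / energy c q' * (1 / energy c p') * W_factor c \<sigma> p q p' q' * G p q p' q')
         = (LINT \<omega>|sphere_measure.
              mandelstam_s c p q * \<sigma> (rho c p q) (theta_omega c p q \<omega>)
                / (energy c p * energy c q)
              * kernel_Bn c p q \<omega> * G p q (post_p c p q \<omega>) (post_q c p q \<omega>))"
proof -
  let ?\<mu> = "hausdorff_measure (CARD('n) - 1) :: (real^'n) measure"
  let ?pq = "energy c p * energy c q"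
  define F where "F = (\<lambda>(p', q'). 1 / energy c q' * (1 / energy c p') * W_factor c \<sigma> p q p' q' * G p q p' q')"
  define R' where "R' \<omega> = mandelstam_s c p q * \<sigma> (rho c p q) (theta_omega c p q \<omega>) / ?pq
                * kernel_Bn c p q \<omega> * G p q (post_p c p q \<omega>) (post_q c p q \<omega>)" for \<omega>
  have Fm: "F \<in> borel_measurable borel"
    using borel_measurable_integrable[OF f] unfolding F_def collision_delta_def by (simp cong: measurable_cong_sets)
  have pair: "(\<lambda>p'. (p', p + q - p')) \<in> borel_measurable borel"
    by (intro borel_measurable_continuous_onI continuous_intros)
  have hm: "(\<lambda>p'. F (p', p + q - p')) \<in> borel_measurable borel"
    by (rule measurable_compose[OF pair Fm])
  have delta: "collision_delta c p q = distr (delta_level energy_gap) borel (\<lambda>p'. (p', p + q - p'))"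
    by (simp add: collision_delta_def energy_gap_def[abs_def])
  have pair': "(\<lambda>p'. (p', p + q - p')) \<in> measurable (delta_level energy_gap) borel"
  proof -
    have "(\<lambda>p'. (p', p + q - p')) \<in> measurable ?\<mu> borel"
      using pair by (simp cong: measurable_cong_sets)
    then show ?thesis
      unfolding delta_level_def by (simp add: measurable_restrict_space1)
  qed
  have "c / ?pq * integral\<^sup>L (collision_delta c p q) F
      = c / ?pq * (LINT p'|delta_level energy_gap. F (p', p + q - p'))"
    unfolding delta by (subst integral_distr[OF pair' Fm]) (rule refl)
  also have "\<dots> = (LINT \<omega>|?\<mu>. c / ?pq * (indicator half_sphere \<omega> *
       (coll_a c p q \<omega> ^ (CARD('n) - 1) * (energy c (post_p c p q \<omega>) * energy c (post_q c p q \<omega>))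
          / (\<omega> \<bullet> collision_vector) * F (post_p c p q \<omega>, post_q c p q \<omega>))))"
    unfolding integral_delta_level_energy_gap[OF n hm] post_q_eq
    by (rule Bochner_Integration.integral_mult_right_zero[symmetric])
  also have "\<dots> = (LINT \<omega>|?\<mu>. indicator half_sphere \<omega> * (2 * R' \<omega>))"
  proof (rule Bochner_Integration.integral_cong[OF refl])
    fix \<omega>
    show "c / ?pq * (indicator half_sphere \<omega> *
       (coll_a c p q \<omega> ^ (CARD('n) - 1) * (energy c (post_p c p q \<omega>) * energy c (post_q c p q \<omega>))
          / (\<omega> \<bullet> collision_vector) * F (post_p c p q \<omega>, post_q c p q \<omega>)))
      = indicator half_sphere \<omega> * (2 * R' \<omega>)"
    proof (cases "\<omega> \<in> half_sphere")
      case True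
      then have \<omega>: "norm \<omega> = 1" by (simp add: half_sphere_def)
      have "energy c (post_p c p q \<omega>) \<noteq> 0" "energy c (post_q c p q \<omega>) \<noteq> 0"
        using energy_pos less_imp_neq by metis+
      then show ?thesis
        using True by (simp add: F_def R'_def W_factor_def theta_post[OF \<omega>] kernel_Bn_eq[OF True n] ac_simps)
    qed simp
  qed
  also have "\<dots> = (LINT \<omega>|sphere_measure. R' \<omega>)"
    by (rule integral_sphere_even[symmetric])
       (use R in \<open>auto simp: R'_def post_minus kernel_Bn_minus theta_omega_minus kernel_Bn_equator\<close>)
  finally show ?thesis unfolding F_def R'_def .
qed

end

theorem theorem4:
  fixes c :: real and p q :: "real ^ 'n"
    and \<sigma> :: "real \<Rightarrow> real \<Rightarrow> real"
    and G :: "real ^ 'n \<Rightarrow> real ^ 'n \<Rightarrow> real ^ 'n \<Rightarrow> real ^ 'n \<Rightarrow> real"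
  assumes "CARD('n) \<ge> 2" and "c > 0" and "p \<noteq> q"
    and "(\<lambda>(r, t). \<sigma> r t) \<in> borel_measurable borel"
    and "(\<lambda>(x, y, x', y'). G x y x' y') \<in> borel_measurable borel"
    and "integrable (collision_delta c p q)
           (\<lambda>(p', q'). 1 / energy c q' * (1 / energy c p') * W_factor c \<sigma> p q p' q' * G p q p' q')"
    and "integrable sphere_measure
           (\<lambda>\<omega>. mandelstam_s c p q * \<sigma> (rho c p q) (theta_omega c p q \<omega>)
                  / (energy c p * energy c q)
                * kernel_Bn c p q \<omega> * G p q (post_p c p q \<omega>) (post_q c p q \<omega>))"
  shows "c / (energy c p * energy c q)
           * (LINT (p', q')|collision_delta c p q.
                1 / energy c q' * (1 / energy c p') * W_factor c \<sigma> p q p' q' * G p q p' q')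
         = (LINT \<omega>|sphere_measure.
              mandelstam_s c p q * \<sigma> (rho c p q) (theta_omega c p q \<omega>)
                / (energy c p * energy c q)
              * kernel_Bn c p q \<omega> * G p q (post_p c p q \<omega>) (post_q c p q \<omega>))"
proof -
  interpret collision c p q
    by unfold_locales (use assms(2,3) in auto)
  show ?thesis
    by (rule collision_integral_identity[where \<sigma> = \<sigma> and G = G, OF assms(1,6,7)])
qed

end
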